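(* Suppose that the billiard domain $\mathcal{B}\subset\mathbb{R}^2$ has piecewise smooth boundary with at least one corner having inner angle less than $\pi$. Then, arbitrarily close to that corner point, the no-slip billiard has (linearly) elliptic period-$2$ orbits; i.e. for every neighborhood $W$ of the corner point in the plane there is a period-$2$ state $\xi$ of the no-slip billiard whose orbit projects into $W$ and which is elliptic.
   Context: No-slip planar billiard. A disc of radius $R>0$ with rotationally symmetric mass distribution moves so that its center stays in a closed region $\mathcal{B}\subset\mathbb{R}^2$ (the billiard table) with piecewise smooth boundary. The mass distribution enters through a parameter $\gamma\in(0,1]$ (moment of inertia $=m(\gamma R)^2$, where $m$ is the mass), equivalently the characteristic angle $\beta\in(0,\pi/2]$ with $\gamma=\tan(\beta/2)$. The configuration manifold is $M=\mathcal{B}\times\mathbb{T}$, $\mathbb{T}=\mathbb{R}/(2\pi\gamma R\,\mathbb{Z})$, where the $\mathbb{T}$-coordinate is $x=\gamma R\theta$ and $\theta$ is the disc's angle of orientation; $\partial M=\partial\mathcal{B}\times\mathbb{T}$. Tangent spaces of $M$ are identified with $\mathbb{R}^3$ with the standard inner product. At $q\in\partial M$ lying over a smooth point of $\partial\mathcal{B}$, the product frame $(e_1,e_2(q),e_3(q))$ is the positively oriented orthonormal frame in which $e_1$ is the constant unit vector in the direction of $\mathbb{T}$, $e_2(q)$ is tangent to $\partial\mathcal{B}$, and $e_3(q)$ is the unit normal to $\partial M$ pointing into $M$. The no-slip collision map $C_q:\mathbb{R}^3\to\mathbb{R}^3$ is the linear map whose matrix in the product frame is $$\mathcal{C}=\begin{pmatrix}-\cos\beta&-\sin\beta&0\\-\sin\beta&\cos\beta&0\\0&0&-1\end{pmatrix}.$$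 The phase space is $N=\{(q,v): q\in\partial M,\ v\in\mathbb{R}^3,\ |v|=1,\ \langle v,e_3(q)\rangle>0\}$ (a 4-manifold away from corners). The billiard map is $T(q,v)=(\tilde q,C_{\tilde q}v)$ with $\tilde q=q+tv$, $t=\inf\{s>0:q+sv\in\partial M\}$, where this makes sense and is smooth. A state $\xi\in N$ has period $2$ if $T^2(\xi)=\xi$. For such $\xi$ the eigenvalues of $dT^2_\xi$ on the 4-dimensional space $T_\xi N$ are either all real, of the form $1,1,r,1/r$, or $1,1,\lambda,\overline\lambda$ with $\lambda$ non-real and $|\lambda|=1$; $\xi$ (and its orbit) is called (linearly) elliptic in the latter case, which is equivalent to $|\mathrm{Tr}(dT^2_\xi)-2|<2$.
   Formalization: The formal theorem also assumes that the inner angle φ of the corner satisfies cos φ ≠ γ²; at cos φ = γ² the claim fails for straight sides (e.g. equilateral triangle, uniform disc), where dT² has eigenvalues 1,1,−1,−1; curved corners with that angle are excluded too. *)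

theory Defs
  imports "HOL-Analysis.Analysis"
begin

section \<open>Billiard tables with piecewise smooth boundary\<close>

text \<open>The plane is \<^typ>\<open>complex\<close>, with its standard inner product.
  \<^emph>\<open>Smooth\<close> means infinitely often differentiable, with one-sided derivatives of all
  orders at the end points of \<open>{0..1}\<close>.\<close>

definition smooth_on_unit :: "(real \<Rightarrow> complex) \<Rightarrow> bool" where
  "smooth_on_unit c \<longleftrightarrow>
     (\<exists>d. d 0 = c \<and>
        (\<forall>n::nat. \<forall>t\<in>{0..1}. (d n has_vector_derivative d (Suc n) t) (at t within {0..1})))"

definition velocity :: "(real \<Rightarrow> complex) \<Rightarrow> real \<Rightarrow> complex" where
  "velocity c t = vector_derivative c (at t within {0..1})"

definition smooth_arc :: "(real \<Rightarrow> complex) \<Rightarrow> bool" where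
  "smooth_arc c \<longleftrightarrow> arc c \<and> smooth_on_unit c \<and> (\<forall>t\<in>{0..1}. velocity c t \<noteq> 0)"

definition closed_region :: "complex set \<Rightarrow> bool" where
  "closed_region B \<longleftrightarrow> connected (interior B) \<and> B = closure (interior B)"

text \<open>The family of arcs is only required to be locally finite, so that unbounded tables (such
  as an infinite wedge) are included; for a bounded table it is a finite family.\<close>

definition piecewise_smooth_boundary :: "complex set \<Rightarrow> bool" where
  "piecewise_smooth_boundary B \<longleftrightarrow>
     (\<exists>\<A>. (\<forall>c\<in>\<A>. smooth_arc c) \<and>
          (\<forall>r. finite {c\<in>\<A>. path_image c \<inter> cball 0 r \<noteq> {}}) \<and>
          (\<forall>c\<in>\<A>. \<forall>d\<in>\<A>. c \<noteq> d \<longrightarrow>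
             path_image c \<inter> path_image d
               \<subseteq> {pathstart c, pathfinish c} \<inter> {pathstart d, pathfinish d}) \<and>
          frontier B = (\<Union>c\<in>\<A>. path_image c))"

definition boundary_arc_through :: "complex set \<Rightarrow> complex \<Rightarrow> (real \<Rightarrow> complex) \<Rightarrow> real \<Rightarrow> bool" where
  "boundary_arc_through B p c s \<longleftrightarrow>
     smooth_arc c \<and> 0 < s \<and> s < 1 \<and> c s = p \<and>
     (\<exists>\<epsilon>>0. frontier B \<inter> ball p \<epsilon> = path_image c \<inter> ball p \<epsilon>)"

definition smooth_boundary_point :: "complex set \<Rightarrow> complex \<Rightarrow> bool" where
  "smooth_boundary_point B p \<longleftrightarrow> (\<exists>c s. boundary_arc_through B p c s)"

text \<open>Only meaningful at smooth boundary points.\<close>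

definition inward_normal :: "complex set \<Rightarrow> complex \<Rightarrow> complex" where
  "inward_normal B p =
     (THE n. norm n = 1 \<and>
        (\<exists>c s. boundary_arc_through B p c s \<and> n \<bullet> velocity c s = 0) \<and>
        (\<forall>\<^sub>F t in at_right 0. p + of_real t * n \<in> interior B))"

definition boundary_sides ::
    "complex set \<Rightarrow> complex \<Rightarrow> (real \<Rightarrow> complex) \<Rightarrow> (real \<Rightarrow> complex) \<Rightarrow> bool" where
  "boundary_sides B p a b \<longleftrightarrow>
     smooth_arc a \<and> smooth_arc b \<and> pathstart a = p \<and> pathstart b = p \<and>
     path_image a \<inter> path_image b = {p} \<and>
     (\<exists>\<epsilon>>0. frontier B \<inter> ball p \<epsilon> = (path_image a \<union> path_image b) \<inter> ball p \<epsilon>)"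

text \<open>\<open>p\<close> is a corner of inner angle \<open>\<phi>\<close> if the boundary near \<open>p\<close> consists of two smooth arcs
  \<open>a\<close>, \<open>b\<close> issuing from \<open>p\<close>, and the rays from \<open>p\<close> that enter \<open>B\<close> are those met when turning
  counterclockwise through the angle \<open>\<phi>\<close> from the tangent of \<open>a\<close> to the tangent of \<open>b\<close>.
  The conditions on the rays tell the inner angle from its complement to \<open>2 * pi\<close>;
  the cases \<open>\<phi> = 0\<close> and \<open>\<phi> = 2 * pi\<close> are cusps.\<close>

definition corner_with_inner_angle :: "complex set \<Rightarrow> complex \<Rightarrow> real \<Rightarrow> bool" where
  "corner_with_inner_angle B p \<phi> \<longleftrightarrow>
     0 \<le> \<phi> \<and> \<phi> \<le> 2 * pi \<and> \<phi> \<noteq> pi \<and>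
     (\<exists>a b. boundary_sides B p a b \<and>
        sgn (velocity b 0) = cis \<phi> * sgn (velocity a 0) \<and>
        (\<forall>\<theta>. 0 < \<theta> \<and> \<theta> < \<phi> \<longrightarrow>
           (\<forall>\<^sub>F t in at_right 0. p + of_real t * cis \<theta> * sgn (velocity a 0) \<in> interior B)) \<and>
        (\<forall>\<theta>. \<phi> < \<theta> \<and> \<theta> < 2 * pi \<longrightarrow>
           (\<forall>\<^sub>F t in at_right 0. p + of_real t * cis \<theta> * sgn (velocity a 0) \<notin> B)))"


section \<open>The no-slip billiard map\<close>

text \<open>Both configurations and velocities are elements of \<open>real \<times> complex\<close> (that is, of the
  Euclidean space of dimension 3); the first component belongs to the rotation coordinate
  \<open>x\<close>. The factor \<open>\<real>/(2\<pi>\<gamma>R\<int>)\<close> is represented by its universal cover: a configuration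
  \<open>(x, p)\<close> stands for its class modulo \<open>2 * pi * \<gamma> * R\<close> in the first component. All maps
  below commute with these translations, whose differentials are the identity.\<close>

type_synonym vec3 = "real \<times> complex"
type_synonym state = "vec3 \<times> vec3"

definition characteristic_angle :: "real \<Rightarrow> real" where
  "characteristic_angle \<gamma> = 2 * arctan \<gamma>"

text \<open>The orientation is that of (rotation axis, real axis, imaginary axis), so that
  \<open>(e\<^sub>1, e\<^sub>2, e\<^sub>3)\<close> is positive iff \<open>e\<^sub>3\<close> is \<open>e\<^sub>2\<close> turned by \<open>pi / 2\<close> in the plane.\<close>

definition e1 :: vec3 where "e1 = (1, 0)"

definition e2 :: "complex set \<Rightarrow> vec3 \<Rightarrow> vec3" where
  "e2 B q = (0, - \<i> * inward_normal B (snd q))"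

definition e3 :: "complex set \<Rightarrow> vec3 \<Rightarrow> vec3" where
  "e3 B q = (0, inward_normal B (snd q))"

definition collision :: "complex set \<Rightarrow> real \<Rightarrow> vec3 \<Rightarrow> vec3 \<Rightarrow> vec3" where
  "collision B \<gamma> q v =
     (let \<beta> = characteristic_angle \<gamma>; a = v \<bullet> e1; b = v \<bullet> e2 B q; c = v \<bullet> e3 B q
      in (- cos \<beta> * a - sin \<beta> * b) *\<^sub>R e1
         + (- sin \<beta> * a + cos \<beta> * b) *\<^sub>R e2 B q
         + (- c) *\<^sub>R e3 B q)"

definition boundary_M :: "complex set \<Rightarrow> vec3 set" where
  "boundary_M B = {q. snd q \<in> frontier B}"

definition phase_space :: "complex set \<Rightarrow> state set" where
  "phase_space B =
     {(q, v). q \<in> boundary_M B \<and> smooth_boundary_point B (snd q) \<and> norm v = 1 \<and> v \<bullet> e3 B q > 0}"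

definition hitting_times :: "complex set \<Rightarrow> state \<Rightarrow> real set" where
  "hitting_times B \<xi> = {s. s > 0 \<and> fst \<xi> + s *\<^sub>R snd \<xi> \<in> boundary_M B}"

definition billiard_map :: "complex set \<Rightarrow> real \<Rightarrow> state \<Rightarrow> state" where
  "billiard_map B \<gamma> \<xi> =
     (let q' = fst \<xi> + Inf (hitting_times B \<xi>) *\<^sub>R snd \<xi>
      in (q', collision B \<gamma> q' (snd \<xi>)))"

text \<open>The image lies in the phase space iff the trajectory next meets the boundary
  over a smooth point and transversally; the map is then smooth near \<open>\<xi>\<close>.\<close>

definition billiard_domain :: "complex set \<Rightarrow> real \<Rightarrow> state set" where
  "billiard_domain B \<gamma> =
     {\<xi> \<in> phase_space B. hitting_times B \<xi> \<noteq> {} \<and> billiard_map B \<gamma> \<xi> \<in> phase_space B}"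

definition same_state :: "real \<Rightarrow> real \<Rightarrow> state \<Rightarrow> state \<Rightarrow> bool" where
  "same_state \<gamma> R \<xi> \<eta> \<longleftrightarrow>
     (\<exists>k::int. fst \<eta> = fst \<xi> + (of_int k * (2 * pi * \<gamma> * R)) *\<^sub>R e1) \<and> snd \<eta> = snd \<xi>"

definition period_two :: "complex set \<Rightarrow> real \<Rightarrow> real \<Rightarrow> state \<Rightarrow> bool" where
  "period_two B \<gamma> R \<xi> \<longleftrightarrow>
     \<xi> \<in> billiard_domain B \<gamma> \<and> billiard_map B \<gamma> \<xi> \<in> billiard_domain B \<gamma> \<and>
     same_state \<gamma> R \<xi> ((billiard_map B \<gamma> ^^ 2) \<xi>)"


section \<open>Linear ellipticity\<close>

definition tangent_space :: "complex set \<Rightarrow> state \<Rightarrow> state set" where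
  "tangent_space B \<xi> = {(dq, dv). dq \<bullet> e3 B (fst \<xi>) = 0 \<and> dv \<bullet> snd \<xi> = 0}"

definition matrix_on :: "state set \<Rightarrow> (state \<Rightarrow> state) \<Rightarrow> real^4^4 \<Rightarrow> bool" where
  "matrix_on V D A \<longleftrightarrow>
     (\<exists>b :: 4 \<Rightarrow> state. inj b \<and> independent (range b) \<and> span (range b) = V \<and>
        (\<forall>j. D (b j) = (\<Sum>i\<in>UNIV. A $ i $ j *\<^sub>R b i)))"

text \<open>The characteristic polynomial is \<open>(z - 1)\<^sup>2 (z - \<mu>) (z - cnj \<mu>)\<close>, i.e. the eigenvalues with
  algebraic multiplicity are \<open>1, 1, \<mu>, cnj \<mu>\<close>. A derivative within the phase space is
  determined only on the tangent space, and only this restriction enters. The tangent spaces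
  at \<open>\<xi>\<close> and at a translate of \<open>\<xi>\<close> in the first component coincide.\<close>

definition elliptic :: "complex set \<Rightarrow> real \<Rightarrow> state \<Rightarrow> bool" where
  "elliptic B \<gamma> \<xi> \<longleftrightarrow>
     (\<exists>D A. ((billiard_map B \<gamma> ^^ 2) has_derivative D) (at \<xi> within phase_space B) \<and>
        matrix_on (tangent_space B \<xi>) D A \<and>
        (\<exists>\<mu>::complex. \<mu> \<notin> \<real> \<and> norm \<mu> = 1 \<and>
           (\<forall>z::complex. det (mat z - (\<chi> i j. of_real (A $ i $ j)) :: complex^4^4)
               = (z - 1)^2 * (z - \<mu>) * (z - cnj \<mu>))))"

text \<open>Let two straight sides meet at the inner angle \<open>\<phi> < pi\<close>. For every period-2 orbit
  running between them, \<open>dT\<^sup>2\<close> acts on velocities as the product of two half-turns of the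
  3-space about axes at an angle \<open>\<alpha>\<close>, where
  \<open>cos \<alpha> = (sin (\<beta>/2))\<^sup>2 - (cos (\<beta>/2))\<^sup>2 * cos \<phi>\<close>, so its eigenvalues are
  \<open>1, 1, cis (2 * \<alpha>), cis (- 2 * \<alpha>)\<close>. If \<open>cos \<phi> = (tan (\<beta>/2))\<^sup>2 = \<gamma>\<^sup>2\<close>, these are
  \<open>1, 1, -1, -1\<close> for all such orbits and none of them is elliptic (example: an equilateral
  triangle and the uniform disc, \<open>\<gamma>\<^sup>2 = 1/2\<close>). A theorem on the existence of elliptic orbits
  near every corner therefore has to exclude \<open>cos \<phi> = \<gamma>\<^sup>2\<close>.\<close>

end

theory Submission
  imports Defs
begin

text \<open>Write the billiard map as the composition of the involution "fly to the other side and reverse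
  the velocity" with the involution "apply minus the collision map". The collision map is the
  half-turn about an axis \<open>n\<close> orthogonal to the normal, so the differential of the second involution
  at one of its fixed points is a reflection. At a state of period 2 whose velocity is orthogonal
  to the axes at both ends, \<open>dT\<^sup>2\<close> is therefore a product \<open>(1 - 2 u f) (1 - 2 u' f')\<close> of two
  reflections; its characteristic polynomial is \<open>(z - 1)\<^sup>2 (z\<^sup>2 - (4 c - 2) z + 1)\<close> with
  \<open>c = f u' * f' u\<close>, and the orbit is elliptic iff \<open>0 < c < 1\<close>. The curvature of the boundary
  enters \<open>c\<close> only through terms proportional to the length of the chord. For short chords across
  the corner \<open>c\<close> is thus close to \<open>(n \<bullet> n')\<^sup>2\<close>, that is, to
  \<open>((cos (\<beta>/2))\<^sup>2 cos \<phi> - (sin (\<beta>/2))\<^sup>2)\<^sup>2\<close>, which lies strictly between 0 and 1.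

  Such chords exist arbitrarily close to the corner by the intermediate value theorem. In a frame
  along the bisector both sides are graphs, which treats cusps (\<open>\<phi> = 0\<close>) on the same footing.\<close>


section \<open>Products of two reflections\<close>

text \<open>A velocity orthogonal to both axes is reversed at both ends, so the disc retraces its
  path and period 2 comes for free. Once the chord is fixed, only the spin can still be chosen, and
  both orthogonality conditions are linear in it. Eliminating the spin leaves one scalar equation
  for the two end points, the one that the intermediate value theorem solves.

  The obstacle is uniformity as the chord shrinks. In the error terms the flight time multiplies an
  oblique projection along the velocity, whose norm blows up when the velocity becomes tangent to a
  side. The scalar equation makes the chord nearly perpendicular to the bisector, hence steep
  compared with both sides. The angles with the normals are then bounded below independently of the
  length of the chord, and its shortness wins. Since \<open>0 < c < 1\<close> is an open condition
  that holds strictly in the limit, small errors are harmless; positivity is where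
  \<open>cos \<phi> \<noteq> \<gamma>^2\<close> enters.

  No charts of the phase space are used: every differential is taken in the ambient space, within
  the phase space. Before two of them are composed, nearby states must be shown to stay in the phase
  space.\<close>

lemma det_block_2_id:
  fixes M :: "'a::comm_ring_1^4^4"
  assumes "\<And>i. i \<in> {3, 4} \<Longrightarrow> M $ i $ 1 = 0 \<and> M $ i $ 2 = 0 \<and> M $ 1 $ i = 0 \<and> M $ 2 $ i = 0"
    and "M $ 3 $ 4 = 0" "M $ 4 $ 3 = 0"
  shows "det M = (M $ 1 $ 1 * M $ 2 $ 2 - M $ 1 $ 2 * M $ 2 $ 1) * M $ 3 $ 3 * M $ 4 $ 4"
proof -
  have f1: "finite {2::4, 3, 4}" "1 \<notin> {2::4, 3, 4}" by auto
  have f2: "finite {3::4, 4}" "2 \<notin> {3::4, 4}" by auto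
  have f3: "finite {4::4}" "3 \<notin> {4::4}" by auto
  have z: "M $ 3 $ 1 = 0" "M $ 4 $ 1 = 0" "M $ 3 $ 2 = 0" "M $ 4 $ 2 = 0"
     "M $ 1 $ 3 = 0" "M $ 1 $ 4 = 0" "M $ 2 $ 3 = 0" "M $ 2 $ 4 = 0"
    using assms(1)[of 3] assms(1)[of 4] by auto
  show ?thesis
    unfolding det_def UNIV_4
    unfolding sum_over_permutations_insert[OF f1]
    unfolding sum_over_permutations_insert[OF f2]
    unfolding sum_over_permutations_insert[OF f3]
    unfolding permutes_sing
    by (simp add: sign_swap_id permutation_swap_id sign_compose sign_id swap_id_eq z assms(2,3) algebra_simps)
qed

text \<open>On the complement \<open>ker f \<inter> ker f'\<close> of the span of \<open>u\<close> and \<open>u'\<close> the product of the two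
  reflections is the identity.\<close>

lemma product_of_reflections_spectrum:
  fixes V :: "state set" and f f' :: "state \<Rightarrow> real"
  assumes V: "subspace V" "dim V = 4"
    and u: "u \<in> V" "u' \<in> V"
    and f: "linear f" "linear f'" "f u = 1" "f' u' = 1"
    and g: "0 < f u' * f' u" "f u' * f' u < 1"
    and D: "\<And>x. x \<in> V \<Longrightarrow>
      D x = (x - (2 * f' x) *\<^sub>R u') - (2 * f (x - (2 * f' x) *\<^sub>R u')) *\<^sub>R u"
  obtains A and \<mu> :: complex where "matrix_on V D A" "\<mu> \<notin> \<real>" "norm \<mu> = 1"
    "\<And>z::complex. det (mat z - (\<chi> i j. of_real (A $ i $ j)) :: complex^4^4)
         = (z - 1)^2 * (z - \<mu>) * (z - cnj \<mu>)"
proof -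
  interpret f: linear f by fact
  interpret f': linear f' by fact
  define g where "g = f u' * f' u"
  define K where "K = {x \<in> V. f x = 0 \<and> f' x = 0}"
  have K: "subspace K"
    using V(1) by (auto simp: K_def subspace_def f.add f'.add f.scaleR f'.scaleR f.zero f'.zero)
  obtain C where C: "C \<subseteq> K" "independent C" "K \<subseteq> span C" "card C = dim K" "finite C"
    by (metis basis_exists finiteI_independent)
  have spanC: "span C = K"
    using C K by (simp add: span_subspace)
  have g1: "g \<noteq> 1" "0 < g" "g < 1" using g by (auto simp: g_def)
  have ne: "f u' * f' u \<noteq> 1" using g by simp
  have u'nK: "u' \<notin> span C"
    using f(4) by (auto simp: spanC K_def)
  have unK: "u \<notin> span (insert u' C)"
  proof
    assume "u \<in> span (insert u' C)"
    then obtain k where k: "u - k *\<^sub>R u' \<in> K" by (auto simp: span_insert spanC)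
    then have "1 - k * f u' = 0" "f' u - k = 0"
      using f by (auto simp: K_def f.diff f'.diff f.scaleR f'.scaleR)
    then show False using ne by (auto simp: algebra_simps)
  qed
  have ind: "independent (insert u (insert u' C))"
    by (intro independent_insertI unK u'nK C)
  have sub: "insert u (insert u' C) \<subseteq> V" using u C by (auto simp: K_def)
  have "V \<subseteq> span (insert u (insert u' C))"
  proof
    fix x assume x: "x \<in> V"
    \<comment> \<open>The coefficients of \<open>u\<close> and \<open>u'\<close> solve a 2x2 linear
      system, which states that the remainder is killed by \<open>f\<close> and \<open>f'\<close>.
      Its determinant is \<open>1 - g\<close>.\<close>
    define s where "s = (f x - f u' * f' x) / (1 - g)"
    define t where "t = f' x - s * f' u"
    have "s * (1 - g) = f x - f u' * f' x" using g1 by (simp add: s_def)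
    then have "s - s * g = f x - f u' * f' x" by (simp add: right_diff_distrib)
    moreover have "f (x - s *\<^sub>R u - t *\<^sub>R u') = f x - s - t * f u'"
      by (simp add: f.diff f.scaleR f(3))
    moreover have "t * f u' = f u' * f' x - s * g"
      by (simp add: t_def g_def algebra_simps)
    ultimately have "f (x - s *\<^sub>R u - t *\<^sub>R u') = 0"
      by linarith
    moreover have "f' (x - s *\<^sub>R u - t *\<^sub>R u') = f' x - s * f' u - t"
      by (simp add: f'.diff f'.scaleR f(4))
    then have "f' (x - s *\<^sub>R u - t *\<^sub>R u') = 0"
      by (simp add: t_def)
    moreover have "x - s *\<^sub>R u - t *\<^sub>R u' \<in> V"
      using x u V by (intro subspace_diff subspace_scale)
    ultimately have "x - s *\<^sub>R u - t *\<^sub>R u' \<in> K"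
      by (simp add: K_def)
    then show "x \<in> span (insert u (insert u' C))"
      by (auto simp: span_insert spanC)
  qed
  then have sp: "span (insert u (insert u' C)) = V"
    using sub V(1) by (simp add: span_subspace)
  have "card (insert u (insert u' C)) = 4"
    using dim_span_eq_card_independent[OF ind] sp V(2) by simp
  moreover have "u' \<notin> C" "u \<notin> insert u' C" using u'nK unK by (auto intro: span_base)
  ultimately have "card C = 2" using C(5) by (simp add: card_insert_if)
  then obtain w1 w2 where w: "C = {w1, w2}" "w1 \<noteq> w2" unfolding card_2_iff by blast
  define b :: "4 \<Rightarrow> state" where
    "b i = (if i = 1 then u else if i = 2 then u' else if i = 3 then w1 else w2)" for i
  have bsimps: "b 1 = u" "b 2 = u'" "b 3 = w1" "b 4 = w2" by (auto simp: b_def)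
  have rb: "range b = insert u (insert u' C)" by (simp add: UNIV_4 bsimps w)
  have injb: "inj b"
    by (rule eq_card_imp_inj_on) (simp_all add: rb \<open>card (insert u (insert u' C)) = 4\<close>)
  \<comment> \<open>The columns are the images of \<open>u\<close>, \<open>u'\<close> and two
    vectors of the common kernel. The block on \<open>u\<close>, \<open>u'\<close> has trace
    \<open>4 * g - 2\<close> and determinant 1; the rest is the identity.\<close>
  define A :: "real^4^4" where
    "A = (\<chi> i j. if j = 1 then (if i = 1 then 4 * g - 1 else if i = 2 then - 2 * f' u else 0)
       else if j = 2 then (if i = 1 then 2 * f u' else if i = 2 then - 1 else 0)
       else if i = j then 1 else 0)"
  have wK: "w1 \<in> V" "w2 \<in> V" "f w1 = 0" "f' w1 = 0" "f w2 = 0" "f' w2 = 0"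
    using C(1) w by (auto simp: K_def)
  have cols: "D (b j) = (\<Sum>i\<in>UNIV. A $ i $ j *\<^sub>R b i)" for j
  proof -
    have "D u = (4 * g - 1) *\<^sub>R u + (- 2 * f' u) *\<^sub>R u'"
      by (simp add: D[OF u(1)] f.diff f.scaleR f g_def algebra_simps) (simp only: scaleR_2)
    moreover have "D u' = (2 * f u') *\<^sub>R u + (- 1) *\<^sub>R u'"
      by (simp add: D[OF u(2)] f.diff f.scaleR f algebra_simps) (simp add: scaleR_2)
    moreover have "D w1 = w1" "D w2 = w2" by (simp_all add: D wK f.zero)
    ultimately show ?thesis
      using exhaust_4[of j] by (auto simp: sum_4 A_def bsimps)
  qed
  have mat: "matrix_on V D A"
    unfolding matrix_on_def using injb ind sp cols by (intro exI[of _ b]) (auto simp: rb)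
  \<comment> \<open>A root of \<open>z^2 - (4 * g - 2) * z + 1\<close>: the middle coefficient is
    twice a cosine, and \<open>0 < g < 1\<close> keeps that cosine strictly between -1 and 1, so the
    root is not real.\<close>
  define \<mu> where "\<mu> = cis (arccos (2 * g - 1))"
  have mu: "\<mu> + cnj \<mu> = of_real (4 * g - 2)" "\<mu> * cnj \<mu> = 1" "\<mu> \<notin> \<real>" "norm \<mu> = 1"
  proof -
    show "\<mu> + cnj \<mu> = of_real (4 * g - 2)"
      using g1 by (simp add: \<mu>_def complex_eq_iff)
    show "\<mu> * cnj \<mu> = 1" "norm \<mu> = 1" by (simp_all add: \<mu>_def flip: complex_norm_square cis_cnj)
    have "sin (arccos (2 * g - 1)) \<noteq> 0"
      using g1 by (intro sin_arccos_nonzero) auto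
    then show "\<mu> \<notin> \<real>" by (simp add: \<mu>_def complex_is_Real_iff)
  qed
  have "det (mat z - (\<chi> i j. of_real (A $ i $ j)) :: complex^4^4)
         = (z - 1)^2 * (z - \<mu>) * (z - cnj \<mu>)" for z :: complex
  proof -
    have "det (mat z - (\<chi> i j. of_real (A $ i $ j)) :: complex^4^4)
       = ((z - of_real (4 * g - 1)) * (z + 1) + 4 * of_real (f u') * of_real (f' u)) * (z - 1) * (z - 1)"
      by (subst det_block_2_id) (auto simp: A_def mat_def)
    also have "\<dots> = (z - 1)^2 * (z^2 - of_real (4 * g - 2) * z + 1)"
      by (simp add: g_def algebra_simps power2_eq_square)
    also have "\<dots> = (z - 1)^2 * (z^2 - (\<mu> + cnj \<mu>) * z + \<mu> * cnj \<mu>)"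
      using mu(1,2) by simp
    also have "\<dots> = (z - 1)^2 * (z - \<mu>) * (z - cnj \<mu>)"
      by (simp add: algebra_simps power2_eq_square)
    finally show ?thesis .
  qed
  then show thesis using that[OF mat mu(3,4)] by blast
qed

text \<open>Used for the flight time, whose continuity is obtained separately. Hence
  differentiability of \<open>F\<close> at the single point suffices, and \<open>S\<close> may be an
  arbitrary set. With \<open>h\<close> and \<open>k\<close> the increments of \<open>x\<close> and
  \<open>\<tau>\<close>, constancy of \<open>F\<close> gives
  \<open>F' (h, 0) + k * c = o(\<bar>h\<bar> + \<bar>k\<bar>)\<close>; since
  \<open>c \<noteq> 0\<close> this first yields \<open>k = O(\<bar>h\<bar>)\<close> and then the
  derivative.\<close>

lemma implicit_function_has_derivative:
  fixes F :: "'a::real_normed_vector \<times> real \<Rightarrow> real"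
  assumes F: "(F has_derivative F') (at (x0, \<tau> x0))"
    and c: "F' (0, 1) \<noteq> 0"
    and cont: "(\<tau> \<longlongrightarrow> \<tau> x0) (at x0 within S)"
    and ev: "\<forall>\<^sub>F x in at x0 within S. F (x, \<tau> x) = F (x0, \<tau> x0)"
  shows "(\<tau> has_derivative (\<lambda>h. - F' (h, 0) / F' (0, 1))) (at x0 within S)"
proof -
  interpret F': bounded_linear F' using F by (rule has_derivative_bounded_linear)
  define c where "c = F' (0, 1)"
  have c0: "c \<noteq> 0" using c by (simp add: c_def)
  have split: "F' (h, k) = F' (h, 0) + k * c" for h k
  proof -
    have "(h, k) = (h, 0) + k *\<^sub>R (0, 1)" by simp
    then show ?thesis unfolding c_def by (metis F'.add F'.scaleR real_scaleR_def)
  qed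
  have L: "bounded_linear (\<lambda>h. F' (h, 0))"
    by (rule bounded_linear_compose[OF F'.bounded_linear_axioms])
       (intro bounded_linear_Pair bounded_linear_ident bounded_linear_zero)
  then obtain M where M: "M > 0" "\<And>h. norm (F' (h, 0)) \<le> norm h * M"
    using bounded_linear.pos_bounded by blast
  show ?thesis
    unfolding has_derivative_within_alt2
  proof (intro conjI allI impI)
    have "bounded_linear (\<lambda>h. (- 1 / c) * F' (h, 0))"
      using bounded_linear_const_mult[OF L] .
    then show "bounded_linear (\<lambda>h. - F' (h, 0) / F' (0, 1))"
      by (simp add: c_def)
    fix e :: real assume e: "e > 0"
    \<comment> \<open>\<open>Q\<close> is the constant in
      \<open>\<bar>h\<bar> + \<bar>k\<bar> \<le> Q * \<bar>h\<bar>\<close>. The bound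
      \<open>\<rho> \<le> 1/2\<close> absorbs \<open>\<rho> * \<bar>k\<bar>\<close> into the
      left-hand side, and \<open>\<rho> * Q \<le> e\<close> turns the final error into
      \<open>e * \<bar>h\<bar>\<close>.\<close>
    define Q where "Q = 2 * (M / \<bar>c\<bar> + 1)"
    define \<rho> where "\<rho> = min (1 / 2) (e / Q)"
    have Q: "Q > 0" using M(1) c0 by (simp add: Q_def add_pos_pos)
    have \<rho>: "\<rho> > 0" "\<rho> \<le> 1/2" "\<rho> * Q \<le> e"
      using e Q min.cobounded1[of "1/2" "e / Q"]
      by (simp_all add: \<rho>_def flip: pos_le_divide_eq[OF Q])
    have "\<forall>\<^sub>F y in at (x0, \<tau> x0). norm (F y - F (x0, \<tau> x0) - F' (y - (x0, \<tau> x0)))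
            \<le> (\<rho> * \<bar>c\<bar>) * norm (y - (x0, \<tau> x0))"
      using F \<rho>(1) c0 unfolding has_derivative_within_alt2 by simp
    then have "\<forall>\<^sub>F y in nhds (x0, \<tau> x0). norm (F y - F (x0, \<tau> x0) - F' (y - (x0, \<tau> x0)))
            \<le> (\<rho> * \<bar>c\<bar>) * norm (y - (x0, \<tau> x0))"
      unfolding eventually_at_filter
      by (rule eventually_mono) (auto simp: zero_prod_def[symmetric] F'.zero)
    moreover have "((\<lambda>x. (x, \<tau> x)) \<longlongrightarrow> (x0, \<tau> x0)) (at x0 within S)"
      by (intro tendsto_Pair cont tendsto_ident_at)
    ultimately have "\<forall>\<^sub>F x in at x0 within S. norm (F (x, \<tau> x) - F (x0, \<tau> x0) - F' ((x, \<tau> x) - (x0, \<tau> x0)))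
            \<le> (\<rho> * \<bar>c\<bar>) * norm ((x, \<tau> x) - (x0, \<tau> x0))"
      by (rule eventually_compose_filterlim)
    with ev show "\<forall>\<^sub>F y in at x0 within S.
        norm (\<tau> y - \<tau> x0 - - F' (y - x0, 0) / F' (0, 1)) \<le> e * norm (y - x0)"
    proof eventually_elim
      case (elim x)
      define h k where "h = x - x0" and "k = \<tau> x - \<tau> x0"
      have "norm (F' (h, k)) \<le> (\<rho> * \<bar>c\<bar>) * norm (h, k)"
        using elim by (simp add: h_def k_def)
      also have "\<dots> \<le> (\<rho> * \<bar>c\<bar>) * (norm h + \<bar>k\<bar>)"
        using \<rho>(1) norm_Pair_le[of h k] by (intro mult_left_mono) auto
      finally have "\<bar>F' (h, 0) + k * c\<bar> \<le> \<bar>c\<bar> * (\<rho> * (norm h + \<bar>k\<bar>))"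
        using split[of h k] by (simp add: mult_ac)
      moreover have "F' (h, 0) + k * c = c * (k + F' (h, 0) / c)"
        using c0 by (simp add: field_simps)
      ultimately have 1: "\<bar>k + F' (h, 0) / c\<bar> \<le> \<rho> * (norm h + \<bar>k\<bar>)"
        using c0 by (simp add: abs_mult)
      have "\<bar>F' (h, 0) / c\<bar> \<le> norm h * (M / \<bar>c\<bar>)"
        using M(2)[of h] c0 by (simp add: divide_right_mono)
      then have 2: "\<bar>k\<bar> \<le> norm h * (M / \<bar>c\<bar>) + \<rho> * (norm h + \<bar>k\<bar>)"
        using 1 by linarith
      have "\<rho> * \<bar>k\<bar> \<le> (1/2) * \<bar>k\<bar>" "\<rho> * norm h \<le> (1/2) * norm h"
        using \<rho>(2) by (intro mult_right_mono; simp)+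
      then have "norm h + \<bar>k\<bar> \<le> norm h * (2 * (M / \<bar>c\<bar> + 1))"
      proof -
        have "\<rho> * (norm h + \<bar>k\<bar>) = \<rho> * norm h + \<rho> * \<bar>k\<bar>"
          by (rule distrib_left)
        moreover have "norm h * (2 * (M / \<bar>c\<bar> + 1)) = 2 * (norm h * (M / \<bar>c\<bar>)) + 2 * norm h"
          by (simp add: distrib_left)
        ultimately show ?thesis
          using 2 \<open>\<rho> * \<bar>k\<bar> \<le> (1/2) * \<bar>k\<bar>\<close> \<open>\<rho> * norm h \<le> (1/2) * norm h\<close> by linarith
      qed
      then have "norm h + \<bar>k\<bar> \<le> norm h * Q" by (simp only: Q_def)
      then have "\<rho> * (norm h + \<bar>k\<bar>) \<le> \<rho> * (norm h * Q)"
        using \<rho>(1) by (intro mult_left_mono) auto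
      also have "\<dots> \<le> e * norm h"
        using mult_right_mono[OF \<rho>(3) norm_ge_zero[of h]] by (simp add: mult_ac)
      finally show ?case using 1 by (simp add: h_def k_def c_def)
    qed
  qed
qed

section \<open>Linear algebra of a pair of bounces\<close>

lemma dim_product_of_hyperplanes:
  fixes e v :: vec3
  assumes "e \<noteq> 0" "v \<noteq> 0"
  shows "subspace {(x :: vec3, y :: vec3). x \<bullet> e = 0 \<and> y \<bullet> v = 0}"
    and "dim {(x :: vec3, y :: vec3). x \<bullet> e = 0 \<and> y \<bullet> v = 0} = 4"
proof -
  have eq: "{(x :: vec3, y :: vec3). x \<bullet> e = 0 \<and> y \<bullet> v = 0} = {x. e \<bullet> x = 0} \<times> {y. v \<bullet> y = 0}"
    by (auto simp: inner_commute)
  show "subspace {(x :: vec3, y :: vec3). x \<bullet> e = 0 \<and> y \<bullet> v = 0}"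
    unfolding eq by (intro subspace_Times subspace_hyperplane)
  show "dim {(x :: vec3, y :: vec3). x \<bullet> e = 0 \<and> y \<bullet> v = 0} = 4"
    unfolding eq using assms by (subst dim_Times) (auto simp: subspace_hyperplane dim_hyperplane)
qed

text \<open>The differentials of the flights from \<open>e\<close> to \<open>e'\<close> and back are inverse to each other, so
  that the second collision and the conjugate of the first one become two reflections of the same
  space.\<close>

lemma two_bounces_spectrum:
  fixes v e e' n n' k k' :: vec3 and t :: real
  defines "\<pi> \<equiv> \<lambda>x :: vec3. x - ((x \<bullet> e) / (v \<bullet> e)) *\<^sub>R v"
    and "\<pi>' \<equiv> \<lambda>x :: vec3. x - ((x \<bullet> e') / (v \<bullet> e')) *\<^sub>R v"
  assumes e: "v \<bullet> e \<noteq> 0" "v \<bullet> e' \<noteq> 0"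
    and n: "v \<bullet> n = 0" "v \<bullet> n' = 0" "n \<bullet> n = 1" "n' \<bullet> n' = 1"
    and D: "\<And>dq dv. D (dq, dv) = D2 (D1 (dq, dv))"
    and D1: "\<And>dq dv. D1 (dq, dv) = (\<pi>' (dq + t *\<^sub>R dv), - dv - (2 * (k' \<bullet> \<pi>' (dq + t *\<^sub>R dv) - dv \<bullet> n')) *\<^sub>R n')"
    and D2: "\<And>dq dv. D2 (dq, dv) = (\<pi> (dq + t *\<^sub>R dv), - dv - (2 * (k \<bullet> \<pi> (dq + t *\<^sub>R dv) - dv \<bullet> n)) *\<^sub>R n)"
    and g: "0 < (- (n \<bullet> n') + t * (k \<bullet> \<pi> n')) * (- (n \<bullet> n') + t * (k' \<bullet> \<pi>' n))"
      "(- (n \<bullet> n') + t * (k \<bullet> \<pi> n')) * (- (n \<bullet> n') + t * (k' \<bullet> \<pi>' n)) < 1"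
  obtains A and \<mu> :: complex where
    "matrix_on {(dq, dv). dq \<bullet> e = 0 \<and> dv \<bullet> v = 0} D A" "\<mu> \<notin> \<real>" "norm \<mu> = 1"
    "\<And>z::complex. det (mat z - (\<chi> i j. of_real (A $ i $ j)) :: complex^4^4)
         = (z - 1)^2 * (z - \<mu>) * (z - cnj \<mu>)"
proof -
  let ?V = "{(dq :: vec3, dv :: vec3). dq \<bullet> e = 0 \<and> dv \<bullet> v = 0}"
  have e0: "e \<noteq> 0" "v \<noteq> 0" using e by auto
  have lin: "linear \<pi>" "linear \<pi>'"
    by (auto simp: \<pi>_def \<pi>'_def linear_iff inner_add_left add_divide_distrib algebra_simps)
  interpret \<pi>: linear \<pi> by fact
  interpret \<pi>': linear \<pi>' by fact
  have \<pi>v: "\<pi> v = 0" "\<pi>' v = 0" using e by (simp_all add: \<pi>_def \<pi>'_def)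
  have \<pi>e: "\<pi> x \<bullet> e = 0" for x using e by (simp add: \<pi>_def inner_diff_left)
  have \<pi>id: "\<pi> x = x" if "x \<bullet> e = 0" for x using that by (simp add: \<pi>_def)
  have \<pi>\<pi>': "\<pi> (\<pi>' x) = \<pi> x" "\<pi>' (\<pi> x) = \<pi>' x" for x
  proof -
    have "\<pi> (\<pi>' x) = \<pi> x - ((x \<bullet> e') / (v \<bullet> e')) *\<^sub>R \<pi> v"
      by (simp only: \<pi>'_def \<pi>.diff \<pi>.scaleR)
    then show "\<pi> (\<pi>' x) = \<pi> x" by (simp add: \<pi>v)
    have "\<pi>' (\<pi> x) = \<pi>' x - ((x \<bullet> e) / (v \<bullet> e)) *\<^sub>R \<pi>' v"
      by (simp only: \<pi>_def \<pi>'.diff \<pi>'.scaleR)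
    then show "\<pi>' (\<pi> x) = \<pi>' x" by (simp add: \<pi>v)
  qed
  \<comment> \<open>\<open>f\<close>, \<open>u\<close> belong to the collision at the near end.
    \<open>f'\<close>, \<open>u'\<close> are the data of the far end pulled back by the flight with
    reversed velocity, \<open>(dq, dv) \<mapsto> (\<pi>' (dq + t dv), - dv)\<close>: it maps
    \<open>u'\<close> to \<open>(0, n')\<close>, because \<open>\<pi>'\<close> kills
    \<open>\<pi> n' - n'\<close>.\<close>
  define f where "f x = k \<bullet> fst x + snd x \<bullet> n" for x :: state
  define f' where "f' x = k' \<bullet> \<pi>' (fst x + t *\<^sub>R snd x) - snd x \<bullet> n'" for x :: state
  define u :: state where "u = (0, n)"
  define u' :: state where "u' = (t *\<^sub>R \<pi> n', - n')"
  have linf: "linear f" "linear f'"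
    unfolding f_def f'_def
    by (auto simp: linear_iff inner_add_left inner_add_right \<pi>'.add \<pi>'.scaleR algebra_simps)
  have fu: "f u = 1" by (simp add: f_def u_def n)
  have "\<pi>' (t *\<^sub>R \<pi> n' - t *\<^sub>R n') = 0"
    by (simp add: \<pi>'.diff \<pi>'.scaleR \<pi>\<pi>')
  then have f'u': "f' u' = 1" by (simp add: f'_def u'_def n)
  have cross: "f u' = - (n \<bullet> n') + t * (k \<bullet> \<pi> n')" "f' u = - (n \<bullet> n') + t * (k' \<bullet> \<pi>' n)"
    by (simp_all add: f_def f'_def u_def u'_def \<pi>'.scaleR inner_commute)
  show thesis
  proof (rule product_of_reflections_spectrum[of ?V u u' f f' D])
    show "subspace ?V" "dim ?V = 4" using dim_product_of_hyperplanes[OF e0] by simp_all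
    show "u \<in> ?V" "u' \<in> ?V" using n by (simp_all add: u_def u'_def \<pi>e inner_commute[of n v] inner_commute[of n' v])
    show "linear f" "linear f'" "f u = 1" "f' u' = 1" by fact+
    show "0 < f u' * f' u" "f u' * f' u < 1" using g by (simp_all add: cross)
    show "D x = (x - (2 * f' x) *\<^sub>R u') - (2 * f (x - (2 * f' x) *\<^sub>R u')) *\<^sub>R u" if "x \<in> ?V" for x
    proof -
      obtain dq dv where x: "x = (dq, dv)" "dq \<bullet> e = 0" "dv \<bullet> v = 0" using \<open>x \<in> ?V\<close> by auto
      define \<phi> where "\<phi> = f' x"
      define y where "y = x - (2 * \<phi>) *\<^sub>R u'"
      have y: "y = (dq - (2 * \<phi>) *\<^sub>R t *\<^sub>R \<pi> n', dv + (2 * \<phi>) *\<^sub>R n')"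
        by (simp add: y_def x u'_def)
      have D1x: "D1 x = (\<pi>' (dq + t *\<^sub>R dv), - snd y)"
        by (simp add: D1 x y \<phi>_def f'_def)
      have "\<pi> (\<pi>' (dq + t *\<^sub>R dv) + t *\<^sub>R (- snd y)) = fst y"
        by (simp add: \<pi>.add \<pi>.diff \<pi>.neg \<pi>.scaleR \<pi>\<pi>' y \<pi>id[OF x(2)] algebra_simps)
      then have "D2 (D1 x) = (fst y, snd y - (2 * f y) *\<^sub>R n)"
        unfolding D1x D2 by (simp add: f_def)
      also have "\<dots> = y - (2 * f y) *\<^sub>R u" by (simp add: u_def y)
      finally show ?thesis using D x(1) by (simp add: y_def \<phi>_def)
    qed
  qed (use that in blast)
qed

section \<open>Strips between two graphs\<close>

definition hor :: "complex \<Rightarrow> complex \<Rightarrow> real" where "hor m z = Re (z * cnj m)"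
definition ver :: "complex \<Rightarrow> complex \<Rightarrow> real" where "ver m z = Im (z * cnj m)"

definition frame_point :: "complex \<Rightarrow> complex \<Rightarrow> real \<Rightarrow> real \<Rightarrow> complex" where
  "frame_point p m X Y = p + Complex X Y * m"

lemma bounded_linear_hor: "bounded_linear (hor m)"
  unfolding hor_def
  by (intro bounded_linear_compose[OF bounded_linear_Re] bounded_linear_mult_left)

lemma bounded_linear_ver: "bounded_linear (ver m)"
  unfolding ver_def
  by (intro bounded_linear_compose[OF bounded_linear_Im] bounded_linear_mult_left)

lemmas hor_linear = bounded_linear.linear[OF bounded_linear_hor]
lemmas ver_linear = bounded_linear.linear[OF bounded_linear_ver]
lemmas hor_simps = linear_add[OF hor_linear] linear_diff[OF hor_linear] linear_scale[OF hor_linear]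
  linear_0[OF hor_linear] linear_neg[OF hor_linear]
lemmas ver_simps = linear_add[OF ver_linear] linear_diff[OF ver_linear] linear_scale[OF ver_linear]
  linear_0[OF ver_linear] linear_neg[OF ver_linear]
lemmas hor_has_derivative [derivative_intros] = bounded_linear.has_derivative[OF bounded_linear_hor]
lemmas ver_has_derivative [derivative_intros] = bounded_linear.has_derivative[OF bounded_linear_ver]
lemmas hor_tendsto [tendsto_intros] = bounded_linear.tendsto[OF bounded_linear_hor]
lemmas ver_tendsto [tendsto_intros] = bounded_linear.tendsto[OF bounded_linear_ver]
lemmas hor_continuous [continuous_intros] = bounded_linear.continuous_on[OF bounded_linear_hor]
lemmas ver_continuous [continuous_intros] = bounded_linear.continuous_on[OF bounded_linear_ver]

lemma unit_mult_cnj: "norm m = 1 \<Longrightarrow> m * cnj m = 1" for m :: complex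
  by (simp flip: complex_norm_square)

lemma hor_ver_Complex_mult:
  assumes "norm m = 1"
  shows "hor m (Complex a b * m) = a" "ver m (Complex a b * m) = b"
  using unit_mult_cnj[OF assms] by (simp_all add: hor_def ver_def mult.assoc)

lemma hor_ver_mult:
  assumes "norm m = 1"
  shows "hor m (c * m) = Re c" "ver m (c * m) = Im c"
  using unit_mult_cnj[OF assms] by (simp_all add: hor_def ver_def mult.assoc)

lemma Complex_hor_ver:
  assumes "norm m = 1"
  shows "Complex (hor m z) (ver m z) * m = z"
proof -
  have "Complex (hor m z) (ver m z) = z * cnj m"
    by (simp add: hor_def ver_def complex_eq_iff)
  then show ?thesis using unit_mult_cnj[OF assms] by (simp add: mult.assoc mult.commute[of "cnj m"])
qed

lemma inner_hor_ver:
  assumes "norm m = 1"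
  shows "z \<bullet> w = hor m z * hor m w + ver m z * ver m w"
proof -
  have "z \<bullet> w = Re (z * cnj w)" by (simp add: inner_complex_def)
  also have "z * cnj w = (z * cnj m) * cnj (w * cnj m)"
    using unit_mult_cnj[OF assms] by (simp add: algebra_simps)
  also have "Re \<dots> = hor m z * hor m w + ver m z * ver m w"
    by (simp add: hor_def ver_def algebra_simps)
  finally show ?thesis .
qed

lemma hor_eq_inner: "norm m = 1 \<Longrightarrow> hor m z = z \<bullet> m"
  using hor_ver_mult[of m 1] by (simp add: inner_hor_ver[of m])

lemma frame_point_coordinates:
  assumes "norm m = 1"
  shows "hor m (frame_point p m X Y - p) = X" "ver m (frame_point p m X Y - p) = Y"
    "frame_point p m (hor m (z - p)) (ver m (z - p)) = z"
  using assms by (simp_all add: frame_point_def hor_ver_Complex_mult Complex_hor_ver)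

lemma frame_point_add:
  assumes "norm m = 1"
  shows "frame_point p m X Y + w = frame_point p m (X + hor m w) (Y + ver m w)"
proof -
  have "w = Complex (hor m w) (ver m w) * m" by (simp add: Complex_hor_ver assms)
  moreover have "Complex (X + hor m w) (Y + ver m w) = Complex X Y + Complex (hor m w) (ver m w)"
    by (simp add: complex_eq_iff)
  ultimately show ?thesis unfolding frame_point_def by (metis add.assoc distrib_right)
qed

lemma norm_le_hor_ver:
  assumes "norm m = 1"
  shows "norm z \<le> \<bar>hor m z\<bar> + \<bar>ver m z\<bar>"
proof -
  have "norm z = norm (z * cnj m)" using assms by (simp add: norm_mult)
  then show ?thesis using cmod_le[of "z * cnj m"] by (simp add: hor_def ver_def)
qed

text \<open>Leaves two candidates for the inward normal; which of them it is depends on the side on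
  which the interior lies.\<close>

lemma unit_orthogonal_unique:
  fixes a b w :: complex
  assumes "w \<noteq> 0" "a \<bullet> w = 0" "b \<bullet> w = 0" "norm a = 1" "norm b = 1"
  shows "a = b \<or> a = - b"
proof -
  have *: "\<exists>s::real. z = of_real s * (\<i> * sgn w) \<and> \<bar>s\<bar> = 1" if "z \<bullet> w = 0" "norm z = 1" for z
  proof -
    define m where "m = sgn w"
    have m: "norm m = 1" using \<open>w \<noteq> 0\<close> by (simp add: m_def norm_sgn)
    have "w = norm w *\<^sub>R m" by (simp add: m_def sgn_div_norm \<open>w \<noteq> 0\<close>)
    then have "z \<bullet> m = 0" using that \<open>w \<noteq> 0\<close> by (metis inner_scaleR_right mult_eq_0_iff norm_eq_zero)
    then have h: "hor m z = 0" by (simp add: hor_eq_inner m)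
    then have "z = of_real (ver m z) * (\<i> * m)"
      using Complex_hor_ver[OF m, of z] by (simp add: complex_eq_iff)
    moreover from this have "\<bar>ver m z\<bar> = 1"
      using that m by (metis mult.right_neutral norm_ii norm_mult norm_of_real)
    ultimately show ?thesis unfolding m_def by blast
  qed
  obtain s t :: real where "a = of_real s * (\<i> * sgn w)" "\<bar>s\<bar> = 1" "b = of_real t * (\<i> * sgn w)" "\<bar>t\<bar> = 1"
    using *[of a] *[of b] assms by blast
  moreover from this have "s = t \<or> s = - t" by linarith
  ultimately show ?thesis by auto
qed

lemma smooth_arc_has_velocity:
  assumes "smooth_arc c" "t \<in> {0..1}"
  shows "(c has_vector_derivative velocity c t) (at t within {0..1})"
proof -
  obtain d where "d 0 = c"
    "\<And>n t. t \<in> {0..1} \<Longrightarrow> (d n has_vector_derivative d (Suc n) t) (at t within {0..1})"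
    using assms(1) by (auto simp: smooth_arc_def smooth_on_unit_def)
  then have *: "(c has_vector_derivative d (Suc 0) t) (at t within {0..1})"
    using assms(2) by blast
  then have "velocity c t = d (Suc 0) t"
    unfolding velocity_def using assms(2)
    by (intro vector_derivative_within_closed_interval) auto
  then show ?thesis using * by simp
qed

lemma sin_arctan_cos_arctan: "sin (arctan x) = x * cos (arctan x)"
  by (simp add: sin_arctan cos_arctan)

lemma cos_arctan_pos: "cos (arctan x) > 0"
  using arctan_bounded[of x] by (intro cos_gt_zero_pi) auto

text \<open>The part of a table over an open interval that stops short of the corner, so that all
  derivatives are two-sided. General end points \<open>l\<close>, \<open>r\<close> keep the notion
  stable under the rotation that exchanges the graphs. \<open>B\<close> is controlled only in layers
  of height \<open>h\<close> beyond the graphs, since the table may come back farther away; this is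
  enough to recognise the frontier locally and to tell inside from outside.\<close>

locale strip =
  fixes B :: "complex set" and p m :: complex and l r h \<Lambda> :: real
    and f f1 f2 g g1 g2 :: "real \<Rightarrow> real"
  assumes closed_B: "closed B" and m: "norm m = 1" and h: "0 < h"
    and f_less_g: "\<And>X. l < X \<Longrightarrow> X < r \<Longrightarrow> f X < g X"
    and DERIV_f: "\<And>X. l < X \<Longrightarrow> X < r \<Longrightarrow> (f has_real_derivative f1 X) (at X)"
    and DERIV_f1: "\<And>X. l < X \<Longrightarrow> X < r \<Longrightarrow> (f1 has_real_derivative f2 X) (at X)"
    and DERIV_g: "\<And>X. l < X \<Longrightarrow> X < r \<Longrightarrow> (g has_real_derivative g1 X) (at X)"
    and DERIV_g1: "\<And>X. l < X \<Longrightarrow> X < r \<Longrightarrow> (g1 has_real_derivative g2 X) (at X)"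
    and slope_f: "\<And>X. l < X \<Longrightarrow> X < r \<Longrightarrow> \<bar>f1 X\<bar> \<le> \<Lambda>"
    and slope_g: "\<And>X. l < X \<Longrightarrow> X < r \<Longrightarrow> \<bar>g1 X\<bar> \<le> \<Lambda>"
    and between: "\<And>X Y. l < X \<Longrightarrow> X < r \<Longrightarrow> f X < Y \<Longrightarrow> Y < g X \<Longrightarrow> frame_point p m X Y \<in> interior B"
    and below: "\<And>X Y. l < X \<Longrightarrow> X < r \<Longrightarrow> f X - h < Y \<Longrightarrow> Y < f X \<Longrightarrow> frame_point p m X Y \<notin> B"
    and above: "\<And>X Y. l < X \<Longrightarrow> X < r \<Longrightarrow> g X < Y \<Longrightarrow> Y < g X + h \<Longrightarrow> frame_point p m X Y \<notin> B"
    and smooth_f: "\<And>X. l < X \<Longrightarrow> X < r \<Longrightarrow> smooth_boundary_point B (frame_point p m X (f X))"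
    and smooth_g: "\<And>X. l < X \<Longrightarrow> X < r \<Longrightarrow> smooth_boundary_point B (frame_point p m X (g X))"
begin

text \<open>A rotation by \<open>pi\<close> exchanges the two graphs, so that each statement about the lower one
  yields one about the upper one.\<close>

lemma rotated: "strip B p (- m) (- r) (- l) h \<Lambda>
    (\<lambda>X. - g (- X)) (\<lambda>X. g1 (- X)) (\<lambda>X. - g2 (- X)) (\<lambda>X. - f (- X)) (\<lambda>X. f1 (- X)) (\<lambda>X. - f2 (- X))"
proof -
  have P: "frame_point p (- m) X Y = frame_point p m (- X) (- Y)" for X Y
    by (simp add: frame_point_def complex_eq_iff)
  have D: "((\<lambda>X. \<phi> (- X)) has_real_derivative - \<phi>') (at X)"
    if "(\<phi> has_real_derivative \<phi>') (at (- X))" for \<phi> \<phi>' X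
    using DERIV_chain2[OF that DERIV_minus[OF DERIV_ident]] by simp
  have D': "((\<lambda>X. - \<phi> (- X)) has_real_derivative \<phi>') (at X)"
    if "(\<phi> has_real_derivative \<phi>') (at (- X))" for \<phi> \<phi>' X
    using DERIV_minus[OF D[OF that]] by simp
  show ?thesis
  proof (unfold_locales, goal_cases)
    case (11 X Y) then show ?case unfolding P by (intro between) auto
  next
    case (12 X Y) then show ?case unfolding P by (intro above) auto
  next
    case (13 X Y) then show ?case unfolding P by (intro below) auto
  qed (use closed_B m h slope_f slope_g in
      \<open>auto simp: P intro!: D D' f_less_g DERIV_f DERIV_f1 DERIV_g DERIV_g1 smooth_f smooth_g\<close>)
qed

lemma lipschitz:
  assumes "l < X" "X < r" "l < X'" "X' < r"
  shows "\<bar>f X - f X'\<bar> \<le> \<Lambda> * \<bar>X - X'\<bar>" "\<bar>g X - g X'\<bar> \<le> \<Lambda> * \<bar>X - X'\<bar>"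
proof -
  have "norm (f X - f X') \<le> \<Lambda> * norm (X - X')"
    by (rule field_differentiable_bound[of "{l<..<r}" f f1])
      (use assms slope_f DERIV_f in \<open>auto intro: has_field_derivative_at_within\<close>)
  then show "\<bar>f X - f X'\<bar> \<le> \<Lambda> * \<bar>X - X'\<bar>" by simp
  have "norm (g X - g X') \<le> \<Lambda> * norm (X - X')"
    by (rule field_differentiable_bound[of "{l<..<r}" g g1])
      (use assms slope_g DERIV_g in \<open>auto intro: has_field_derivative_at_within\<close>)
  then show "\<bar>g X - g X'\<bar> \<le> \<Lambda> * \<bar>X - X'\<bar>" by simp
qed

lemma smooth_boundary_point_frontier: "smooth_boundary_point B z \<Longrightarrow> z \<in> frontier B"
  unfolding smooth_boundary_point_def boundary_arc_through_def path_image_def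
  by (metis IntD1 IntI atLeastAtMost_iff centre_in_ball image_eqI less_imp_le)

lemma frontier_lower:
  assumes "l < X" "X < r" "f X - h < Y" "Y < g X" "frame_point p m X Y \<in> frontier B"
  shows "Y = f X"
proof (rule ccontr)
  assume "Y \<noteq> f X"
  then have "frame_point p m X Y \<in> interior B \<or> frame_point p m X Y \<notin> B"
    using assms between below by (metis linorder_neqE_linordered_idom)
  then show False
    using assms(5) closed_B by (auto simp: frontier_def closure_closed)
qed

lemma isCont_fg:
  assumes "l < X" "X < r"
  shows "isCont f X" "isCont g X"
  using assms DERIV_f DERIV_g by (blast intro: DERIV_isCont)+

text \<open>In \<open>inward_normal\<close> the arc is arbitrary, so the tangent direction has to be
  computed for each admissible one. Near the parameter \<open>s\<close> the arc runs in the frontier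
  and hence on the graph of \<open>f\<close>; differentiating the identity that expresses this at
  \<open>s\<close> gives the slope.\<close>

lemma boundary_arc_tangent:
  assumes X: "l < X" "X < r" and c: "boundary_arc_through B (frame_point p m X (f X)) c s"
  shows "ver m (velocity c s) = f1 X * hor m (velocity c s)" "velocity c s \<noteq> 0"
proof -
  let ?z = "frame_point p m X (f X)"
  from c obtain \<epsilon> where \<epsilon>: "\<epsilon> > 0" "frontier B \<inter> ball ?z \<epsilon> = path_image c \<inter> ball ?z \<epsilon>"
    and s: "0 < s" "s < 1" "c s = ?z" "smooth_arc c"
    by (auto simp: boundary_arc_through_def)
  show "velocity c s \<noteq> 0" using s by (auto simp: smooth_arc_def)
  have "(c has_vector_derivative velocity c s) (at s within {0..1})"
    using s by (intro smooth_arc_has_velocity) auto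
  then have d: "(c has_vector_derivative velocity c s) (at s)"
    using s by (simp add: at_within_Icc_at)
  then have dh: "((\<lambda>\<sigma>. hor m (c \<sigma> - p)) has_real_derivative hor m (velocity c s)) (at s)"
    and dv: "((\<lambda>\<sigma>. ver m (c \<sigma> - p)) has_real_derivative ver m (velocity c s)) (at s)"
    unfolding has_vector_derivative_def has_field_derivative_def
    by (auto intro!: derivative_eq_intros simp: hor_simps ver_simps)
  let ?x = "\<lambda>\<sigma>. hor m (c \<sigma> - p)" and ?y = "\<lambda>\<sigma>. ver m (c \<sigma> - p)"
  have xs: "?x s = X" "?y s = f X" by (simp_all add: s frame_point_coordinates m)
  have cc: "c \<midarrow>s\<rightarrow> ?z" using d s(3) has_vector_derivative_continuous isCont_def by metis
  have cx: "?x \<midarrow>s\<rightarrow> X" and cy: "?y \<midarrow>s\<rightarrow> f X"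
    using DERIV_isCont[OF dh] DERIV_isCont[OF dv] xs by (simp_all add: isCont_def)
  have cf: "(\<lambda>\<sigma>. f (?x \<sigma>)) \<midarrow>s\<rightarrow> f X" and cg: "(\<lambda>\<sigma>. g (?x \<sigma>)) \<midarrow>s\<rightarrow> g X"
    using isCont_fg[OF X] cx by (auto intro: isCont_tendsto_compose)
  have "\<forall>\<^sub>F \<sigma> in at s. \<sigma> \<in> {0..1} \<and> c \<sigma> \<in> ball ?z \<epsilon> \<and> l < ?x \<sigma> \<and> ?x \<sigma> < r \<and>
       f (?x \<sigma>) - ?y \<sigma> < h \<and> g (?x \<sigma>) - ?y \<sigma> > 0"
  proof (intro eventually_conj)
    show "\<forall>\<^sub>F \<sigma> in at s. \<sigma> \<in> {0..1}"
      using s by (intro eventually_at_in_open'[of "{0<..<1}", THEN eventually_mono]) auto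
    show "\<forall>\<^sub>F \<sigma> in at s. c \<sigma> \<in> ball ?z \<epsilon>"
      using \<epsilon>(1) by (intro topological_tendstoD[OF cc]) auto
    show "\<forall>\<^sub>F \<sigma> in at s. l < ?x \<sigma>" "\<forall>\<^sub>F \<sigma> in at s. ?x \<sigma> < r"
      using X cx by (auto intro: order_tendstoD)
    show "\<forall>\<^sub>F \<sigma> in at s. f (?x \<sigma>) - ?y \<sigma> < h"
      using tendsto_diff[OF cf cy] h by (intro order_tendstoD(2)) auto
    show "\<forall>\<^sub>F \<sigma> in at s. g (?x \<sigma>) - ?y \<sigma> > 0"
      using tendsto_diff[OF cg cy] f_less_g[OF X] by (intro order_tendstoD(1)) auto
  qed
  then have "\<forall>\<^sub>F \<sigma> in at s. ?y \<sigma> - f (?x \<sigma>) = 0"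
  proof eventually_elim
    case (elim \<sigma>)
    have "c \<sigma> \<in> frontier B" using elim \<epsilon>(2) by (auto simp: path_image_def)
    then have "frame_point p m (?x \<sigma>) (?y \<sigma>) \<in> frontier B" by (simp add: frame_point_coordinates m)
    then have "?y \<sigma> = f (?x \<sigma>)" using elim by (intro frontier_lower) auto
    then show ?case by simp
  qed
  then have "\<forall>\<^sub>F \<sigma> in nhds s. ?y \<sigma> - f (?x \<sigma>) = 0"
    unfolding eventually_at_filter by (rule eventually_mono) (auto simp: xs)
  moreover have "((\<lambda>\<sigma>. ?y \<sigma> - f (?x \<sigma>)) has_real_derivative
      ver m (velocity c s) - f1 X * hor m (velocity c s)) (at s)"
    using DERIV_f[OF X] by (intro DERIV_diff dv DERIV_chain2[OF _ dh]) (simp add: xs)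
  ultimately have "((\<lambda>\<sigma>. 0) has_real_derivative
      ver m (velocity c s) - f1 X * hor m (velocity c s)) (at s)"
    using DERIV_cong_ev[of s s "\<lambda>\<sigma>. ?y \<sigma> - f (?x \<sigma>)" "\<lambda>\<sigma>. 0"] by blast
  then show "ver m (velocity c s) = f1 X * hor m (velocity c s)"
    using DERIV_unique[OF _ DERIV_const[of 0 "at s"]] by fastforce
qed

lemma inward_normal_lower:
  assumes X: "l < X" "X < r"
  shows "inward_normal B (frame_point p m X (f X)) = \<i> * cis (arctan (f1 X)) * m"
proof -
  let ?z = "frame_point p m X (f X)"
  define \<psi> where "\<psi> = arctan (f1 X)"
  define \<nu> where "\<nu> = \<i> * cis \<psi> * m"
  have sc: "sin \<psi> = f1 X * cos \<psi>" "cos \<psi> > 0"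
    by (simp_all add: \<psi>_def sin_arctan_cos_arctan cos_arctan_pos)
  have \<nu>: "hor m \<nu> = - sin \<psi>" "ver m \<nu> = cos \<psi>" "norm \<nu> = 1"
    by (simp_all add: \<nu>_def hor_ver_mult m norm_mult)
  have move: "?z + of_real t * (of_real \<sigma> * \<nu>) = frame_point p m (X - t * \<sigma> * sin \<psi>) (f X + t * \<sigma> * cos \<psi>)" for t \<sigma>
  proof -
    have "of_real t * (of_real \<sigma> * \<nu>) = (t * \<sigma>) *\<^sub>R \<nu>"
      by (simp add: scaleR_conv_of_real)
    then show ?thesis by (simp only: frame_point_add[OF m] hor_simps ver_simps \<nu>) simp
  qed
  have orth: "\<nu> \<bullet> velocity c s = 0" "velocity c s \<noteq> 0" if "boundary_arc_through B ?z c s" for c s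
    using boundary_arc_tangent[OF X that] sc by (simp_all add: inner_hor_ver[OF m] \<nu>)
  \<comment> \<open>The height over the lower graph of the point reached after time \<open>t\<close>
    along \<open>\<sigma> * \<nu>\<close>. Its derivative at 0 has the sign of
    \<open>\<sigma>\<close>: the candidate \<open>\<nu>\<close> enters the interior and
    \<open>- \<nu>\<close> leaves \<open>B\<close>.\<close>
  have dgap: "((\<lambda>t. f X + t * \<sigma> * cos \<psi> - f (X - t * \<sigma> * sin \<psi>)) has_real_derivative
      \<sigma> * cos \<psi> * (1 + (f1 X)\<^sup>2)) (at 0)" for \<sigma>
    using DERIV_f[OF X]
    by (auto intro!: derivative_eq_intros DERIV_chain2[where f=f] simp: sc power2_eq_square algebra_simps)
  have lim: "((\<lambda>t. X - t * \<sigma> * sin \<psi>) \<longlongrightarrow> X) (at_right 0)" for \<sigma>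
    by (auto intro!: tendsto_eq_intros)
  have limf: "((\<lambda>t. f (X - t * \<sigma> * sin \<psi>)) \<longlongrightarrow> f X) (at_right 0)"
    and limg: "((\<lambda>t. g (X - t * \<sigma> * sin \<psi>)) \<longlongrightarrow> g X) (at_right 0)" for \<sigma>
    using isCont_fg[OF X] lim by (auto intro: isCont_tendsto_compose)
  have limY: "((\<lambda>t. f X + t * \<sigma> * cos \<psi>) \<longlongrightarrow> f X) (at_right 0)" for \<sigma>
    by (auto intro!: tendsto_eq_intros)
  have dom: "\<forall>\<^sub>F t in at_right 0. l < X - t * \<sigma> * sin \<psi> \<and> X - t * \<sigma> * sin \<psi> < r" for \<sigma>
    using order_tendstoD[OF lim[of \<sigma>]] X by (auto intro: eventually_conj)
  have "\<forall>\<^sub>F t in at_right 0. ?z + of_real t * \<nu> \<in> interior B"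
  proof -
    obtain d where "d > 0" and d: "\<And>t. 0 < t \<Longrightarrow> t < d \<Longrightarrow> f (X - t * sin \<psi>) < f X + t * cos \<psi>"
      using DERIV_pos_inc_right[OF dgap[of 1]] sc by (auto simp: add_pos_nonneg)
    then have "\<forall>\<^sub>F t in at_right 0. f (X - t * sin \<psi>) < f X + t * cos \<psi>"
      using eventually_at_right_real[of 0 d] by (auto elim: eventually_mono)
    moreover have "\<forall>\<^sub>F t in at_right 0. g (X - t * 1 * sin \<psi>) - (f X + t * 1 * cos \<psi>) > 0"
      using f_less_g[OF X] by (intro order_tendstoD(1)[OF tendsto_diff[OF limg limY]]) auto
    ultimately show ?thesis using dom[of 1]
      by eventually_elim (use between move[of _ 1] in auto)
  qed
  moreover have "\<not> (\<forall>\<^sub>F t in at_right 0. ?z + of_real t * (- \<nu>) \<in> interior B)"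
  proof
    assume in_B: "\<forall>\<^sub>F t in at_right 0. ?z + of_real t * (- \<nu>) \<in> interior B"
    obtain d where "d > 0" and d: "\<And>t. 0 < t \<Longrightarrow> t < d \<Longrightarrow> f X - t * cos \<psi> < f (X + t * sin \<psi>)"
      using DERIV_neg_dec_right[OF dgap[of "-1"]] sc by (auto simp: add_pos_nonneg)
    then have "\<forall>\<^sub>F t in at_right 0. f X - t * cos \<psi> < f (X + t * sin \<psi>)"
      using eventually_at_right_real[of 0 d] by (auto elim: eventually_mono)
    moreover have "\<forall>\<^sub>F t in at_right 0. f (X - t * (-1) * sin \<psi>) - (f X + t * (-1) * cos \<psi>) < h"
      using h by (intro order_tendstoD(2)[OF tendsto_diff[OF limf limY]]) auto
    ultimately have "\<forall>\<^sub>F t in at_right (0::real). False"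
      using dom[of "-1"] in_B
    proof eventually_elim
      case (elim t)
      then have "frame_point p m (X + t * sin \<psi>) (f X - t * cos \<psi>) \<notin> B" by (intro below) auto
      then show ?case using elim(4) move[of t "-1"] interior_subset[of B] by auto
    qed
    then show False by simp
  qed
  moreover have "\<exists>c s. boundary_arc_through B ?z c s"
    using smooth_f[OF X] by (simp add: smooth_boundary_point_def)
  ultimately show ?thesis
    unfolding inward_normal_def \<psi>_def[symmetric] \<nu>_def[symmetric]
    using unit_orthogonal_unique[of "velocity _ _" _ \<nu>] orth \<nu>(3)
    by (intro the_equality) blast+
qed

end

section \<open>Crossing a strip\<close>

text \<open>The eigenvector of the collision map for the eigenvalue 1. As
  \<open>arctan \<gamma>\<close> is half the characteristic angle and \<open>e2\<close> is
  \<open>- \<i>\<close> times the normal, it equals \<open>sin (\<beta>/2)\<close> times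
  \<open>e1\<close> minus \<open>cos (\<beta>/2)\<close> times \<open>e2\<close>.\<close>

definition axis :: "complex set \<Rightarrow> real \<Rightarrow> vec3 \<Rightarrow> vec3" where
  "axis B \<gamma> q = (sin (arctan \<gamma>), cos (arctan \<gamma>) *\<^sub>R (\<i> * inward_normal B (snd q)))"

lemma inner_axis_axis:
  assumes "norm (inward_normal B (snd q)) = 1"
  shows "axis B \<gamma> q \<bullet> axis B \<gamma> q = 1"
proof -
  have "axis B \<gamma> q \<bullet> axis B \<gamma> q = (sin (arctan \<gamma>))\<^sup>2
      + (cos (arctan \<gamma>))\<^sup>2 * ((\<i> * inward_normal B (snd q)) \<bullet> (\<i> * inward_normal B (snd q)))"
    by (simp add: axis_def power2_eq_square)
  moreover have "(\<i> * inward_normal B (snd q)) \<bullet> (\<i> * inward_normal B (snd q)) = 1"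
    using assms by (simp add: dot_square_norm norm_mult)
  ultimately show ?thesis by simp
qed

lemma complex_orthonormal_expansion:
  fixes n V :: complex
  assumes "norm n = 1"
  shows "V = (V \<bullet> (\<i> * n)) *\<^sub>R (\<i> * n) + (V \<bullet> n) *\<^sub>R n"
proof -
  have "V \<bullet> (\<i> * n) = ver n V"
    using hor_ver_mult[OF assms, of \<i>] by (simp add: inner_hor_ver[OF assms])
  moreover have "V \<bullet> n = hor n V" using assms by (simp add: hor_eq_inner)
  moreover have "Complex (hor n V) (ver n V) = of_real (hor n V) + \<i> * of_real (ver n V)"
    by (simp add: complex_eq_iff)
  ultimately show ?thesis
    using Complex_hor_ver[OF assms, of V] by (simp add: scaleR_conv_of_real algebra_simps)
qed

text \<open>On the span of \<open>e1\<close> and \<open>e2\<close> the collision is a reflection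
  with eigenvalues 1 and -1, and the normal contributes another -1: a half-turn about the
  eigenvector for 1. The computation is the double angle formulas for
  \<open>\<beta> = 2 * arctan \<gamma>\<close>.\<close>

lemma collision_eq_half_turn:
  assumes "norm (inward_normal B (snd q)) = 1"
  shows "collision B \<gamma> q v = (2 * (v \<bullet> axis B \<gamma> q)) *\<^sub>R axis B \<gamma> q - v"
proof -
  obtain x V where v: "v = (x, V)" by force
  define n where "n = inward_normal B (snd q)"
  define s c where "s = sin (arctan \<gamma>)" and "c = cos (arctan \<gamma>)"
  define b d where "b = V \<bullet> (\<i> * n)" and "d = V \<bullet> n"
  have V: "V = b *\<^sub>R (\<i> * n) + d *\<^sub>R n"
    using complex_orthonormal_expansion assms by (simp add: b_def d_def n_def)
  have \<beta>: "cos (characteristic_angle \<gamma>) = 1 - 2 * s\<^sup>2" "sin (characteristic_angle \<gamma>) = 2 * s * c"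
    "cos (characteristic_angle \<gamma>) = 2 * c\<^sup>2 - 1"
    unfolding characteristic_angle_def s_def c_def by (rule cos_double_sin sin_double cos_double_cos)+
  have va: "v \<bullet> axis B \<gamma> q = s * x + c * b"
    by (simp add: v axis_def s_def c_def b_def n_def)
  have ve: "v \<bullet> e1 = x" "v \<bullet> e2 B q = - b" "v \<bullet> e3 B q = d"
    by (simp_all add: v e1_def e2_def e3_def b_def d_def n_def inner_minus_right)
  have "collision B \<gamma> q v = ((- cos (characteristic_angle \<gamma>)) * x + sin (characteristic_angle \<gamma>) * b,
      (sin (characteristic_angle \<gamma>) * x + cos (characteristic_angle \<gamma>) * b) *\<^sub>R (\<i> * n) - d *\<^sub>R n)"
    unfolding collision_def Let_def ve by (simp add: e1_def e2_def e3_def n_def scaleR_conv_of_real algebra_simps)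
  also have "(- cos (characteristic_angle \<gamma>)) * x + sin (characteristic_angle \<gamma>) * b
      = (2 * s\<^sup>2 - 1) * x + 2 * s * c * b"
    using \<beta>(1,2) by simp
  also have "sin (characteristic_angle \<gamma>) * x + cos (characteristic_angle \<gamma>) * b
      = 2 * s * c * x + (2 * c\<^sup>2 - 1) * b"
    using \<beta>(2,3) by simp
  also have "((2 * s\<^sup>2 - 1) * x + 2 * s * c * b, (2 * s * c * x + (2 * c\<^sup>2 - 1) * b) *\<^sub>R (\<i> * n) - d *\<^sub>R n)
     = (2 * (s * x + c * b)) *\<^sub>R (s, c *\<^sub>R (\<i> * n)) - (x, b *\<^sub>R (\<i> * n) + d *\<^sub>R n)"
    by (simp add: power2_eq_square algebra_simps)
  finally show ?thesis unfolding va using V by (simp add: v axis_def s_def c_def n_def)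
qed

lemma norm_half_turn:
  fixes a v :: "'a::real_inner"
  assumes "a \<bullet> a = 1"
  shows "norm ((2 * (v \<bullet> a)) *\<^sub>R a - v) = norm v"
proof -
  have "((2 * (v \<bullet> a)) *\<^sub>R a - v) \<bullet> ((2 * (v \<bullet> a)) *\<^sub>R a - v) = v \<bullet> v"
    using assms by (simp add: inner_diff_left inner_diff_right inner_commute[of a v] algebra_simps)
  then show ?thesis by (simp add: norm_eq_sqrt_inner)
qed

lemma cis_arctan_has_vector_derivative:
  assumes "(\<phi> has_real_derivative \<phi>') (at X)"
  shows "((\<lambda>X. cis (arctan (\<phi> X))) has_vector_derivative
     (\<phi>' / (1 + (\<phi> X)\<^sup>2)) *\<^sub>R (\<i> * cis (arctan (\<phi> X)))) (at X)"
proof -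
  have "((\<lambda>X. arctan (\<phi> X)) has_real_derivative \<phi>' / (1 + (\<phi> X)\<^sup>2)) (at X)"
    using DERIV_chain2[OF DERIV_arctan assms] by (simp add: inverse_eq_divide)
  then have *: "((\<lambda>X. arctan (\<phi> X)) has_vector_derivative \<phi>' / (1 + (\<phi> X)\<^sup>2)) (at X)"
    by (simp add: has_real_derivative_iff_has_vector_derivative)
  have "((\<lambda>z. exp (\<i> * z)) has_field_derivative \<i> * exp (\<i> * of_real t)) (at (of_real t))" for t :: real
    by (auto intro!: derivative_eq_intros)
  then have "((\<lambda>t. exp (\<i> * of_real t)) has_vector_derivative \<i> * exp (\<i> * of_real t)) (at t)" for t :: real
    by (rule has_vector_derivative_real_field)
  from vector_diff_chain_at[OF * this]
  show ?thesis by (simp add: cis_conv_exp o_def)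
qed

context strip
begin

lemma inward_normal_upper:
  assumes X: "l < X" "X < r"
  shows "inward_normal B (frame_point p m X (g X)) = - \<i> * cis (arctan (g1 X)) * m"
proof -
  interpret rot: strip B p "- m" "- r" "- l" h \<Lambda> "\<lambda>X. - g (- X)" "\<lambda>X. g1 (- X)" "\<lambda>X. - g2 (- X)"
      "\<lambda>X. - f (- X)" "\<lambda>X. f1 (- X)" "\<lambda>X. - f2 (- X)"
    by (rule rotated)
  have "frame_point p m X (g X) = frame_point p (- m) (- X) (- g X)"
    by (simp add: frame_point_def complex_eq_iff)
  then show ?thesis using rot.inward_normal_lower[of "- X"] X by simp
qed

text \<open>The last condition is a cone condition: the velocity is steeper than both graphs, so that the
  trajectory leaves the lower graph at once and meets the upper one only once.\<close>

definition crossing :: "state \<Rightarrow> real \<Rightarrow> bool" where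
  "crossing \<xi> t \<longleftrightarrow> 0 < t \<and>
     l < hor m (snd (fst \<xi>) - p) \<and> hor m (snd (fst \<xi>) - p) < r \<and>
     ver m (snd (fst \<xi>) - p) = f (hor m (snd (fst \<xi>) - p)) \<and>
     l < hor m (snd (fst \<xi> + t *\<^sub>R snd \<xi>) - p) \<and> hor m (snd (fst \<xi> + t *\<^sub>R snd \<xi>) - p) < r \<and>
     ver m (snd (fst \<xi> + t *\<^sub>R snd \<xi>) - p) = g (hor m (snd (fst \<xi> + t *\<^sub>R snd \<xi>) - p)) \<and>
     \<Lambda> * \<bar>hor m (snd (snd \<xi>))\<bar> < ver m (snd (snd \<xi>))"

lemma on_lower:
  assumes "ver m (z - p) = f (hor m (z - p))"
  shows "frame_point p m (hor m (z - p)) (f (hor m (z - p))) = z"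
  using assms frame_point_coordinates(3)[OF m] by metis

lemma on_upper:
  assumes "ver m (z - p) = g (hor m (z - p))"
  shows "frame_point p m (hor m (z - p)) (g (hor m (z - p))) = z"
  using assms frame_point_coordinates(3)[OF m] by metis

lemma cone_slope:
  assumes "\<Lambda> * \<bar>a\<bar> < b" "\<bar>k\<bar> \<le> \<Lambda>"
  shows "k * a < b"
proof -
  have "k * a \<le> \<bar>k\<bar> * \<bar>a\<bar>" by (metis abs_ge_self abs_mult)
  also have "\<dots> \<le> \<Lambda> * \<bar>a\<bar>" using assms by (intro mult_right_mono) auto
  finally show ?thesis using assms by simp
qed

lemma above_lower:
  assumes "\<Lambda> * \<bar>a\<bar> < b" "l < X" "X < r" "l < X + s * a" "X + s * a < r" "0 < s"
  shows "f (X + s * a) < f X + s * b"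
proof -
  have "f (X + s * a) \<le> f X + \<Lambda> * \<bar>s * a\<bar>"
    using lipschitz(1)[of "X + s * a" X] assms by auto
  also have "\<Lambda> * \<bar>s * a\<bar> = s * (\<Lambda> * \<bar>a\<bar>)" using assms by (simp add: abs_mult)
  also have "\<dots> < s * b" using assms by simp
  finally show ?thesis by simp
qed

lemma above_upper:
  assumes "\<Lambda> * \<bar>a\<bar> < b" "l < X" "X < r" "l < X + s * a" "X + s * a < r" "0 < s"
  shows "g (X + s * a) < g X + s * b"
proof -
  have "g (X + s * a) \<le> g X + \<Lambda> * \<bar>s * a\<bar>"
    using lipschitz(2)[of "X + s * a" X] assms by auto
  also have "\<Lambda> * \<bar>s * a\<bar> = s * (\<Lambda> * \<bar>a\<bar>)" using assms by (simp add: abs_mult)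
  also have "\<dots> < s * b" using assms by simp
  finally show ?thesis by simp
qed

text \<open>By the cone condition the trajectory is above the lower graph when compared from its
  start, and below the upper graph when compared backwards from its end. In between it is therefore
  in the interior, and \<open>t\<close> is the least hitting time.\<close>

lemma crossing_hitting_times:
  assumes "crossing \<xi> t"
  shows "t \<in> hitting_times B \<xi>" and "Inf (hitting_times B \<xi>) = t"
proof -
  obtain x z w V where \<xi>: "\<xi> = ((x, z), (w, V))" by (metis prod.collapse)
  define X a b where "X = hor m (z - p)" and "a = hor m V" and "b = ver m V"
  have co: "hor m (z + s *\<^sub>R V - p) = X + s * a" "ver m (z + s *\<^sub>R V - p) = ver m (z - p) + s * b" for s
    by (simp_all add: X_def a_def b_def hor_simps ver_simps)
  have c: "0 < t" "l < X" "X < r" "ver m (z - p) = f X" "l < X + t * a" "X + t * a < r"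
    "f X + t * b = g (X + t * a)" "\<Lambda> * \<bar>a\<bar> < b"
    using assms unfolding crossing_def by (simp_all add: \<xi> co flip: X_def a_def b_def)
  have pos: "frame_point p m (X + s * a) (f X + s * b) = z + s *\<^sub>R V" for s
    using frame_point_coordinates(3)[OF m, of p "z + s *\<^sub>R V"] by (simp add: co c)
  show t: "t \<in> hitting_times B \<xi>"
    using smooth_boundary_point_frontier[OF smooth_g[OF c(5,6)]] pos[of t] c(1,7)
    by (simp add: hitting_times_def boundary_M_def \<xi>)
  have "s \<notin> hitting_times B \<xi>" if s: "0 < s" "s < t" for s
  proof -
    have "l < X + s * a" "X + s * a < r"
    proof -
      have "s * a \<le> t * a \<or> s * a \<le> 0" "s * a \<ge> t * a \<or> s * a \<ge> 0"
        using s by (simp_all add: mult_le_cancel_right mult_le_0_iff zero_le_mult_iff)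
      then show "l < X + s * a" "X + s * a < r" using c by linarith+
    qed
    note s' = this
    have "f (X + s * a) < f X + s * b" using above_lower c s s' by blast
    moreover have "g ((X + t * a) + (t - s) * (- a)) > g (X + t * a) - (t - s) * b"
    proof -
      have "g (X + s * a + (t - s) * a) < g (X + s * a) + (t - s) * b"
        using above_upper[of a b "X + s * a" "t - s"] c s s' by (simp add: algebra_simps)
      then show ?thesis by (simp add: algebra_simps)
    qed
    then have "f X + s * b < g (X + s * a)" using c(7) by (simp add: algebra_simps)
    ultimately have "z + s *\<^sub>R V \<in> interior B" using between s' pos by metis
    then show ?thesis by (simp add: hitting_times_def boundary_M_def \<xi> frontier_def)
  qed
  then show "Inf (hitting_times B \<xi>) = t"
    using t by (intro cInf_eq_minimum) (force simp: hitting_times_def not_less)+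
qed

lemma crossing_normals:
  assumes "crossing \<xi> t"
  defines "q' \<equiv> fst \<xi> + t *\<^sub>R snd \<xi>"
  shows "norm (inward_normal B (snd (fst \<xi>))) = 1" "norm (inward_normal B (snd q')) = 1"
    "inward_normal B (snd (fst \<xi>)) = \<i> * cis (arctan (f1 (hor m (snd (fst \<xi>) - p)))) * m"
    "inward_normal B (snd q') = - \<i> * cis (arctan (g1 (hor m (snd q' - p)))) * m"
    "snd \<xi> \<bullet> e3 B (fst \<xi>) > 0" "snd \<xi> \<bullet> e3 B q' < 0"
    "smooth_boundary_point B (snd (fst \<xi>))" "smooth_boundary_point B (snd q')"
proof -
  let ?X = "hor m (snd (fst \<xi>) - p)" and ?X' = "hor m (snd q' - p)"
  have c: "l < ?X" "?X < r" "ver m (snd (fst \<xi>) - p) = f ?X"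
    "l < ?X'" "?X' < r" "ver m (snd q' - p) = g ?X'" "\<Lambda> * \<bar>hor m (snd (snd \<xi>))\<bar> < ver m (snd (snd \<xi>))"
    using assms by (simp_all add: crossing_def)
  show n1: "inward_normal B (snd (fst \<xi>)) = \<i> * cis (arctan (f1 ?X)) * m"
    using inward_normal_lower[OF c(1,2)] on_lower[OF c(3)] by simp
  show n2: "inward_normal B (snd q') = - \<i> * cis (arctan (g1 ?X')) * m"
    using inward_normal_upper[OF c(4,5)] on_upper[OF c(6)] by simp
  show "norm (inward_normal B (snd (fst \<xi>))) = 1" "norm (inward_normal B (snd q')) = 1"
    unfolding n1 n2 by (simp_all add: norm_mult m)
  show "smooth_boundary_point B (snd (fst \<xi>))" "smooth_boundary_point B (snd q')"
    using smooth_f[OF c(1,2)] on_lower[OF c(3)] smooth_g[OF c(4,5)] on_upper[OF c(6)] by simp_all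
  have "snd \<xi> \<bullet> e3 B (fst \<xi>) = cos (arctan (f1 ?X)) * (ver m (snd (snd \<xi>)) - f1 ?X * hor m (snd (snd \<xi>)))"
    unfolding e3_def n1
    by (simp add: inner_prod_def inner_hor_ver[OF m] hor_ver_mult[OF m] sin_arctan_cos_arctan)
      (simp add: algebra_simps)
  then show "snd \<xi> \<bullet> e3 B (fst \<xi>) > 0"
    using cone_slope[OF c(7) slope_f[OF c(1,2)]] cos_arctan_pos by simp
  have "snd \<xi> \<bullet> e3 B q' = - (cos (arctan (g1 ?X')) * (ver m (snd (snd \<xi>)) - g1 ?X' * hor m (snd (snd \<xi>))))"
    unfolding e3_def n2
    by (simp add: inner_prod_def inner_hor_ver[OF m] hor_ver_mult[OF m] hor_simps ver_simps sin_arctan_cos_arctan)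
      (simp add: algebra_simps)
  then show "snd \<xi> \<bullet> e3 B q' < 0"
    using cone_slope[OF c(7) slope_g[OF c(4,5)]] cos_arctan_pos by simp
qed

lemma crossing_billiard_map:
  assumes "crossing \<xi> t"
  defines "q' \<equiv> fst \<xi> + t *\<^sub>R snd \<xi>"
  shows "billiard_map B \<gamma> \<xi> = (q', (2 * (snd \<xi> \<bullet> axis B \<gamma> q')) *\<^sub>R axis B \<gamma> q' - snd \<xi>)"
  using crossing_hitting_times(2)[OF assms(1)] collision_eq_half_turn[of B q' \<gamma> "snd \<xi>"]
    crossing_normals(2)[OF assms(1)]
  by (simp add: billiard_map_def Let_def q'_def)

lemma inner_axis_e3: "axis B \<gamma> q \<bullet> e3 B q = 0"
  by (simp add: axis_def e3_def inner_complex_def)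

lemma crossing_in_billiard_domain:
  assumes "crossing \<xi> t" "norm (snd \<xi>) = 1"
  shows "\<xi> \<in> phase_space B" "billiard_map B \<gamma> \<xi> \<in> phase_space B" "\<xi> \<in> billiard_domain B \<gamma>"
proof -
  note n = crossing_normals[OF assms(1)]
  define q' where "q' = fst \<xi> + t *\<^sub>R snd \<xi>"
  show 1: "\<xi> \<in> phase_space B"
    using n assms smooth_boundary_point_frontier
    by (auto simp: phase_space_def boundary_M_def case_prod_beta)
  have "norm ((2 * (snd \<xi> \<bullet> axis B \<gamma> q')) *\<^sub>R axis B \<gamma> q' - snd \<xi>) = 1"
    using n(2) by (simp add: norm_half_turn inner_axis_axis q'_def assms)
  moreover have "((2 * (snd \<xi> \<bullet> axis B \<gamma> q')) *\<^sub>R axis B \<gamma> q' - snd \<xi>) \<bullet> e3 B q' > 0"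
    using n(6) by (simp add: inner_diff_left inner_axis_e3 q'_def)
  ultimately show 2: "billiard_map B \<gamma> \<xi> \<in> phase_space B"
    unfolding crossing_billiard_map[OF assms(1)]
    using n(8) smooth_boundary_point_frontier by (auto simp: phase_space_def boundary_M_def q'_def)
  show "\<xi> \<in> billiard_domain B \<gamma>"
    using 1 2 crossing_hitting_times(1)[OF assms(1)] by (auto simp: billiard_domain_def)
qed


text \<open>A nearby state of the phase space is based on the frontier, close to the lower graph and
  hence on it. Its trajectory is below the upper graph slightly before \<open>t0\<close> and above
  it slightly after, so it meets that graph in between. This is also the continuity of the flight
  time.\<close>

lemma crossing_nearby:
  assumes c0: "crossing \<xi>0 t0" and e: "0 < e"
  shows "\<forall>\<^sub>F \<xi> in at \<xi>0 within phase_space B. \<exists>t. \<bar>t - t0\<bar> < e \<and> crossing \<xi> t"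
proof -
  define x y :: "real \<Rightarrow> state \<Rightarrow> real"
    where "x s \<xi> = hor m (snd (fst \<xi> + s *\<^sub>R snd \<xi>) - p)"
      and "y s \<xi> = ver m (snd (fst \<xi> + s *\<^sub>R snd \<xi>) - p)" for s \<xi>
  define a b :: "state \<Rightarrow> real" where "a \<xi> = hor m (snd (snd \<xi>))" and "b \<xi> = ver m (snd (snd \<xi>))" for \<xi>
  let ?F = "at \<xi>0 within phase_space B"
  have xy: "x s \<xi> = x 0 \<xi> + s * a \<xi>" "y s \<xi> = y 0 \<xi> + s * b \<xi>" for s \<xi>
    by (simp_all add: x_def y_def a_def b_def hor_simps ver_simps)
  have cr: "crossing \<xi> t \<longleftrightarrow> 0 < t \<and> l < x 0 \<xi> \<and> x 0 \<xi> < r \<and> y 0 \<xi> = f (x 0 \<xi>) \<and>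
      l < x t \<xi> \<and> x t \<xi> < r \<and> y t \<xi> = g (x t \<xi>) \<and> \<Lambda> * \<bar>a \<xi>\<bar> < b \<xi>" for \<xi> t
    by (simp add: crossing_def x_def y_def a_def b_def)
  have c: "0 < t0" "l < x 0 \<xi>0" "x 0 \<xi>0 < r" "y 0 \<xi>0 = f (x 0 \<xi>0)"
      "l < x t0 \<xi>0" "x t0 \<xi>0 < r" "y t0 \<xi>0 = g (x t0 \<xi>0)" "\<Lambda> * \<bar>a \<xi>0\<bar> < b \<xi>0"
    using c0 by (simp_all add: cr)
  have lims: "((\<lambda>\<xi>. x s \<xi>) \<longlongrightarrow> x s \<xi>0) ?F" "((\<lambda>\<xi>. y s \<xi>) \<longlongrightarrow> y s \<xi>0) ?F"
      "(a \<longlongrightarrow> a \<xi>0) ?F" "(b \<longlongrightarrow> b \<xi>0) ?F" for s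
    unfolding x_def y_def a_def b_def by (intro tendsto_intros)+
  have limf: "((\<lambda>\<xi>. f (x s \<xi>)) \<longlongrightarrow> f (x s \<xi>0)) ?F"
    and limg: "((\<lambda>\<xi>. g (x s \<xi>)) \<longlongrightarrow> g (x s \<xi>0)) ?F" if "l < x s \<xi>0" "x s \<xi>0 < r" for s
    using isCont_fg[OF that] lims(1) by (auto intro: isCont_tendsto_compose)
  have "\<forall>\<^sub>F s in nhds t0. l < x s \<xi>0 \<and> x s \<xi>0 < r"
  proof -
    have "continuous_on UNIV (\<lambda>s. x s \<xi>0)" by (subst xy) (auto intro!: continuous_intros)
    then have L: "filterlim (\<lambda>s. x s \<xi>0) (nhds (x t0 \<xi>0)) (nhds t0)"
      using tendsto_at_iff_tendsto_nhds[of "\<lambda>s. x s \<xi>0" t0]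
      by (simp add: continuous_on_eq_continuous_at continuous_at)
    show ?thesis by (intro eventually_conj order_tendstoD(1)[OF L] order_tendstoD(2)[OF L] c)
  qed
  then obtain d where d: "d > 0" "\<And>s. \<bar>s - t0\<bar> < d \<Longrightarrow> l < x s \<xi>0 \<and> x s \<xi>0 < r"
    unfolding eventually_nhds_metric dist_real_def by blast
  \<comment> \<open>Below \<open>e\<close> for the required accuracy, below \<open>d\<close> so that
    both comparison times remain over the interval, below \<open>t0\<close> so that the hitting time
    found is positive.\<close>
  define \<rho> where "\<rho> = min (min (e / 2) (d / 2)) (t0 / 2)"
  have \<rho>: "0 < \<rho>" "\<rho> < e" "\<rho> < d" "\<rho> < t0" using e d(1) c(1) by (auto simp: \<rho>_def)
  define s1 s2 where "s1 = t0 - \<rho>" and "s2 = t0 + \<rho>"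
  have s12: "l < x s1 \<xi>0" "x s1 \<xi>0 < r" "l < x s2 \<xi>0" "x s2 \<xi>0 < r"
    using d(2)[of s1] d(2)[of s2] \<rho> by (simp_all add: s1_def s2_def)
  have rel: "x s' \<xi> = x s \<xi> + (s' - s) * a \<xi>" "y s' \<xi> = y s \<xi> + (s' - s) * b \<xi>" for s s' \<xi>
    using xy[of s \<xi>] xy[of s' \<xi>] by (simp_all add: algebra_simps)
  have gap1: "y s1 \<xi>0 - g (x s1 \<xi>0) < 0"
  proof -
    have "x t0 \<xi>0 = x s1 \<xi>0 + \<rho> * a \<xi>0" "y t0 \<xi>0 = y s1 \<xi>0 + \<rho> * b \<xi>0"
      using rel[of t0 \<xi>0 s1] by (simp_all add: s1_def)
    then show ?thesis
      using above_upper[OF c(8) s12(1,2), of \<rho>] c(5-7) \<rho>(1) by simp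
  qed
  have gap2: "y s2 \<xi>0 - g (x s2 \<xi>0) > 0"
  proof -
    have "x s2 \<xi>0 = x t0 \<xi>0 + \<rho> * a \<xi>0" "y s2 \<xi>0 = y t0 \<xi>0 + \<rho> * b \<xi>0"
      using rel[of s2 \<xi>0 t0] by (simp_all add: s2_def)
    then show ?thesis
      using above_upper[OF c(8) c(5,6), of \<rho>] s12 c(7) \<rho>(1) by simp
  qed
  have "\<forall>\<^sub>F \<xi> in ?F. \<xi> \<in> phase_space B"
    by (simp add: eventually_at_filter)
  moreover have "\<forall>\<^sub>F \<xi> in ?F. \<Lambda> * \<bar>a \<xi>\<bar> - b \<xi> < 0"
    using c(8) by (intro order_tendstoD(2)[OF tendsto_diff[OF tendsto_mult[OF tendsto_const tendsto_rabs[OF lims(3)]] lims(4)]]) auto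
  moreover have "\<forall>\<^sub>F \<xi> in ?F. l < x 0 \<xi> \<and> x 0 \<xi> < r \<and> l < x s1 \<xi> \<and> x s1 \<xi> < r \<and> l < x s2 \<xi> \<and> x s2 \<xi> < r"
    using c s12 by (intro eventually_conj order_tendstoD[OF lims(1)])
  moreover have "\<forall>\<^sub>F \<xi> in ?F. y s1 \<xi> - g (x s1 \<xi>) < 0"
    by (rule order_tendstoD(2)[OF tendsto_diff[OF lims(2) limg[OF s12(1,2)]] gap1])
  moreover have "\<forall>\<^sub>F \<xi> in ?F. y s2 \<xi> - g (x s2 \<xi>) > 0"
    by (rule order_tendstoD(1)[OF tendsto_diff[OF lims(2) limg[OF s12(3,4)]] gap2])
  moreover have "\<forall>\<^sub>F \<xi> in ?F. f (x 0 \<xi>) - y 0 \<xi> < h"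
    using h c(4) by (intro order_tendstoD(2)[OF tendsto_diff[OF limf[OF c(2,3)] lims(2)]]) simp
  moreover have "\<forall>\<^sub>F \<xi> in ?F. g (x 0 \<xi>) - y 0 \<xi> > 0"
    using c(4) f_less_g[OF c(2,3)] by (intro order_tendstoD(1)[OF tendsto_diff[OF limg[OF c(2,3)] lims(2)]]) simp
  ultimately show ?thesis
  proof eventually_elim
    case (elim \<xi>)
    have "frame_point p m (x 0 \<xi>) (y 0 \<xi>) \<in> frontier B"
      using elim(1) by (auto simp: phase_space_def boundary_M_def x_def y_def frame_point_coordinates[OF m])
    then have y0: "y 0 \<xi> = f (x 0 \<xi>)" using elim by (intro frontier_lower) auto
    have in_strip: "l < x s \<xi> \<and> x s \<xi> < r" if "s1 \<le> s" "s \<le> s2" for s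
    proof -
      have "s * a \<xi> \<le> s2 * a \<xi> \<or> s * a \<xi> \<le> s1 * a \<xi>" "s1 * a \<xi> \<le> s * a \<xi> \<or> s2 * a \<xi> \<le> s * a \<xi>"
        using that by (simp_all add: mult_le_cancel_right)
      then show ?thesis using elim(3) xy(1)[of s \<xi>] xy(1)[of s1 \<xi>] xy(1)[of s2 \<xi>] by linarith
    qed
    have "\<exists>s\<ge>s1. s \<le> s2 \<and> y s \<xi> - g (x s \<xi>) = 0"
    proof (intro IVT allI impI)
      show "y s1 \<xi> - g (x s1 \<xi>) \<le> 0" "0 \<le> y s2 \<xi> - g (x s2 \<xi>)" "s1 \<le> s2"
        using elim \<rho> by (simp_all add: s1_def s2_def)
      fix s assume s: "s1 \<le> s \<and> s \<le> s2"
      have "isCont (\<lambda>s. x s \<xi>) s" "isCont (\<lambda>s. y s \<xi>) s"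
        by (subst xy, auto intro!: continuous_intros)+
      moreover from this(1) have "isCont (\<lambda>s. g (x s \<xi>)) s"
        using in_strip[of s] s by (intro isCont_o2[OF _ isCont_fg(2)]) auto
      ultimately show "isCont (\<lambda>s. y s \<xi> - g (x s \<xi>)) s"
        by (intro continuous_intros)
    qed
    then obtain s where "s1 \<le> s" "s \<le> s2" "y s \<xi> = g (x s \<xi>)" by auto
    then have "\<bar>s - t0\<bar> < e \<and> crossing \<xi> s"
      using in_strip[of s] elim y0 \<rho> by (simp add: cr s1_def s2_def abs_less_iff)
    then show ?case by blast
  qed
qed

text \<open>The new velocity is \<open>2 (v \<bullet> A) A - v\<close> with \<open>A\<close> the
  axis at the hitting point. Since \<open>v\<close> is orthogonal to the axis at the base state, the
  term with \<open>v \<bullet> A\<close> times the derivative of \<open>A\<close> vanishes. The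
  turning of the axis thus acts only through a covector \<open>k\<close> multiplying
  \<open>n\<close>, and \<open>k\<close> is bounded by the second derivative of the graph.\<close>

lemma flight_derivative:
  fixes \<gamma> :: real
  assumes c0: "crossing (q, v) t" and nv: "norm v = 1"
  defines "q' \<equiv> q + t *\<^sub>R v"
  defines "n \<equiv> axis B \<gamma> q'"
  defines "\<pi> \<equiv> \<lambda>x :: vec3. x - ((x \<bullet> e3 B q') / (v \<bullet> e3 B q')) *\<^sub>R v"
  assumes vn: "v \<bullet> n = 0"
  obtains k where "norm k \<le> \<bar>g2 (hor m (snd q' - p))\<bar>"
    "(billiard_map B \<gamma> has_derivative (\<lambda>(dq, dv). (\<pi> (dq + t *\<^sub>R dv),
        - dv - (2 * (k \<bullet> \<pi> (dq + t *\<^sub>R dv) - dv \<bullet> n)) *\<^sub>R n))) (at (q, v) within phase_space B)"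
proof -
  let ?\<xi> = "(q, v)"
  let ?N = "at ?\<xi> within phase_space B"
  define X where "X = hor m (snd q' - p)"
  have X: "l < X" "X < r" "ver m (snd q' - p) = g X"
    using c0 by (simp_all add: crossing_def X_def q'_def)
  define \<tau> where "\<tau> \<xi> = Inf (hitting_times B \<xi>)" for \<xi>
  have \<tau>0: "\<tau> ?\<xi> = t" unfolding \<tau>_def by (rule crossing_hitting_times(2)[OF c0])
  have near: "\<forall>\<^sub>F \<xi> in ?N. \<bar>\<tau> \<xi> - t\<bar> < e \<and> crossing \<xi> (\<tau> \<xi>)" if "e > 0" for e
    using crossing_nearby[OF c0 that]
    by (rule eventually_mono) (auto simp: \<tau>_def crossing_hitting_times(2))
  have lim\<tau>: "(\<tau> \<longlongrightarrow> \<tau> ?\<xi>) ?N"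
    unfolding tendsto_iff \<tau>0 dist_real_def using near by (blast intro: eventually_mono)
  \<comment> \<open>Height above the upper graph after time \<open>s\<close>; the flight time is its
    zero.\<close>
  define F where "F = (\<lambda>(\<xi> :: state, s). ver m (snd (fst \<xi> + s *\<^sub>R snd \<xi>) - p) - g (hor m (snd (fst \<xi> + s *\<^sub>R snd \<xi>) - p)))"
  define F' where "F' = (\<lambda>(d :: state, s). ver m (snd (fst d + t *\<^sub>R snd d + s *\<^sub>R v)) - g1 X * hor m (snd (fst d + t *\<^sub>R snd d + s *\<^sub>R v)))"
  define L where "L w = ver m (snd w) - g1 X * hor m (snd w)" for w :: vec3
  have \<nu>: "inward_normal B (snd q') = - \<i> * cis (arctan (g1 X)) * m"
    using crossing_normals(4)[OF c0] by (simp add: q'_def X_def)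
  have L: "w \<bullet> e3 B q' = - (cos (arctan (g1 X)) * L w)" for w
    unfolding e3_def \<nu> L_def
    by (simp add: inner_prod_def inner_hor_ver[OF m] hor_ver_mult[OF m] hor_simps ver_simps sin_arctan_cos_arctan)
      (simp add: algebra_simps)
  \<comment> \<open>Numerator and denominator are normal components up to the same factor. In this
    form the derivative of the hitting point is the projection along \<open>v\<close> onto the
    tangent plane.\<close>
  have ratio: "- F' (d, 0) / F' (0, 1) = - ((fst d + t *\<^sub>R snd d) \<bullet> e3 B q') / (v \<bullet> e3 B q')" for d
  proof -
    have "F' (d, 0) = L (fst d + t *\<^sub>R snd d)" "F' (0, 1) = L v"
      by (simp_all add: F'_def L_def)
    moreover have "cos (arctan (g1 X)) \<noteq> 0" using cos_arctan_pos[of "g1 X"] by simp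
    ultimately show ?thesis by (simp add: L)
  qed
  have F'1: "F' (0, 1) \<noteq> 0"
  proof -
    have "v \<bullet> e3 B q' \<noteq> 0" using crossing_normals(6)[OF c0] by (simp add: q'_def)
    then show ?thesis by (simp add: L F'_def L_def)
  qed
  have DF: "(F has_derivative F') (at (?\<xi>, \<tau> ?\<xi>))"
  proof -
    have g: "(g has_derivative (*) (g1 X)) (at (hor m (snd (q + t *\<^sub>R v) - p)))"
      using DERIV_g[OF X(1,2)] by (simp add: has_field_derivative_def X_def q'_def)
    define W W' where "W y = fst (fst y) + snd y *\<^sub>R snd (fst y)"
      and "W' y = fst (fst y) + t *\<^sub>R snd (fst y) + snd y *\<^sub>R v" for y :: "state \<times> real"
    have DW: "(W has_derivative W') (at (?\<xi>, t))"
      unfolding W_def W'_def by (rule derivative_eq_intros refl)+ (simp add: fun_eq_iff)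
    have Dh: "((\<lambda>y. hor m (snd (W y) - p)) has_derivative (\<lambda>y. hor m (snd (W' y)))) (at (?\<xi>, t))"
      by (rule derivative_eq_intros DW refl)+ simp
    have Dv: "((\<lambda>y. ver m (snd (W y) - p)) has_derivative (\<lambda>y. ver m (snd (W' y)))) (at (?\<xi>, t))"
      by (rule derivative_eq_intros DW refl)+ simp
    have "((\<lambda>y. ver m (snd (W y) - p) - g (hor m (snd (W y) - p))) has_derivative
        (\<lambda>y. ver m (snd (W' y)) - g1 X * hor m (snd (W' y)))) (at (?\<xi>, t))"
      using g by (intro has_derivative_diff Dv has_derivative_compose[OF Dh]) (simp add: W_def)
    then show ?thesis
      unfolding F_def F'_def case_prod_beta \<tau>0 W_def W'_def .
  qed
  have evF: "\<forall>\<^sub>F \<xi> in ?N. F (\<xi>, \<tau> \<xi>) = F (?\<xi>, \<tau> ?\<xi>)"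
  proof -
    have z: "F (\<xi>, s) = 0" if "crossing \<xi> s" for \<xi> s
      using that by (simp add: F_def crossing_def)
    show ?thesis using near[OF zero_less_one] z[of ?\<xi> t] c0 z by (auto simp: \<tau>0 elim: eventually_mono)
  qed
  have D\<tau>: "(\<tau> has_derivative (\<lambda>d. - ((fst d + t *\<^sub>R snd d) \<bullet> e3 B q') / (v \<bullet> e3 B q'))) ?N"
    using implicit_function_has_derivative[of F F' ?\<xi> \<tau>, OF DF F'1 lim\<tau> evF] unfolding ratio .
  define Q where "Q \<xi> = fst \<xi> + \<tau> \<xi> *\<^sub>R snd \<xi>" for \<xi>
  have Q0: "Q ?\<xi> = q'" by (simp add: Q_def \<tau>0 q'_def)
  have DQ: "(Q has_derivative (\<lambda>d. \<pi> (fst d + t *\<^sub>R snd d))) ?N"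
    unfolding Q_def
    by (rule derivative_eq_intros D\<tau> refl)+
      (simp add: fun_eq_iff \<tau>0 \<pi>_def add_ac flip: minus_divide_left)
  define s c where "s = sin (arctan \<gamma>)" and "c = cos (arctan \<gamma>)"
  define A where "A X = (s, c *\<^sub>R (cis (arctan (g1 X)) * m))" for X
  define A1 where "A1 = (0 :: real, c *\<^sub>R (((g2 X / (1 + (g1 X)\<^sup>2)) *\<^sub>R (\<i> * cis (arctan (g1 X)))) * m))"
  have axisA: "axis B \<gamma> (fst \<xi> + u *\<^sub>R snd \<xi>) = A (hor m (snd (fst \<xi> + u *\<^sub>R snd \<xi>) - p))" if "crossing \<xi> u" for \<xi> u
    unfolding axis_def A_def crossing_normals(4)[OF that] by (simp add: s_def c_def flip: mult.assoc)
  have nA: "n = A X" using axisA[OF c0] by (simp add: n_def q'_def X_def)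
  have "(A has_vector_derivative A1) (at X)"
    unfolding A_def A1_def
    by (intro has_vector_derivative_Pair has_vector_derivative_const
       bounded_linear.has_vector_derivative[OF bounded_linear_scaleR_right]
       has_vector_derivative_mult_left cis_arctan_has_vector_derivative DERIV_g1 X)
  then have "(A has_derivative (\<lambda>h. h *\<^sub>R A1)) (at (hor m (snd (Q ?\<xi>) - p)))"
    by (simp add: has_vector_derivative_def Q0 X_def)
  moreover have "((\<lambda>\<xi>. hor m (snd (Q \<xi>) - p)) has_derivative
      (\<lambda>d. hor m (snd (\<pi> (fst d + t *\<^sub>R snd d))))) ?N"
    by (rule derivative_eq_intros DQ refl)+ simp
  ultimately have DA: "((\<lambda>\<xi>. A (hor m (snd (Q \<xi>) - p))) has_derivative
      (\<lambda>d. hor m (snd (\<pi> (fst d + t *\<^sub>R snd d))) *\<^sub>R A1)) ?N"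
    by (rule has_derivative_compose[rotated])
  \<comment> \<open>Represents the functional \<open>x \<mapsto> - v \<bullet> (derivative of the
    axis in the direction x)\<close>; the axis depends on the hitting point only through its
    coordinate along \<open>m\<close>.\<close>
  define k :: vec3 where "k = (- (v \<bullet> A1)) *\<^sub>R (0, m)"
  have kx: "k \<bullet> x = - (v \<bullet> A1) * hor m (snd x)" for x
    by (simp add: k_def inner_prod_def hor_eq_inner[OF m] inner_commute)
  have "norm A1 = \<bar>c\<bar> * (\<bar>g2 X\<bar> / (1 + (g1 X)\<^sup>2))"
    by (simp add: A1_def norm_Pair norm_mult m abs_mult)
  also have "\<dots> \<le> 1 * (\<bar>g2 X\<bar> / 1)"
    by (intro mult_mono divide_left_mono) (auto simp: c_def intro: add_pos_nonneg)
  finally have nA1: "norm A1 \<le> \<bar>g2 X\<bar>" by simp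
  have "norm k = \<bar>v \<bullet> A1\<bar>" by (simp add: k_def norm_Pair m abs_mult)
  also have "\<dots> \<le> norm v * norm A1" by (rule Cauchy_Schwarz_ineq2)
  finally have nk: "norm k \<le> \<bar>g2 X\<bar>" using nA1 nv by simp
  define T where "T \<xi> = (Q \<xi>, (2 * (snd \<xi> \<bullet> A (hor m (snd (Q \<xi>) - p)))) *\<^sub>R A (hor m (snd (Q \<xi>) - p)) - snd \<xi>)" for \<xi>
  have TB: "billiard_map B \<gamma> \<xi> = T \<xi>" if "crossing \<xi> (\<tau> \<xi>)" for \<xi>
    using crossing_billiard_map[OF that, of \<gamma>] axisA[OF that] by (simp add: T_def Q_def)
  have "(T has_derivative (\<lambda>d. (\<pi> (fst d + t *\<^sub>R snd d),
        - snd d - (2 * (k \<bullet> \<pi> (fst d + t *\<^sub>R snd d) - snd d \<bullet> n)) *\<^sub>R n))) ?N"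
    unfolding T_def
    apply (rule derivative_eq_intros DQ DA refl)+
    using vn by (simp add: fun_eq_iff Q0 kx flip: X_def nA) (simp add: algebra_simps)
  then have "(billiard_map B \<gamma> has_derivative (\<lambda>d. (\<pi> (fst d + t *\<^sub>R snd d),
        - snd d - (2 * (k \<bullet> \<pi> (fst d + t *\<^sub>R snd d) - snd d \<bullet> n)) *\<^sub>R n))) ?N"
  proof (rule has_derivative_transform_eventually)
    show "\<forall>\<^sub>F \<xi> in ?N. T \<xi> = billiard_map B \<gamma> \<xi>"
      using near[OF zero_less_one] by (auto simp: TB elim: eventually_mono)
    show "T ?\<xi> = billiard_map B \<gamma> ?\<xi>" using TB[of ?\<xi>] \<tau>0 c0 by simp
    show "?\<xi> \<in> phase_space B" using crossing_in_billiard_domain(1)[OF c0] nv by simp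
  qed
  then show thesis using that[of k] nk unfolding X_def case_prod_beta by blast
qed

end

section \<open>Period-two orbits of a strip\<close>

lemma hor_ver_neg: "hor (- m) z = - hor m z" "ver (- m) z = - ver m z"
  by (simp_all add: hor_def ver_def)

lemma cos_arctan_ge:
  assumes "\<bar>x\<bar> \<le> \<Lambda>"
  shows "1 / (1 + \<Lambda>) \<le> cos (arctan x)"
proof -
  have "sqrt (1 + x\<^sup>2) \<le> sqrt ((1 + \<Lambda>)\<^sup>2)"
  proof (rule real_sqrt_le_mono)
    have "x\<^sup>2 \<le> \<Lambda>\<^sup>2" using assms abs_le_square_iff[of x \<Lambda>] by linarith
    moreover have "(1 + \<Lambda>)\<^sup>2 = 1 + 2 * \<Lambda> + \<Lambda>\<^sup>2" by (simp add: power2_sum)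
    ultimately show "1 + x\<^sup>2 \<le> (1 + \<Lambda>)\<^sup>2" using assms by linarith
  qed
  then show ?thesis
    unfolding cos_arctan using assms by (intro divide_left_mono) (auto intro!: mult_pos_pos add_pos_nonneg)
qed

lemma abs_inner_projection_le:
  fixes k x e v :: "'a::real_inner"
  assumes "norm k \<le> K" "norm x = 1" "norm v = 1" "norm e = 1" "0 < \<kappa>" "\<kappa> \<le> \<bar>v \<bullet> e\<bar>"
  shows "\<bar>k \<bullet> (x - ((x \<bullet> e) / (v \<bullet> e)) *\<^sub>R v)\<bar> \<le> K * (1 + 1 / \<kappa>)"
proof -
  have "\<bar>x \<bullet> e\<bar> \<le> 1" using Cauchy_Schwarz_ineq2[of x e] assms by simp
  then have "\<bar>(x \<bullet> e) / (v \<bullet> e)\<bar> \<le> 1 / \<kappa>"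
    unfolding abs_divide using assms by (intro frac_le) auto
  then have "norm (x - ((x \<bullet> e) / (v \<bullet> e)) *\<^sub>R v) \<le> 1 + 1 / \<kappa>"
    using norm_triangle_ineq4[of x "((x \<bullet> e) / (v \<bullet> e)) *\<^sub>R v"] assms by simp
  then have "norm k * norm (x - ((x \<bullet> e) / (v \<bullet> e)) *\<^sub>R v) \<le> K * (1 + 1 / \<kappa>)"
    using assms by (intro mult_mono) (auto intro: order_trans[OF norm_ge_zero])
  then show ?thesis using Cauchy_Schwarz_ineq2 order_trans by blast
qed

context strip
begin

lemma crossing_eventually_phase_space:
  assumes "crossing \<xi> t"
  shows "\<forall>\<^sub>F \<eta> in at \<xi> within phase_space B. billiard_map B \<gamma> \<eta> \<in> phase_space B"
proof -
  have *: "norm (snd \<eta>) = 1" if "\<eta> \<in> phase_space B" for \<eta>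
    using that by (auto simp: phase_space_def)
  have "\<forall>\<^sub>F \<eta> in at \<xi> within phase_space B. \<eta> \<in> phase_space B"
    by (simp add: eventually_at_filter)
  then show ?thesis
    using crossing_nearby[OF assms zero_less_one]
    by eventually_elim (use * in \<open>blast intro: crossing_in_billiard_domain(2)\<close>)
qed

text \<open>\<open>balance\<close> is what remains of the two orthogonality conditions when the spin
  is eliminated. The left-hand side of the hypothesis on \<open>\<epsilon>\<close> is a product of
  bounds: \<open>2 * b * (1 + 1 / \<gamma>)\<close> for the flight time, \<open>K\<close> for the
  second derivatives, and the last factor for the oblique projections. Both factors of the trace
  parameter are then within \<open>\<epsilon>\<close> of \<open>- (n \<bullet> n')\<close>, and
  \<open>good\<close> asks exactly that their product stays between 0 and 1.\<close>

lemma elliptic_orbit: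
  fixes \<gamma> R X1 X2 K \<epsilon> :: real
  defines "a \<equiv> X2 - X1" and "b \<equiv> g X2 - f X1"
    and "\<psi>1 \<equiv> arctan (f1 X1)" and "\<psi>2 \<equiv> arctan (g1 X2)"
  assumes \<gamma>: "0 < \<gamma>" and X1: "l < X1" "X1 < r" and X2: "l < X2" "X2 < r"
    and ab: "0 < b" "\<bar>a\<bar> \<le> b" "2 * \<Lambda> * \<bar>a\<bar> \<le> b"
    and balance: "a * (cos \<psi>1 + cos \<psi>2) + b * (sin \<psi>1 + sin \<psi>2) = 0"
    and curv: "\<bar>f2 X1\<bar> \<le> K" "\<bar>g2 X2\<bar> \<le> K"
    and \<epsilon>: "2 * b * (1 + 1 / \<gamma>) * (K * (1 + 4 * (1 + \<Lambda>) * (1 + 1 / \<gamma>))) \<le> \<epsilon>"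
    and good: "\<And>x y. \<bar>x - ((cos (arctan \<gamma>))\<^sup>2 * cos (\<psi>2 - \<psi>1) - (sin (arctan \<gamma>))\<^sup>2)\<bar> \<le> \<epsilon> \<Longrightarrow>
        \<bar>y - ((cos (arctan \<gamma>))\<^sup>2 * cos (\<psi>2 - \<psi>1) - (sin (arctan \<gamma>))\<^sup>2)\<bar> \<le> \<epsilon> \<Longrightarrow>
        0 < x * y \<and> x * y < 1"
  shows "\<exists>\<xi>. period_two B \<gamma> R \<xi> \<and>
     (\<forall>n. snd (fst ((billiard_map B \<gamma> ^^ n) \<xi>)) \<in> {frame_point p m X1 (f X1), frame_point p m X2 (g X2)}) \<and>
     elliptic B \<gamma> \<xi>"
proof -
  interpret rot: strip B p "- m" "- r" "- l" h \<Lambda> "\<lambda>X. - g (- X)" "\<lambda>X. g1 (- X)" "\<lambda>X. - g2 (- X)"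
      "\<lambda>X. - f (- X)" "\<lambda>X. f1 (- X)" "\<lambda>X. - f2 (- X)"
    by (rule rotated)
  define s c where "s = sin (arctan \<gamma>)" and "c = cos (arctan \<gamma>)"
  have sc: "s = \<gamma> * c" by (simp add: s_def c_def sin_arctan_cos_arctan)
  have \<Lambda>: "0 \<le> \<Lambda>" using slope_f[OF X1] by linarith
  define P1 P2 where "P1 = frame_point p m X1 (f X1)" and "P2 = frame_point p m X2 (g X2)"
  define V where "V = P2 - P1"
  \<comment> \<open>The spin that makes the velocity orthogonal to the axis at the lower end; by \<open>balance\<close> it is then
     orthogonal to the axis at the upper end.\<close>
  define w where "w = (a * cos \<psi>1 + b * sin \<psi>1) / \<gamma>"
  define t where "t = norm (w, V)"
  define v where "v = (1 / t) *\<^sub>R (w, V)"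
  define q q' where "q = (0 :: real, P1)" and "q' = (w, P2)"
  have V: "hor m V = a" "ver m V = b"
  proof -
    have "V = (P2 - p) - (P1 - p)" by (simp add: V_def)
    then have "hor m V = hor m (P2 - p) - hor m (P1 - p)" "ver m V = ver m (P2 - p) - ver m (P1 - p)"
      by (simp_all only: hor_simps ver_simps)
    then show "hor m V = a" "ver m V = b"
      by (simp_all only: P1_def P2_def frame_point_coordinates[OF m] a_def b_def)
  qed
  have V0: "V \<noteq> 0" using V(2) ab(1) by (auto simp: ver_simps)
  have t0: "t > 0" using V0 by (simp add: t_def norm_Pair add_nonneg_pos)
  have tv: "t *\<^sub>R v = (w, V)" using t0 by (simp add: v_def)
  have nv: "norm v = 1" unfolding v_def norm_scaleR t_def[symmetric] using t0 by simp
  have vw: "v = (w / t, (1 / t) *\<^sub>R V)" by (simp add: v_def)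
  have qq': "q + t *\<^sub>R v = q'" "q' + t *\<^sub>R (- v) = q" using tv by (simp_all add: q_def q'_def V_def)
  have cone: "\<Lambda> * \<bar>a\<bar> < b" using ab(1,3) by linarith
  have hq: "hor m (snd q - p) = X1" "hor m (snd q' - p) = X2"
      "ver m (snd q - p) = f X1" "ver m (snd q' - p) = g X2"
    by (simp_all only: q_def q'_def P1_def P2_def snd_conv frame_point_coordinates[OF m])
  have hv: "hor m (snd v) = a / t" "ver m (snd v) = b / t"
    by (simp_all add: vw hor_simps ver_simps V)
  have cone_v: "\<Lambda> * \<bar>a / t\<bar> < b / t"
    using cone t0 by (simp add: abs_divide divide_strict_right_mono)
  have cr: "crossing (q, v) t"
    unfolding crossing_def fst_conv snd_conv qq' hq hv using t0 X1 X2 cone_v by simp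
  \<comment> \<open>The way back is a crossing of the rotated strip, in which the starting side is
    the lower one; all results on crossings thus apply to it as well.\<close>
  have neg: "snd (- v) = - snd v" by simp
  have cr': "rot.crossing (q', - v) t"
    unfolding rot.crossing_def fst_conv snd_conv qq' hor_ver_neg neg linear_neg[OF hor_linear]
      linear_neg[OF ver_linear] hq hv
    using t0 X1 X2 cone_v by simp
  define e e' n n' where "e = e3 B q" and "e' = e3 B q'" and "n = axis B \<gamma> q" and "n' = axis B \<gamma> q'"
  note cn = crossing_normals[OF cr, unfolded fst_conv snd_conv qq' hq, folded \<psi>1_def \<psi>2_def]
  have ne: "norm e = 1" "norm e' = 1" using cn(1,2) by (simp_all add: e_def e'_def e3_def norm_Pair)
  have nn: "n \<bullet> n = 1" "n' \<bullet> n' = 1" using cn(1,2) by (simp_all add: n_def n'_def inner_axis_axis)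
  have n: "n = (s, - c *\<^sub>R (cis \<psi>1 * m))" "n' = (s, c *\<^sub>R (cis \<psi>2 * m))"
    unfolding n_def n'_def axis_def cn(3,4) by (simp_all add: s_def c_def flip: mult.assoc)
  have vn: "v \<bullet> n = 0"
  proof -
    have "(w, V) \<bullet> n = s * w - c * (a * cos \<psi>1 + b * sin \<psi>1)"
      by (simp add: n inner_hor_ver[OF m] V hor_ver_mult[OF m] hor_simps ver_simps) (simp add: algebra_simps)
    then have "(w, V) \<bullet> n = 0" using \<gamma> by (simp add: w_def sc)
    then show ?thesis unfolding v_def inner_scaleR_left by (simp only: mult_zero_right)
  qed
  have vn': "v \<bullet> n' = 0"
  proof -
    have "(w, V) \<bullet> n' = s * w + c * (a * cos \<psi>2 + b * sin \<psi>2)"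
      by (simp add: n inner_hor_ver[OF m] V hor_ver_mult[OF m] hor_simps ver_simps) (simp add: algebra_simps)
    also have "a * cos \<psi>2 + b * sin \<psi>2 = - (a * cos \<psi>1 + b * sin \<psi>1)"
      using balance by (simp add: algebra_simps)
    finally have "(w, V) \<bullet> n' = 0" using \<gamma> by (simp add: w_def sc) (simp add: algebra_simps)
    then show ?thesis unfolding v_def inner_scaleR_left by (simp only: mult_zero_right)
  qed
  have nn': "- (n \<bullet> n') = (cos (arctan \<gamma>))\<^sup>2 * cos (\<psi>2 - \<psi>1) - (sin (arctan \<gamma>))\<^sup>2"
    by (simp add: n inner_hor_ver[OF m] hor_ver_mult[OF m] hor_simps ver_simps cos_diff s_def c_def power2_eq_square)
      (simp add: algebra_simps)
  have T1: "billiard_map B \<gamma> (q, v) = (q', - v)"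
    using crossing_billiard_map[OF cr, of \<gamma>] vn' by (simp add: qq' n'_def)
  have T2: "billiard_map B \<gamma> (q', - v) = (q, v)"
  proof -
    have "billiard_map B \<gamma> (q', - v) = (q, (2 * ((- v) \<bullet> n)) *\<^sub>R n - (- v))"
      using rot.crossing_billiard_map[OF cr', of \<gamma>] unfolding fst_conv snd_conv qq' by (simp add: n_def)
    then show ?thesis using vn by simp
  qed
  have dom: "(q, v) \<in> billiard_domain B \<gamma>" "(q', - v) \<in> billiard_domain B \<gamma>" "(q, v) \<in> phase_space B"
    using crossing_in_billiard_domain[OF cr] rot.crossing_in_billiard_domain[OF cr'] nv by simp_all
  have per: "period_two B \<gamma> R (q, v)"
    unfolding period_two_def same_state_def using dom
    by (auto simp: T1 T2 numeral_2_eq_2 intro!: exI[of _ 0])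
  have orbit: "(billiard_map B \<gamma> ^^ i) (q, v) \<in> {(q, v), (q', - v)}" for i
    by (induction i) (auto simp: T1 T2)
  \<comment> \<open>A lower bound for the normal components of \<open>v\<close> at both ends. Times
    \<open>t\<close>, each of them is at least \<open>(b / 2) / (1 + \<Lambda>)\<close> in absolute
    value, while \<open>t \<le> 2 * b * (1 + 1 / \<gamma>)\<close>. The factor \<open>b\<close>
    cancels, so the bound does not depend on the length of the chord.\<close>
  define \<kappa> where "\<kappa> = 1 / (4 * (1 + \<Lambda>) * (1 + 1 / \<gamma>))"
  have \<kappa>0: "\<kappa> > 0" using \<Lambda> \<gamma> by (simp add: \<kappa>_def add_pos_pos)
  have t_le: "t \<le> 2 * b * (1 + 1 / \<gamma>)"
  proof -
    have nV: "norm V \<le> 2 * b" using norm_le_hor_ver[OF m, of V] ab by (simp add: V)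
    have "\<bar>a * cos \<psi>1 + b * sin \<psi>1\<bar> = \<bar>V \<bullet> (cis \<psi>1 * m)\<bar>"
      by (simp add: inner_hor_ver[OF m] V hor_ver_mult[OF m])
    also have "\<dots> \<le> norm V" using Cauchy_Schwarz_ineq2[of V "cis \<psi>1 * m"] by (simp add: norm_mult m)
    finally have "\<bar>w\<bar> \<le> 2 * b / \<gamma>" using \<gamma> nV by (simp add: w_def abs_divide divide_right_mono)
    then show ?thesis
      using norm_Pair_le[of w V] nV by (simp add: t_def algebra_simps)
  qed
  have ve: "v \<bullet> e \<ge> \<kappa>" "v \<bullet> e' \<le> - \<kappa>"
  proof -
    have key: "\<kappa> * t \<le> cos (arctan x) * (b - x * a)" if x: "\<bar>x\<bar> \<le> \<Lambda>" for x
    proof -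
      have "\<kappa> * t \<le> \<kappa> * (2 * b * (1 + 1 / \<gamma>))" using t_le \<kappa>0 by simp
      also have "\<dots> = (1 / (1 + \<Lambda>)) * (b / 2)"
      proof -
        have "1 + 1 / \<gamma> > 0" "1 + \<Lambda> > 0" using \<gamma> \<Lambda> by (auto intro: add_pos_pos)
        then show ?thesis unfolding \<kappa>_def by (simp add: divide_simps)
      qed
      also have "\<dots> \<le> cos (arctan x) * (b - x * a)"
      proof (rule mult_mono)
        have "x * a \<le> \<Lambda> * \<bar>a\<bar>"
          using x mult_right_mono[of "\<bar>x\<bar>" \<Lambda> "\<bar>a\<bar>"] abs_ge_self[of "x * a"] by (simp add: abs_mult)
        then show "b / 2 \<le> b - x * a" using ab by linarith
      qed (use cos_arctan_ge[OF x] ab cos_arctan_pos[of x] in auto)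
      finally show ?thesis .
    qed
    have "t * (v \<bullet> e) = (w, V) \<bullet> e" using tv by (metis inner_scaleR_left)
    also have "\<dots> = cos \<psi>1 * (b - f1 X1 * a)"
      unfolding e_def e3_def cn(3)
      by (simp add: inner_hor_ver[OF m] V hor_ver_mult[OF m] \<psi>1_def sin_arctan_cos_arctan)
        (simp add: algebra_simps)
    finally have "\<kappa> * t \<le> t * (v \<bullet> e)" using key[OF slope_f[OF X1]] by (simp add: \<psi>1_def)
    then show "v \<bullet> e \<ge> \<kappa>" using t0 by (simp add: mult.commute)
    have "t * (v \<bullet> e') = (w, V) \<bullet> e'" using tv by (metis inner_scaleR_left)
    also have "\<dots> = - (cos \<psi>2 * (b - g1 X2 * a))"
      unfolding e'_def e3_def cn(4)
      by (simp add: inner_hor_ver[OF m] V hor_ver_mult[OF m] hor_simps ver_simps \<psi>2_def sin_arctan_cos_arctan)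
        (simp add: algebra_simps)
    finally have "\<kappa> * t \<le> t * - (v \<bullet> e')" using key[OF slope_g[OF X2]] by (simp add: \<psi>2_def)
    then have "t * \<kappa> \<le> t * - (v \<bullet> e')" by (simp only: mult.commute[of t \<kappa>])
    then have "\<kappa> \<le> - (v \<bullet> e')" using mult_le_cancel_left_pos[OF t0] by blast
    then show "v \<bullet> e' \<le> - \<kappa>" by simp
  qed
  define \<pi> \<pi>' where "\<pi> x = x - ((x \<bullet> e) / (v \<bullet> e)) *\<^sub>R v"
    and "\<pi>' x = x - ((x \<bullet> e') / (v \<bullet> e')) *\<^sub>R v" for x :: vec3
  obtain k' where k': "norm k' \<le> \<bar>g2 X2\<bar>"
    "(billiard_map B \<gamma> has_derivative (\<lambda>(dq, dv). (\<pi>' (dq + t *\<^sub>R dv),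
        - dv - (2 * (k' \<bullet> \<pi>' (dq + t *\<^sub>R dv) - dv \<bullet> n')) *\<^sub>R n'))) (at (q, v) within phase_space B)"
    using flight_derivative[OF cr nv, of \<gamma>] vn' unfolding qq' hq \<pi>'_def e'_def n'_def by blast
  obtain k where k: "norm k \<le> \<bar>f2 X1\<bar>"
    "(billiard_map B \<gamma> has_derivative (\<lambda>(dq, dv). (\<pi> (dq + t *\<^sub>R dv),
        - dv - (2 * (k \<bullet> \<pi> (dq + t *\<^sub>R dv) - dv \<bullet> n)) *\<^sub>R n))) (at (q', - v) within phase_space B)"
  proof -
    have "norm (- v) = 1" "- v \<bullet> axis B \<gamma> (q' + t *\<^sub>R - v) = 0"
      using nv vn by (simp_all add: qq'(2)[simplified] n_def)
    from rot.flight_derivative[OF cr' this] show ?thesis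
      using that unfolding qq' hor_ver_neg hq \<pi>_def e_def n_def by fastforce
  qed
  define D1 where "D1 = (\<lambda>(dq, dv). (\<pi>' (dq + t *\<^sub>R dv), - dv - (2 * (k' \<bullet> \<pi>' (dq + t *\<^sub>R dv) - dv \<bullet> n')) *\<^sub>R n'))"
  define D2 where "D2 = (\<lambda>(dq, dv). (\<pi> (dq + t *\<^sub>R dv), - dv - (2 * (k \<bullet> \<pi> (dq + t *\<^sub>R dv) - dv \<bullet> n)) *\<^sub>R n))"
  have deriv: "((billiard_map B \<gamma> ^^ 2) has_derivative (\<lambda>d. D2 (D1 d))) (at (q, v) within phase_space B)"
  proof -
    obtain d where d: "d > 0" "\<And>\<eta>. \<eta> \<in> phase_space B \<Longrightarrow> \<eta> \<noteq> (q, v) \<Longrightarrow> dist \<eta> (q, v) < d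
        \<Longrightarrow> billiard_map B \<gamma> \<eta> \<in> phase_space B"
      using crossing_eventually_phase_space[OF cr, of \<gamma>] unfolding eventually_at by blast
    \<comment> \<open>The chain rule needs the first map to send its domain into the set within
      which the second is differentiated. This holds close to \<open>(q, v)\<close>, and passing to
      a ball does not change the derivative.\<close>
    define S where "S = phase_space B \<inter> ball (q, v) d"
    have S: "billiard_map B \<gamma> ` S \<subseteq> phase_space B"
      using d(2) dom(1) by (fastforce simp: S_def dist_commute billiard_domain_def)
    have at: "at (q, v) within phase_space B = at (q, v) within S"
      by (rule at_within_nhd[of _ "ball (q, v) d"]) (use d(1) in \<open>auto simp: S_def\<close>)
    have "(billiard_map B \<gamma> has_derivative D1) (at (q, v) within S)"
      using k'(2) unfolding at D1_def .
    moreover have "(billiard_map B \<gamma> has_derivative D2) (at (billiard_map B \<gamma> (q, v)) within billiard_map B \<gamma> ` S)"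
      using k(2) unfolding T1 D2_def by (rule has_derivative_subset[OF _ S])
    ultimately have "((\<lambda>x. billiard_map B \<gamma> (billiard_map B \<gamma> x)) has_derivative (\<lambda>d. D2 (D1 d))) (at (q, v) within S)"
      by (rule has_derivative_in_compose)
    then show ?thesis unfolding at by (simp add: numeral_2_eq_2 o_def)
  qed
  have err: "\<bar>t * (k \<bullet> \<pi> n')\<bar> \<le> \<epsilon>" "\<bar>t * (k' \<bullet> \<pi>' n)\<bar> \<le> \<epsilon>"
  proof -
    have K0: "0 \<le> K" using curv by linarith
    have 1: "norm n = 1" "norm n' = 1" using nn by (simp_all add: norm_eq_1)
    have "t * (K * (1 + 1 / \<kappa>)) \<le> 2 * b * (1 + 1 / \<gamma>) * (K * (1 + 1 / \<kappa>))"
      using t_le K0 \<kappa>0 by (intro mult_right_mono) auto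
    also have "\<dots> \<le> \<epsilon>" using \<epsilon> by (simp add: \<kappa>_def)
    finally have tK: "t * (K * (1 + 1 / \<kappa>)) \<le> \<epsilon>" .
    have "\<bar>k \<bullet> \<pi> n'\<bar> \<le> K * (1 + 1 / \<kappa>)" unfolding \<pi>_def
      using k(1) curv ve \<kappa>0 by (intro abs_inner_projection_le 1 nv ne) auto
    then have "t * \<bar>k \<bullet> \<pi> n'\<bar> \<le> t * (K * (1 + 1 / \<kappa>))"
      using t0 by (intro mult_left_mono) auto
    also note tK
    finally show "\<bar>t * (k \<bullet> \<pi> n')\<bar> \<le> \<epsilon>" using t0 by (simp add: abs_mult)
    have "\<bar>k' \<bullet> \<pi>' n\<bar> \<le> K * (1 + 1 / \<kappa>)" unfolding \<pi>'_def
      using k'(1) curv ve \<kappa>0 by (intro abs_inner_projection_le 1 nv ne) auto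
    then have "t * \<bar>k' \<bullet> \<pi>' n\<bar> \<le> t * (K * (1 + 1 / \<kappa>))"
      using t0 by (intro mult_left_mono) auto
    also note tK
    finally show "\<bar>t * (k' \<bullet> \<pi>' n)\<bar> \<le> \<epsilon>" using t0 by (simp add: abs_mult)
  qed
  have "0 < (- (n \<bullet> n') + t * (k \<bullet> \<pi> n')) * (- (n \<bullet> n') + t * (k' \<bullet> \<pi>' n)) \<and>
      (- (n \<bullet> n') + t * (k \<bullet> \<pi> n')) * (- (n \<bullet> n') + t * (k' \<bullet> \<pi>' n)) < 1"
    unfolding nn' using err by (intro good) simp_all
  note gg = conjunct1[OF this] conjunct2[OF this]
  have ve0: "v \<bullet> e \<noteq> 0" "v \<bullet> e' \<noteq> 0" using ve \<kappa>0 by auto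
  obtain A and \<mu> :: complex where A:
    "matrix_on {(dq, dv). dq \<bullet> e = 0 \<and> dv \<bullet> v = 0} (\<lambda>d. D2 (D1 d)) A" "\<mu> \<notin> \<real>" "norm \<mu> = 1"
    "\<And>z::complex. det (mat z - (\<chi> i j. of_real (A $ i $ j)) :: complex^4^4)
         = (z - 1)^2 * (z - \<mu>) * (z - cnj \<mu>)"
    by (rule two_bounces_spectrum[of v e e' n n' "\<lambda>d. D2 (D1 d)" D2 D1 t k' k, folded \<pi>_def \<pi>'_def])
      (use ve0 vn vn' nn gg in \<open>simp_all add: D1_def D2_def\<close>)
  have "elliptic B \<gamma> (q, v)"
    unfolding elliptic_def tangent_space_def fst_conv snd_conv e_def[symmetric]
    using deriv A by blast
  moreover have "snd (fst ((billiard_map B \<gamma> ^^ i) (q, v))) \<in> {P1, P2}" for i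
    using orbit[of i] by (auto simp: q_def q'_def)
  ultimately show ?thesis using per unfolding P1_def P2_def by blast
qed

end

section \<open>A corner is a strip\<close>

text \<open>Where \<open>x1\<close> is positive, \<open>x\<close> can be inverted, and
  \<open>f\<close> is \<open>y\<close> composed with the inverse. At the end point 0 only continuity
  of \<open>f\<close> and \<open>f1\<close> is recorded; the bound on \<open>f2\<close> up to the
  end point comes from its formula in terms of the curve, which is continuous on a compact
  interval.\<close>

lemma graph_of_regular_curve:
  fixes x x1 x2 y y1 y2 :: "real \<Rightarrow> real"
  assumes dx: "\<And>s. s \<in> {0..1} \<Longrightarrow> (x has_real_derivative x1 s) (at s within {0..1})"
    and dx1: "\<And>s. s \<in> {0..1} \<Longrightarrow> (x1 has_real_derivative x2 s) (at s within {0..1})"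
    and dy: "\<And>s. s \<in> {0..1} \<Longrightarrow> (y has_real_derivative y1 s) (at s within {0..1})"
    and dy1: "\<And>s. s \<in> {0..1} \<Longrightarrow> (y1 has_real_derivative y2 s) (at s within {0..1})"
    and c2: "continuous_on {0..1} x2" "continuous_on {0..1} y2"
    and 0: "x 0 = 0" "y 0 = 0" "x1 0 > 0"
  obtains \<sigma> \<delta> f f1 f2 M where "0 < \<sigma>" "\<sigma> < 1" "0 < \<delta>"
    "\<And>s. s \<in> {0..\<sigma>} \<Longrightarrow> 0 \<le> x s \<and> y s = f (x s)"
    "\<And>X. X \<in> {0..\<delta>} \<Longrightarrow> \<exists>s\<in>{0..\<sigma>}. x s = X"
    "continuous_on {0..\<delta>} f" "continuous_on {0..\<delta>} f1" "f 0 = 0" "f1 0 = y1 0 / x1 0"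
    "\<And>X. 0 < X \<Longrightarrow> X < \<delta> \<Longrightarrow> (f has_real_derivative f1 X) (at X)"
    "\<And>X. 0 < X \<Longrightarrow> X < \<delta> \<Longrightarrow> (f1 has_real_derivative f2 X) (at X)"
    "\<And>X. 0 \<le> X \<Longrightarrow> X \<le> \<delta> \<Longrightarrow> \<bar>f2 X\<bar> \<le> M"
proof -
  have cont: "continuous_on {0..1} x" "continuous_on {0..1} x1" "continuous_on {0..1} y" "continuous_on {0..1} y1"
    using DERIV_continuous_on[OF dx] DERIV_continuous_on[OF dx1] DERIV_continuous_on[OF dy] DERIV_continuous_on[OF dy1] by auto
  have "\<exists>d>0. \<forall>s\<in>{0..1}. dist s 0 < d \<longrightarrow> dist (x1 s) (x1 0) < x1 0"
    using cont(2) 0(3) unfolding continuous_on_iff by (metis atLeastAtMost_iff order_refl zero_le_one)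
  then obtain d where d: "d > 0" "\<And>s. s \<in> {0..1} \<Longrightarrow> dist s 0 < d \<Longrightarrow> dist (x1 s) (x1 0) < x1 0"
    by blast
  define \<sigma> where "\<sigma> = min (d / 2) (1 / 2)"
  have \<sigma>: "0 < \<sigma>" "\<sigma> < 1" "\<sigma> < d" using d(1) by (auto simp: \<sigma>_def)
  have sub: "{0..\<sigma>} \<subseteq> {0..1}" using \<sigma> by auto
  have x1pos: "x1 s > 0" if "s \<in> {0..\<sigma>}" for s
    using d(2)[of s] that \<sigma> by (auto simp: dist_real_def)
  note cont\<sigma> = cont[THEN continuous_on_subset, OF sub] c2[THEN continuous_on_subset, OF sub]
  have at: "at s within {0..1} = at s" if "s \<in> {0<..<\<sigma>}" for s
    using that \<sigma> by (intro at_within_Icc_at) auto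
  have incr: "x s < x s'" if "0 \<le> s" "s < s'" "s' \<le> \<sigma>" for s s'
  proof (rule DERIV_pos_imp_increasing_open[OF that(2)])
    show "\<exists>y. (x has_real_derivative y) (at u) \<and> 0 < y" if "s < u" "u < s'" for u
      using dx[of u] at[of u] x1pos[of u] that \<open>0 \<le> s\<close> \<open>s' \<le> \<sigma>\<close> \<sigma> by auto
    show "continuous_on {s..s'} x"
      by (rule continuous_on_subset[OF cont\<sigma>(1)]) (use that in auto)
  qed
  have inj: "inj_on x {0..\<sigma>}"
  proof (rule inj_onI)
    fix s s' assume "s \<in> {0..\<sigma>}" "s' \<in> {0..\<sigma>}" "x s = x s'"
    then show "s = s'" using incr[of s s'] incr[of s' s] by (cases s s' rule: linorder_cases) auto
  qed
  define \<delta> where "\<delta> = x \<sigma>"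
  have \<delta>: "\<delta> > 0" using incr[of 0 \<sigma>] \<sigma> 0 by (simp add: \<delta>_def)
  have range: "0 \<le> x s \<and> x s \<le> \<delta>" if "s \<in> {0..\<sigma>}" for s
    using incr[of 0 s] incr[of s \<sigma>] that 0 by (cases "s = 0"; cases "s = \<sigma>") (auto simp: \<delta>_def)
  have surj: "\<exists>s\<in>{0..\<sigma>}. x s = X" if "X \<in> {0..\<delta>}" for X
    using IVT'[of x 0 X \<sigma>] that 0 \<sigma> cont\<sigma>(1) by (auto simp: \<delta>_def)
  have img: "x ` {0..\<sigma>} = {0..\<delta>}" using range surj by (fastforce simp: image_iff)
  define S where "S = the_inv_into {0..\<sigma>} x"
  have Sx: "S (x s) = s" if "s \<in> {0..\<sigma>}" for s
    unfolding S_def by (rule the_inv_into_f_f[OF inj that])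
  have S: "S X \<in> {0..\<sigma>}" "x (S X) = X" if "X \<in> {0..\<delta>}" for X
    using surj[OF that] Sx by auto
  have S0: "S 0 = 0" using Sx[of 0] 0 \<sigma> by simp
  have Sin: "S X \<in> {0<..<\<sigma>}" if "X \<in> {0<..<\<delta>}" for X
  proof -
    have "S X \<noteq> 0" "S X \<noteq> \<sigma>" using S(2)[of X] that 0 by (auto simp: \<delta>_def)
    then show ?thesis using S(1)[of X] that by auto
  qed
  have contS: "continuous_on {0..\<delta>} S"
    using continuous_on_inv[OF cont\<sigma>(1), of S] Sx img by auto
  have DS: "(S has_real_derivative inverse (x1 (S X))) (at X)" if X: "X \<in> {0<..<\<delta>}" for X
  proof (rule DERIV_inverse_function[of x])
    show "(x has_real_derivative x1 (S X)) (at (S X))"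
      using dx[of "S X"] at[OF Sin[OF X]] Sin[OF X] \<sigma> by auto
    show "x1 (S X) \<noteq> 0" using x1pos[of "S X"] S(1)[of X] X by auto
    show "0 < X" "X < \<delta>" using X by auto
    show "x (S Y) = Y" if "0 < Y" "Y < \<delta>" for Y using S(2)[of Y] that by auto
    show "isCont S X"
      by (rule continuous_on_interior[OF contS]) (use X in auto)
  qed
  have chain: "((\<lambda>X. \<phi> (S X)) has_real_derivative \<phi>' / x1 (S X)) (at X)"
    if X: "X \<in> {0<..<\<delta>}" and \<phi>: "(\<phi> has_real_derivative \<phi>') (at (S X) within {0..1})" for \<phi> \<phi>' X
    using DERIV_chain2[OF _ DS[OF X], of \<phi> \<phi>'] \<phi> at[OF Sin[OF X]] by (simp add: divide_inverse)
  define f f1 f2 where "f X = y (S X)" and "f1 X = y1 (S X) / x1 (S X)"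
    and "f2 X = (y2 (S X) * x1 (S X) - y1 (S X) * x2 (S X)) / (x1 (S X))\<^sup>2 / x1 (S X)" for X
  have compS: "continuous_on {0..\<delta>} (\<lambda>X. \<phi> (S X))" if "continuous_on {0..\<sigma>} \<phi>" for \<phi> :: "real \<Rightarrow> real"
    by (rule continuous_on_compose2[OF that contS]) (use S in auto)
  have x1S: "x1 (S X) \<noteq> 0" if "X \<in> {0..\<delta>}" for X using x1pos[OF S(1)[OF that]] by simp
  have "continuous_on {0..\<delta>} f2" unfolding f2_def
    by (intro continuous_intros compS cont\<sigma>) (use x1S in auto)
  then have "bounded (f2 ` {0..\<delta>})"
    by (intro compact_imp_bounded compact_continuous_image) auto
  then obtain M where M: "\<forall>z\<in>f2 ` {0..\<delta>}. norm z \<le> M"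
    unfolding bounded_iff by blast
  show thesis
  proof (rule that[of \<sigma> \<delta> f f1 f2])
    show "0 < \<sigma>" "\<sigma> < 1" "0 < \<delta>" by fact+
    show "0 \<le> x s \<and> y s = f (x s)" if "s \<in> {0..\<sigma>}" for s
      using range[OF that] Sx[OF that] by (simp add: f_def)
    show "\<exists>s\<in>{0..\<sigma>}. x s = X" if "X \<in> {0..\<delta>}" for X using surj[OF that] .
    show "continuous_on {0..\<delta>} f" unfolding f_def by (intro compS cont\<sigma>)
    show "continuous_on {0..\<delta>} f1" unfolding f1_def
      by (intro continuous_on_divide compS cont\<sigma>) (use x1S in auto)
    show "f 0 = 0" "f1 0 = y1 0 / x1 0" by (simp_all add: f_def f1_def S0 0)
    show "(f has_real_derivative f1 X) (at X)" if "0 < X" "X < \<delta>" for X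
      unfolding f_def f1_def using that S(1)[of X] sub by (intro chain dy) auto
    show "(f1 has_real_derivative f2 X) (at X)" if X: "0 < X" "X < \<delta>" for X
      unfolding f1_def f2_def
    proof (rule chain)
      show "X \<in> {0<..<\<delta>}" using X by simp
      have "S X \<in> {0..1}" "x1 (S X) \<noteq> 0" using S(1)[of X] sub x1S[of X] X by auto
      then show "((\<lambda>s. y1 s / x1 s) has_real_derivative
          (y2 (S X) * x1 (S X) - y1 (S X) * x2 (S X)) / (x1 (S X))\<^sup>2) (at (S X) within {0..1})"
        using DERIV_divide[OF dy1 dx1, of "S X"] by (simp add: power2_eq_square)
    qed
    show "\<bar>f2 X\<bar> \<le> M" if "0 \<le> X" "X \<le> \<delta>" for X using M that by simp
  qed
qed


text \<open>Only an initial piece of the arc is a graph, but near \<open>p\<close> there is nothing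
  else of it. The parameter below 1 is kept because a smooth boundary point has to be an inner point
  of its arc.\<close>

lemma smooth_arc_graph:
  assumes c: "smooth_arc c" and start: "pathstart c = p" and m: "norm m = 1"
    and forward: "0 < hor m (velocity c 0)"
  obtains e \<delta> f f1 f2 M where "0 < e" "0 < \<delta>"
    "\<And>z. z \<in> ball p e \<Longrightarrow> z \<in> path_image c \<longleftrightarrow> 0 \<le> hor m (z - p) \<and> ver m (z - p) = f (hor m (z - p))"
    "\<And>z. z \<in> ball p e \<Longrightarrow> z \<in> path_image c \<Longrightarrow> \<exists>s\<in>{0..<1}. z = c s"
    "continuous_on {0..\<delta>} f" "continuous_on {0..\<delta>} f1" "f 0 = 0"
    "f1 0 = ver m (velocity c 0) / hor m (velocity c 0)"
    "\<And>X. 0 < X \<Longrightarrow> X < \<delta> \<Longrightarrow> (f has_real_derivative f1 X) (at X)"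
    "\<And>X. 0 < X \<Longrightarrow> X < \<delta> \<Longrightarrow> (f1 has_real_derivative f2 X) (at X)"
    "\<And>X. 0 \<le> X \<Longrightarrow> X \<le> \<delta> \<Longrightarrow> \<bar>f2 X\<bar> \<le> M"
proof -
  obtain d where d0: "d 0 = c"
    and d: "\<And>n t. t \<in> {0..1} \<Longrightarrow> (d n has_vector_derivative d (Suc n) t) (at t within {0..1})"
    using c by (auto simp: smooth_arc_def smooth_on_unit_def)
  have vel: "velocity c 0 = d 1 0"
    using d[of 0 0] unfolding velocity_def d0[symmetric]
    by (intro vector_derivative_within_closed_interval) auto
  have arc: "arc c" and c0: "c 0 = p" using c start by (auto simp: smooth_arc_def pathstart_def)
  have dh: "((\<lambda>s. hor m (d n s - u)) has_real_derivative hor m (d (Suc n) s)) (at s within {0..1})"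
    and dv: "((\<lambda>s. ver m (d n s - u)) has_real_derivative ver m (d (Suc n) s)) (at s within {0..1})"
    if "s \<in> {0..1}" for n s u
    using d[OF that, of n] unfolding has_vector_derivative_def has_field_derivative_def
    by (auto intro!: derivative_eq_intros simp: hor_simps ver_simps)
  have cd: "continuous_on {0..1} (d n)" for n
    unfolding continuous_on_eq_continuous_within
    using d[of _ n] has_vector_derivative_continuous by blast
  obtain \<sigma> \<delta> f f1 f2 M where g: "0 < \<sigma>" "\<sigma> < 1" "0 < \<delta>"
    "\<And>s. s \<in> {0..\<sigma>} \<Longrightarrow> 0 \<le> hor m (c s - p) \<and> ver m (c s - p) = f (hor m (c s - p))"
    "\<And>X. X \<in> {0..\<delta>} \<Longrightarrow> \<exists>s\<in>{0..\<sigma>}. hor m (c s - p) = X"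
    "continuous_on {0..\<delta>} f" "continuous_on {0..\<delta>} f1" "f 0 = 0" "f1 0 = ver m (d 1 0) / hor m (d 1 0)"
    "\<And>X. 0 < X \<Longrightarrow> X < \<delta> \<Longrightarrow> (f has_real_derivative f1 X) (at X)"
    "\<And>X. 0 < X \<Longrightarrow> X < \<delta> \<Longrightarrow> (f1 has_real_derivative f2 X) (at X)"
    "\<And>X. 0 \<le> X \<Longrightarrow> X \<le> \<delta> \<Longrightarrow> \<bar>f2 X\<bar> \<le> M"
  proof (rule graph_of_regular_curve[of "\<lambda>s. hor m (c s - p)" "\<lambda>s. hor m (d 1 s)" "\<lambda>s. hor m (d 2 s)"
      "\<lambda>s. ver m (c s - p)" "\<lambda>s. ver m (d 1 s)" "\<lambda>s. ver m (d 2 s)"])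
    fix s :: real assume s: "s \<in> {0..1}"
    show "((\<lambda>s. hor m (c s - p)) has_real_derivative hor m (d 1 s)) (at s within {0..1})"
      "((\<lambda>s. ver m (c s - p)) has_real_derivative ver m (d 1 s)) (at s within {0..1})"
      "((\<lambda>s. hor m (d 1 s)) has_real_derivative hor m (d 2 s)) (at s within {0..1})"
      "((\<lambda>s. ver m (d 1 s)) has_real_derivative ver m (d 2 s)) (at s within {0..1})"
      using dh[OF s, of 0 p] dv[OF s, of 0 p] dh[OF s, of 1 0] dv[OF s, of 1 0]
      by (simp_all add: d0 numeral_2_eq_2)
  next
    show "continuous_on {0..1} (\<lambda>s. hor m (d 2 s))" "continuous_on {0..1} (\<lambda>s. ver m (d 2 s))"
      by (intro continuous_intros cd)+
    show "hor m (c 0 - p) = 0" "ver m (c 0 - p) = 0"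
      by (simp_all add: c0 hor_simps ver_simps)
    show "0 < hor m (d 1 0)" using forward vel by simp
  qed (rule that)
  \<comment> \<open>Injectivity and compactness keep the remaining piece of the arc at a positive
    distance from \<open>p\<close>, even if it bends back.\<close>
  have "p \<notin> c ` {\<sigma>..1}"
  proof
    assume "p \<in> c ` {\<sigma>..1}"
    then obtain s where "s \<in> {\<sigma>..1}" "c s = c 0" using c0 by auto
    then have "s = 0" using arc g(1) by (intro inj_onD[of c "{0..1}"]) (auto simp: arc_def)
    then show False using \<open>s \<in> {\<sigma>..1}\<close> g(1) by simp
  qed
  moreover have "closed (c ` {\<sigma>..1})"
    using cd[of 0] g(1) by (intro compact_imp_closed compact_continuous_image)
      (auto simp: d0 intro: continuous_on_subset)
  ultimately obtain e1 where e1: "e1 > 0" "ball p e1 \<inter> c ` {\<sigma>..1} = {}"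
    using separate_point_closed[of "c ` {\<sigma>..1}" p] by (fastforce simp: ball_def)
  define e where "e = min e1 \<delta>"
  have param: "\<exists>s\<in>{0..\<sigma>}. s < 1 \<and> z = c s" if zb: "z \<in> ball p e" and zc: "z \<in> path_image c" for z
  proof -
    obtain s where s: "s \<in> {0..1}" "z = c s" using zc by (auto simp: path_image_def)
    then have "s < \<sigma>" using zb e1(2) by (force simp: e_def)
    then show ?thesis using s g(2) by auto
  qed
  show thesis
  proof (rule that[of e \<delta> f f1 f2 M])
    show "0 < e" using e1 g by (simp add: e_def)
    show "z \<in> path_image c \<longleftrightarrow> 0 \<le> hor m (z - p) \<and> ver m (z - p) = f (hor m (z - p))"
      if z: "z \<in> ball p e" for z
    proof
      assume "z \<in> path_image c"
      then show "0 \<le> hor m (z - p) \<and> ver m (z - p) = f (hor m (z - p))"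
        using param[OF z] g(4) by auto
    next
      assume r: "0 \<le> hor m (z - p) \<and> ver m (z - p) = f (hor m (z - p))"
      have "hor m (z - p) \<le> norm (z - p)"
        using Cauchy_Schwarz_ineq2[of "z - p" m] by (simp add: hor_eq_inner[OF m] m)
      also have "\<dots> \<le> \<delta>" using z by (simp add: e_def dist_norm norm_minus_commute)
      finally have "\<exists>s\<in>{0..\<sigma>}. hor m (c s - p) = hor m (z - p)" using r by (intro g(5)) auto
      then obtain s where s: "s \<in> {0..\<sigma>}" "hor m (c s - p) = hor m (z - p)" by blast
      then have "ver m (c s - p) = ver m (z - p)" using g(4)[OF s(1)] r by simp
      then have "c s = z" using s(2) frame_point_coordinates(3)[OF m, of p] by metis
      then show "z \<in> path_image c" using s(1) g(2) by (auto simp: path_image_def)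
    qed
    show "\<exists>s\<in>{0..<1}. z = c s" if "z \<in> ball p e" "z \<in> path_image c" for z
      using param[OF that] by auto
  qed (use g vel in auto)
qed

section \<open>Inside and outside near a corner\<close>

lemma connected_avoiding_frontier:
  assumes "connected S" "S \<inter> frontier B = {}" "z \<in> S" "w \<in> S"
  shows "z \<in> B \<longleftrightarrow> w \<in> B"
  using connected_Int_frontier[OF assms(1), of B] assms(2-4) by blast

lemma smooth_boundary_point_on_arc:
  assumes a: "smooth_arc a" and b: "compact (path_image b)" and ab: "path_image a \<inter> path_image b = {p}"
    and fr: "frontier B \<inter> ball p e = (path_image a \<union> path_image b) \<inter> ball p e"
    and z: "z \<in> ball p e" "z = a s" "z \<noteq> p" "0 < s" "s < 1"
  shows "smooth_boundary_point B z"
proof -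
  have "z \<in> path_image a" using z by (auto simp: path_image_def)
  then have "z \<in> ball p e \<inter> - path_image b" using ab z by auto
  moreover have "open (ball p e \<inter> - path_image b)"
    using compact_imp_closed[OF b] by (intro open_Int open_ball) (simp add: open_Compl)
  ultimately obtain \<eta> where "\<eta> > 0" "ball z \<eta> \<subseteq> ball p e \<inter> - path_image b"
    using open_contains_ball_eq by blast
  then have "frontier B \<inter> ball z \<eta> = path_image a \<inter> ball z \<eta>" using fr by blast
  then have "boundary_arc_through B z a s"
    using a z \<open>\<eta> > 0\<close> unfolding boundary_arc_through_def by metis
  then show ?thesis unfolding smooth_boundary_point_def by blast
qed

text \<open>The outside is recognised by one ray only: it makes everything but the wedge lie outside \<open>B\<close>,
  and the wedge cannot lie outside as well because \<open>p\<close> is a limit of interior points.\<close>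

lemma wedge_strip:
  fixes B :: "complex set" and p m :: complex
  assumes B: "closed_region B" and m: "norm m = 1" and \<delta>: "0 < \<delta>" and h: "0 < h"
    and p: "p \<in> frontier B" and fg0: "f 0 = 0" "g 0 = 0"
    and cont: "continuous_on {0..<\<delta>} f" "continuous_on {0..<\<delta>} g"
    and less: "\<And>X. 0 < X \<Longrightarrow> X < \<delta> \<Longrightarrow> f X < g X"
    and small: "\<And>X. 0 \<le> X \<Longrightarrow> X < \<delta> \<Longrightarrow> \<bar>f X\<bar> < h \<and> \<bar>g X\<bar> < h"
    and fr: "\<And>X Y. \<bar>X\<bar> < \<delta> \<Longrightarrow> \<bar>Y\<bar> < 2 * h \<Longrightarrow>
        frame_point p m X Y \<in> frontier B \<longleftrightarrow> 0 \<le> X \<and> (Y = f X \<or> Y = g X)"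
    and outside: "\<forall>\<^sub>F t in at_right 0. frame_point p m (- t) 0 \<notin> B"
  shows "0 < X \<Longrightarrow> X < \<delta> \<Longrightarrow> f X < Y \<Longrightarrow> Y < g X \<Longrightarrow> frame_point p m X Y \<in> interior B"
    and "0 < X \<Longrightarrow> X < \<delta> \<Longrightarrow> f X - h < Y \<Longrightarrow> Y < f X \<Longrightarrow> frame_point p m X Y \<notin> B"
    and "0 < X \<Longrightarrow> X < \<delta> \<Longrightarrow> g X < Y \<Longrightarrow> Y < g X + h \<Longrightarrow> frame_point p m X Y \<notin> B"
proof -
  have clB: "B = closure (interior B)" using B by (simp add: closed_region_def)
  then have "closed B" by (metis closed_closure)
  let ?P = "frame_point p m"
  have segment: "?P X Y \<notin> B"
    if "?P X' Y' \<notin> B"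
      and "\<And>u. 0 \<le> u \<Longrightarrow> u \<le> 1 \<Longrightarrow> ?P (X + u * (X' - X)) (Y + u * (Y' - Y)) \<notin> frontier B"
    for X Y X' Y'
  proof -
    let ?S = "(\<lambda>u. ?P (X + u * (X' - X)) (Y + u * (Y' - Y))) ` {0..1}"
    have "connected ?S"
      unfolding frame_point_def Complex_eq by (intro connected_continuous_image continuous_intros) simp
    moreover have "?P X Y \<in> ?S" by (rule image_eqI[of _ _ 0]) auto
    moreover have "?P X' Y' \<in> ?S" by (rule image_eqI[of _ _ 1]) auto
    moreover have "?S \<inter> frontier B = {}" using that(2) by auto
    ultimately show ?thesis using connected_avoiding_frontier that(1) by blast
  qed
  have le: "f X \<le> g X" if "0 \<le> X" "X < \<delta>" for X
    using less[of X] fg0 that by (cases "X = 0") auto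
  \<comment> \<open>The left half of the box is free of frontier points and convex, so one outside
    point on the ray decides for all of it.\<close>
  have left: "?P X Y \<notin> B" if "- \<delta> < X" "X < 0" "\<bar>Y\<bar> < 2 * h" for X Y
  proof -
    have "\<forall>\<^sub>F t in at_right 0. t \<in> {0<..<\<delta>}" by (rule eventually_at_right_real) fact
    with outside have "\<forall>\<^sub>F t in at_right (0::real). ?P (- t) 0 \<notin> B \<and> t \<in> {0<..<\<delta>}"
      by (rule eventually_conj)
    then obtain t where t: "?P (- t) 0 \<notin> B" "0 < t" "t < \<delta>"
      using eventually_happens'[OF trivial_limit_at_right_real] by fastforce
    show ?thesis
    proof (rule segment[OF t(1)])
      fix u :: real assume u: "0 \<le> u" "u \<le> 1"
      have c: "X + u * (- t - X) = (1 - u) * X + u * (- t)" by (simp add: algebra_simps)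
      have "X + u * (- t - X) < 0"
        unfolding c using convex_bound_lt[of X 0 "- t" "1 - u" u] that t u by simp
      moreover have "- (X + u * (- t - X)) < \<delta>"
        using convex_bound_lt[of "- X" \<delta> t "1 - u" u] that t u by (simp add: algebra_simps)
      moreover have "\<bar>Y + u * (0 - Y)\<bar> < 2 * h"
      proof -
        have "Y + u * (0 - Y) = (1 - u) * Y" by (simp add: algebra_simps)
        then have "\<bar>Y + u * (0 - Y)\<bar> \<le> 1 * \<bar>Y\<bar>"
          using u by (simp only: abs_mult) (intro mult_right_mono; simp)
        then show ?thesis using that by simp
      qed
      ultimately show "?P (X + u * (- t - X)) (Y + u * (0 - Y)) \<notin> frontier B"
        using fr by (simp add: abs_less_iff)
    qed
  qed
  \<comment> \<open>At heights of absolute value at least \<open>h\<close>, which the graphs do not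
    reach, a horizontal segment leads back to the left half. The points just beyond the graphs are
    then reached by vertical segments from the heights \<open>h\<close> and
    \<open>- h\<close>.\<close>
  have far: "?P X Y \<notin> B" if "0 \<le> X" "X < \<delta>" "h \<le> \<bar>Y\<bar>" "\<bar>Y\<bar> < 2 * h" for X Y
  proof (rule segment)
    show "?P (- \<delta> / 2) Y \<notin> B" using \<delta> that by (intro left) auto
    fix u :: real assume u: "0 \<le> u" "u \<le> 1"
    define Z where "Z = X + u * (- \<delta> / 2 - X)"
    have "Z = (1 - u) * X + u * (- \<delta> / 2)" by (simp add: Z_def algebra_simps)
    then have "Z < \<delta>" "- Z < \<delta>"
      using convex_bound_lt[of X \<delta> "- \<delta> / 2" "1 - u" u] convex_bound_lt[of "- X" \<delta> "\<delta> / 2" "1 - u" u] that \<delta> u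
      by (simp_all add: algebra_simps)
    moreover have "Y \<noteq> f Z" "Y \<noteq> g Z" if "0 \<le> Z"
      using small[OF that \<open>Z < \<delta>\<close>] \<open>h \<le> \<bar>Y\<bar>\<close> by auto
    ultimately show "?P (X + u * (- \<delta> / 2 - X)) (Y + u * (Y - Y)) \<notin> frontier B"
      unfolding Z_def[symmetric] using fr[of Z Y] that by (auto simp: abs_less_iff)
  qed
  have high: "?P X Y \<notin> B" if "0 \<le> X" "X < \<delta>" "g X < Y" "Y < 2 * h" for X Y
  proof (cases "h \<le> Y")
    case True then show ?thesis using far[of X Y] that h by auto
  next
    case False
    show ?thesis
    proof (rule segment)
      show "?P X h \<notin> B" using far[of X h] that h by simp
      fix u :: real assume u: "0 \<le> u" "u \<le> 1"
      have "Y + u * (h - Y) \<ge> Y" using False u by simp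
      moreover have "u * (h - Y) \<le> h - Y"
        using False u by (intro mult_left_le_one_le) auto
      then have "Y + u * (h - Y) \<le> h" by linarith
      moreover have "\<bar>g X\<bar> < h" using small that by simp
      ultimately show "?P (X + u * (X - X)) (Y + u * (h - Y)) \<notin> frontier B"
        using fr[of X "Y + u * (h - Y)"] that le[of X] by (auto simp: abs_less_iff)
    qed
  qed
  have low: "?P X Y \<notin> B" if "0 \<le> X" "X < \<delta>" "Y < f X" "- 2 * h < Y" for X Y
  proof (cases "Y \<le> - h")
    case True then show ?thesis using far[of X Y] that h by auto
  next
    case False
    show ?thesis
    proof (rule segment)
      show "?P X (- h) \<notin> B" using far[of X "- h"] that h by simp
      fix u :: real assume u: "0 \<le> u" "u \<le> 1"
      have "u * (- h - Y) \<le> 0" using False u by (intro mult_nonneg_nonpos) auto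
      moreover have "u * (Y + h) \<le> Y + h"
        using False u by (intro mult_left_le_one_le) auto
      then have "Y + u * (- h - Y) \<ge> - h" by (simp add: algebra_simps)
      moreover have "\<bar>f X\<bar> < h" using small that by simp
      ultimately show "?P (X + u * (X - X)) (Y + u * (- h - Y)) \<notin> frontier B"
        using fr[of X "Y + u * (- h - Y)"] that le[of X] by (auto simp: abs_less_iff)
    qed
  qed
  show "0 < X \<Longrightarrow> X < \<delta> \<Longrightarrow> f X - h < Y \<Longrightarrow> Y < f X \<Longrightarrow> ?P X Y \<notin> B"
    using small[of X] by (intro low) auto
  show "0 < X \<Longrightarrow> X < \<delta> \<Longrightarrow> g X < Y \<Longrightarrow> Y < g X + h \<Longrightarrow> ?P X Y \<notin> B"
    using small[of X] by (intro high) auto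
  assume XY: "0 < X" "X < \<delta>" "f X < Y" "Y < g X"
  obtain X0 Y0 where z: "0 < X0" "X0 < \<delta>" "f X0 < Y0" "Y0 < g X0" "?P X0 Y0 \<in> B"
  proof -
    have "p \<in> closure (interior B)"
      using p clB \<open>closed B\<close> by (metis DiffD1 closure_closed frontier_def)
    then obtain w where w: "w \<in> interior B" "dist w p < min \<delta> (2 * h)"
      using \<delta> h unfolding closure_approachable by (metis min_less_iff_conj mult_pos_pos zero_less_numeral)
    define X0 Y0 where "X0 = hor m (w - p)" and "Y0 = ver m (w - p)"
    have P0: "?P X0 Y0 = w" by (simp add: X0_def Y0_def frame_point_coordinates m)
    have "\<bar>X0\<bar> \<le> norm (w - p)" "\<bar>Y0\<bar> \<le> norm (w - p)"
      using abs_Re_le_cmod[of "(w - p) * cnj m"] abs_Im_le_cmod[of "(w - p) * cnj m"] m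
      by (simp_all add: X0_def Y0_def hor_def ver_def norm_mult)
    then have b: "\<bar>X0\<bar> < \<delta>" "\<bar>Y0\<bar> < 2 * h" using w(2) by (simp_all add: dist_norm)
    have wB: "w \<in> B" "w \<notin> frontier B" using w(1) interior_subset by (auto simp: frontier_def)
    have "0 \<le> X0" using left[of X0 Y0] b wB P0 by force
    moreover have "f X0 \<le> Y0" using low[of X0 Y0] b wB P0 calculation by force
    moreover have "Y0 \<le> g X0" using high[of X0 Y0] b wB P0 calculation by force
    moreover have "Y0 \<noteq> f X0" "Y0 \<noteq> g X0" using fr[OF b] wB P0 calculation by auto
    moreover from calculation have "X0 \<noteq> 0" using fg0 by auto
    ultimately show thesis using that[of X0 Y0] b wB P0 by auto
  qed
  \<comment> \<open>The wedge is a continuous image of a rectangle, hence connected. It avoids the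
    frontier, so the single point of \<open>B\<close> found in it decides for the whole
    wedge.\<close>
  let ?Q = "\<lambda>(X, u). ?P X (f X + u * (g X - f X))"
  let ?S = "?Q ` ({0<..<\<delta>} \<times> {0<..<1})"
  have "connected ?S"
  proof (rule connected_continuous_image)
    have c: "continuous_on ({0<..<\<delta>} \<times> {0<..<1::real}) (\<lambda>z. f (fst z))"
      "continuous_on ({0<..<\<delta>} \<times> {0<..<1::real}) (\<lambda>z. g (fst z))"
      by (rule continuous_on_compose2[OF cont(1)] continuous_on_compose2[OF cont(2)];
          auto intro!: continuous_intros)+
    show "continuous_on ({0<..<\<delta>} \<times> {0<..<1}) ?Q"
      unfolding case_prod_beta frame_point_def Complex_eq by (intro continuous_intros c)
    show "connected ({0<..<\<delta>} \<times> {0<..<1::real})" by (intro connected_Times) auto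
  qed
  moreover have mem: "?P X Y \<in> ?S" if "0 < X" "X < \<delta>" "f X < Y" "Y < g X" for X Y
    by (rule image_eqI[of _ _ "(X, (Y - f X) / (g X - f X))"]) (use that in auto)
  moreover have disj: "?S \<inter> frontier B = {}"
  proof -
    have "?P X (f X + u * (g X - f X)) \<notin> frontier B" if "0 < X" "X < \<delta>" "0 < u" "u < 1" for X u
    proof -
      have "0 < g X - f X" using less that by simp
      then have "0 < u * (g X - f X)" "u * (g X - f X) < 1 * (g X - f X)"
        using that by (auto intro!: mult_strict_right_mono)
      then show ?thesis
        using fr[of X "f X + u * (g X - f X)"] small[of X] that by (auto simp: abs_less_iff)
    qed
    then show ?thesis by auto
  qed
  ultimately have "?P X Y \<in> B" using connected_avoiding_frontier mem[OF z(1-4)] mem[OF XY] z(5) by blast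
  moreover have "?P X Y \<notin> frontier B" using disj mem[OF XY] by blast
  ultimately show "?P X Y \<in> interior B"
    using \<open>closed B\<close> by (auto simp: frontier_def closure_closed)
qed

lemma continuous_on_Icc_near_left:
  fixes f :: "real \<Rightarrow> real"
  assumes "continuous_on {0..d} f" "0 < d" "0 < e"
  obtains d' where "0 < d'" "d' \<le> d" "\<And>X. 0 \<le> X \<Longrightarrow> X < d' \<Longrightarrow> \<bar>f X - f 0\<bar> < e"
proof -
  have "0 \<in> {0..d}" using assms by simp
  then obtain c where c: "c > 0" "\<And>X. X \<in> {0..d} \<Longrightarrow> dist X 0 < c \<Longrightarrow> dist (f X) (f 0) < e"
    using assms(1,3) unfolding continuous_on_iff by blast
  show thesis
    by (rule that[of "min c d"]) (use c assms in \<open>auto simp: dist_real_def\<close>)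
qed

text \<open>Shows that the two sides can lie in the unexpected order only if their slopes at the
  corner agree.\<close>

lemma initial_slope_mono:
  fixes f g :: "real \<Rightarrow> real"
  assumes d: "0 < d" and cont: "continuous_on {0..d} f" "continuous_on {0..d} g"
      "continuous_on {0..d} f1" "continuous_on {0..d} g1"
    and df: "\<And>X. 0 < X \<Longrightarrow> X < d \<Longrightarrow> (f has_real_derivative f1 X) (at X)"
    and dg: "\<And>X. 0 < X \<Longrightarrow> X < d \<Longrightarrow> (g has_real_derivative g1 X) (at X)"
    and 0: "f 0 = g 0" and less: "\<And>X. 0 < X \<Longrightarrow> X < d \<Longrightarrow> f X < g X"
  shows "f1 0 \<le> g1 0"
proof (rule ccontr)
  assume "\<not> f1 0 \<le> g1 0"
  then obtain d' where d': "0 < d'" "d' \<le> d"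
      "\<And>X. 0 \<le> X \<Longrightarrow> X < d' \<Longrightarrow> \<bar>(f1 X - g1 X) - (f1 0 - g1 0)\<bar> < f1 0 - g1 0"
    using continuous_on_Icc_near_left[of d "\<lambda>X. f1 X - g1 X" "f1 0 - g1 0"] cont d
    by (auto intro: continuous_on_diff)
  have "f 0 - g 0 < f (d' / 2) - g (d' / 2)"
  proof (rule DERIV_pos_imp_increasing_open[of 0 "d' / 2" "\<lambda>X. f X - g X"])
    show "\<exists>y. ((\<lambda>X. f X - g X) has_real_derivative y) (at X) \<and> 0 < y" if "0 < X" "X < d' / 2" for X
      using DERIV_diff[OF df[of X] dg[of X]] d'(3)[of X] d'(1,2) that
      by (intro exI[of _ "f1 X - g1 X"]) (auto simp: abs_less_iff)
    show "continuous_on {0..d' / 2} (\<lambda>X. f X - g X)"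
      by (rule continuous_on_subset[of "{0..d}"]) (use cont d' in \<open>auto intro: continuous_on_diff\<close>)
  qed (use d' in simp)
  then show False using less[of "d' / 2"] d' 0 by simp
qed

lemma two_arcs_strip:
  assumes B: "closed_region B" and m: "norm m = 1"
    and arcs: "smooth_arc a" "smooth_arc b" "path_image a \<inter> path_image b = {p}"
      "pathstart a = p" "pathstart b = p"
    and e: "0 < e" and fr: "frontier B \<inter> ball p e = (path_image a \<union> path_image b) \<inter> ball p e"
    and outside: "\<forall>\<^sub>F t in at_right 0. p + of_real t * (- m) \<notin> B"
    and a: "\<And>z. z \<in> ball p e \<Longrightarrow> z \<in> path_image a \<longleftrightarrow> 0 \<le> hor m (z - p) \<and> ver m (z - p) = f (hor m (z - p))"
      "\<And>z. z \<in> ball p e \<Longrightarrow> z \<in> path_image a \<Longrightarrow> \<exists>s\<in>{0..<1}. z = a s"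
    and b: "\<And>z. z \<in> ball p e \<Longrightarrow> z \<in> path_image b \<longleftrightarrow> 0 \<le> hor m (z - p) \<and> ver m (z - p) = g (hor m (z - p))"
      "\<And>z. z \<in> ball p e \<Longrightarrow> z \<in> path_image b \<Longrightarrow> \<exists>s\<in>{0..<1}. z = b s"
    and d: "0 < d"
    and f: "continuous_on {0..d} f" "continuous_on {0..d} f1" "f 0 = 0"
      "\<And>X. 0 < X \<Longrightarrow> X < d \<Longrightarrow> (f has_real_derivative f1 X) (at X)"
      "\<And>X. 0 < X \<Longrightarrow> X < d \<Longrightarrow> (f1 has_real_derivative f2 X) (at X)"
    and g: "continuous_on {0..d} g" "continuous_on {0..d} g1" "g 0 = 0"
      "\<And>X. 0 < X \<Longrightarrow> X < d \<Longrightarrow> (g has_real_derivative g1 X) (at X)"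
      "\<And>X. 0 < X \<Longrightarrow> X < d \<Longrightarrow> (g1 has_real_derivative g2 X) (at X)"
    and less: "\<And>X. 0 < X \<Longrightarrow> X < d \<Longrightarrow> f X < g X"
  obtains \<delta> h \<Lambda> where "0 < \<delta>" "\<delta> \<le> d" "strip B p m 0 \<delta> h \<Lambda> f f1 f2 g g1 g2"
proof -
  \<comment> \<open>With \<open>\<delta> \<le> e / 2\<close> the box
    \<open>\<bar>X\<bar> < \<delta>\<close>, \<open>\<bar>Y\<bar> < 2 * h\<close> fits into the ball
    of radius \<open>e\<close>. As the graphs stay within height \<open>h\<close>, layers of height
    \<open>h\<close> beyond them remain in the box.\<close>
  define h where "h = e / 4"
  have h: "h > 0" using e by (simp add: h_def)
  obtain d1 where d1: "0 < d1" "d1 \<le> d" "\<And>X. 0 \<le> X \<Longrightarrow> X < d1 \<Longrightarrow> \<bar>f X\<bar> < h"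
    using continuous_on_Icc_near_left[OF f(1) d h] f(3) by auto
  obtain d2 where d2: "0 < d2" "d2 \<le> d" "\<And>X. 0 \<le> X \<Longrightarrow> X < d2 \<Longrightarrow> \<bar>g X\<bar> < h"
    using continuous_on_Icc_near_left[OF g(1) d h] g(3) by auto
  define \<delta> where "\<delta> = min (min d1 d2) (e / 2)"
  have \<delta>: "0 < \<delta>" "\<delta> \<le> d" "\<delta> \<le> d1" "\<delta> \<le> d2" "\<delta> \<le> e / 2"
    using d1 d2 e by (auto simp: \<delta>_def)
  have "bounded (f1 ` {0..d})" "bounded (g1 ` {0..d})"
    using f(2) g(2) by (auto intro!: compact_imp_bounded compact_continuous_image)
  then obtain \<Lambda>1 \<Lambda>2 where "\<forall>z\<in>f1 ` {0..d}. norm z \<le> \<Lambda>1" "\<forall>z\<in>g1 ` {0..d}. norm z \<le> \<Lambda>2"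
    unfolding bounded_iff by blast
  then have \<Lambda>: "\<bar>f1 X\<bar> \<le> max \<Lambda>1 \<Lambda>2" "\<bar>g1 X\<bar> \<le> max \<Lambda>1 \<Lambda>2" if "0 < X" "X < \<delta>" for X
    using that \<delta> by (auto simp: le_max_iff_disj)
  let ?P = "frame_point p m"
  have ball: "?P X Y \<in> ball p e" if "\<bar>X\<bar> < \<delta>" "\<bar>Y\<bar> < 2 * h" for X Y
    using norm_le_hor_ver[OF m, of "?P X Y - p"] that \<delta>(5)
    by (simp add: frame_point_coordinates[OF m] dist_norm norm_minus_commute h_def)
  have onA: "?P X Y \<in> path_image a \<longleftrightarrow> 0 \<le> X \<and> Y = f X"
    and onB: "?P X Y \<in> path_image b \<longleftrightarrow> 0 \<le> X \<and> Y = g X"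
    if "\<bar>X\<bar> < \<delta>" "\<bar>Y\<bar> < 2 * h" for X Y
    using a(1)[OF ball[OF that]] b(1)[OF ball[OF that]] by (simp_all add: frame_point_coordinates[OF m])
  have frP: "?P X Y \<in> frontier B \<longleftrightarrow> 0 \<le> X \<and> (Y = f X \<or> Y = g X)" if "\<bar>X\<bar> < \<delta>" "\<bar>Y\<bar> < 2 * h" for X Y
    using onA[OF that] onB[OF that] ball[OF that] fr by blast
  have Pne: "?P X Y \<noteq> p" if "0 < X" for X Y
    using frame_point_coordinates(1)[OF m, of p X Y] that linear_0[OF hor_linear, of m] by force
  have P00: "?P 0 0 = p" by (simp add: frame_point_def complex_eq_iff)
  have cpt: "compact (path_image a)" "compact (path_image b)"
    using arcs by (auto simp: smooth_arc_def arc_imp_path compact_path_image)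
  have smooth: "smooth_boundary_point B (?P X (f X))" "smooth_boundary_point B (?P X (g X))"
    if X: "0 < X" "X < \<delta>" for X
  proof -
    have bnd: "\<bar>X\<bar> < \<delta>" "\<bar>f X\<bar> < 2 * h" "\<bar>g X\<bar> < 2 * h"
      using d1(3)[of X] d2(3)[of X] X \<delta> by auto
    note za = ball[OF bnd(1,2)] and zb = ball[OF bnd(1,3)]
    obtain s where s: "s \<in> {0..<1}" "?P X (f X) = a s"
      using a(2)[OF za] onA[OF bnd(1,2)] X by auto
    have "s \<noteq> 0" using s Pne[OF X(1)] arcs(4) by (auto simp: pathstart_def)
    then show "smooth_boundary_point B (?P X (f X))"
      using s by (intro smooth_boundary_point_on_arc[OF arcs(1) cpt(2) arcs(3) fr za s(2) Pne[OF X(1)]]) auto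
    obtain s where s: "s \<in> {0..<1}" "?P X (g X) = b s"
      using b(2)[OF zb] onB[OF bnd(1,3)] X by auto
    have "s \<noteq> 0" using s Pne[OF X(1)] arcs(5) by (auto simp: pathstart_def)
    moreover have "path_image b \<inter> path_image a = {p}"
      "frontier B \<inter> ball p e = (path_image b \<union> path_image a) \<inter> ball p e"
      using arcs(3) fr by blast+
    ultimately show "smooth_boundary_point B (?P X (g X))"
      using s by (intro smooth_boundary_point_on_arc[OF arcs(2) cpt(1) _ _ zb s(2) Pne[OF X(1)]]) auto
  qed
  have "closed B" using B unfolding closed_region_def by (metis closed_closure)
  have pF: "p \<in> frontier B" using frP[of 0 0] \<delta>(1) h f(3) P00 by simp
  have out: "\<forall>\<^sub>F t in at_right 0. ?P (- t) 0 \<notin> B"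
  proof -
    have "?P (- t) 0 = p + of_real t * (- m)" for t
      by (simp add: frame_point_def complex_eq_iff)
    then show ?thesis using outside by simp
  qed
  have small: "\<bar>f X\<bar> < h \<and> \<bar>g X\<bar> < h" if "0 \<le> X" "X < \<delta>" for X
    using d1(3)[of X] d2(3)[of X] that \<delta> by auto
  have cont: "continuous_on {0..<\<delta>} f" "continuous_on {0..<\<delta>} g"
    using f(1) g(1) \<delta> by (auto elim!: continuous_on_subset)
  have less\<delta>: "f X < g X" if "0 < X" "X < \<delta>" for X using less that \<delta>(2) by simp
  have W: "0 < X \<Longrightarrow> X < \<delta> \<Longrightarrow> f X < Y \<Longrightarrow> Y < g X \<Longrightarrow> ?P X Y \<in> interior B"
    "0 < X \<Longrightarrow> X < \<delta> \<Longrightarrow> f X - h < Y \<Longrightarrow> Y < f X \<Longrightarrow> ?P X Y \<notin> B"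
    "0 < X \<Longrightarrow> X < \<delta> \<Longrightarrow> g X < Y \<Longrightarrow> Y < g X + h \<Longrightarrow> ?P X Y \<notin> B" for X Y
    using wedge_strip[OF B m \<delta>(1) h pF f(3) g(3) cont less\<delta> small frP out] by blast+
  have "strip B p m 0 \<delta> h (max \<Lambda>1 \<Lambda>2) f f1 f2 g g1 g2"
  proof (unfold_locales, goal_cases)
    case (12 X Y) then show ?case by (rule W(2))
  next
    case (13 X Y) then show ?case by (rule W(3))
  qed (use \<delta> in \<open>auto intro!: W(1) f g less \<Lambda> smooth m h \<open>closed B\<close>\<close>)
  then show thesis using that \<delta> by blast
qed

text \<open>The frame is directed along the bisector, so the tangents make the angles
  \<open>- \<phi> / 2\<close> and \<open>\<phi> / 2\<close> with it. These are less than a right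
  angle in absolute value because \<open>\<phi> < pi\<close>; this makes both sides graphs,
  including at a cusp.\<close>

lemma corner_strip:
  assumes B: "closed_region B" and corner: "corner_with_inner_angle B p \<phi>" and \<phi>: "\<phi> < pi"
  obtains m \<delta> h \<Lambda> K f f1 f2 g g1 g2 where "strip B p m 0 \<delta> h \<Lambda> f f1 f2 g g1 g2" "0 < \<delta>"
    "f 0 = 0" "g 0 = 0" "f1 0 = - tan (\<phi> / 2)" "g1 0 = tan (\<phi> / 2)"
    "continuous_on {0..\<delta>} f" "continuous_on {0..\<delta>} f1"
    "continuous_on {0..\<delta>} g" "continuous_on {0..\<delta>} g1"
    "\<And>X. 0 < X \<Longrightarrow> X < \<delta> \<Longrightarrow> \<bar>f2 X\<bar> \<le> K \<and> \<bar>g2 X\<bar> \<le> K"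
proof -
  obtain a b where \<phi>0: "0 \<le> \<phi>" and sides: "boundary_sides B p a b"
    and vb: "sgn (velocity b 0) = cis \<phi> * sgn (velocity a 0)"
    and out: "\<And>\<theta>. \<phi> < \<theta> \<Longrightarrow> \<theta> < 2 * pi \<Longrightarrow>
        \<forall>\<^sub>F t in at_right 0. p + of_real t * cis \<theta> * sgn (velocity a 0) \<notin> B"
    using corner unfolding corner_with_inner_angle_def by blast
  from sides have arcs: "smooth_arc a" "smooth_arc b" "pathstart a = p" "pathstart b = p"
      "path_image a \<inter> path_image b = {p}"
    and "\<exists>\<epsilon>>0. frontier B \<inter> ball p \<epsilon> = (path_image a \<union> path_image b) \<inter> ball p \<epsilon>"
    by (auto simp: boundary_sides_def)
  then obtain \<epsilon> where \<epsilon>: "\<epsilon> > 0" "frontier B \<inter> ball p \<epsilon> = (path_image a \<union> path_image b) \<inter> ball p \<epsilon>"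
    by blast
  define m where "m = cis (\<phi> / 2) * sgn (velocity a 0)"
  have v0: "velocity a 0 \<noteq> 0" "velocity b 0 \<noteq> 0" using arcs by (auto simp: smooth_arc_def)
  have m: "norm m = 1" using v0 by (simp add: m_def norm_mult norm_sgn)
  have va: "velocity a 0 = norm (velocity a 0) *\<^sub>R (cis (- (\<phi> / 2)) * m)"
    using v0 by (simp add: m_def sgn_div_norm cis_mult flip: mult.assoc)
  have vb': "velocity b 0 = norm (velocity b 0) *\<^sub>R (cis (\<phi> / 2) * m)"
  proof -
    have "cis (\<phi> / 2) * m = sgn (velocity b 0)" by (simp add: m_def vb cis_mult flip: mult.assoc)
    then show ?thesis using v0 by (simp add: sgn_div_norm)
  qed
  have half: "0 \<le> \<phi> / 2" "\<phi> / 2 < pi / 2" using \<phi>0 \<phi> by auto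
  have cos: "cos (\<phi> / 2) > 0" using half by (intro cos_gt_zero_pi) auto
  have ha: "hor m (velocity a 0) = norm (velocity a 0) * cos (\<phi> / 2)"
      "ver m (velocity a 0) = - (norm (velocity a 0) * sin (\<phi> / 2))"
    by (subst va, simp add: hor_simps ver_simps hor_ver_mult[OF m])+
  have hb: "hor m (velocity b 0) = norm (velocity b 0) * cos (\<phi> / 2)"
      "ver m (velocity b 0) = norm (velocity b 0) * sin (\<phi> / 2)"
    by (subst vb', simp add: hor_simps ver_simps hor_ver_mult[OF m])+
  define \<tau> where "\<tau> = tan (\<phi> / 2)"
  have \<tau>: "\<tau> \<ge> 0" using half by (auto simp: \<tau>_def tan_pos_pi2_le)
  have slopes: "ver m (velocity a 0) / hor m (velocity a 0) = - \<tau>" "ver m (velocity b 0) / hor m (velocity b 0) = \<tau>"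
    using v0 by (simp_all add: ha hb \<tau>_def tan_def)
  have "0 < hor m (velocity a 0)" "0 < hor m (velocity b 0)" using ha hb cos v0 by auto
  note fwd = this
  obtain ea da f f1 f2 Mf where fa: "0 < ea" "0 < da"
    "\<And>z. z \<in> ball p ea \<Longrightarrow> z \<in> path_image a \<longleftrightarrow> 0 \<le> hor m (z - p) \<and> ver m (z - p) = f (hor m (z - p))"
    "\<And>z. z \<in> ball p ea \<Longrightarrow> z \<in> path_image a \<Longrightarrow> \<exists>s\<in>{0..<1}. z = a s"
    "continuous_on {0..da} f" "continuous_on {0..da} f1" "f 0 = 0" "f1 0 = - \<tau>"
    "\<And>X. 0 < X \<Longrightarrow> X < da \<Longrightarrow> (f has_real_derivative f1 X) (at X)"
    "\<And>X. 0 < X \<Longrightarrow> X < da \<Longrightarrow> (f1 has_real_derivative f2 X) (at X)"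
    "\<And>X. 0 \<le> X \<Longrightarrow> X \<le> da \<Longrightarrow> \<bar>f2 X\<bar> \<le> Mf"
    using smooth_arc_graph[OF arcs(1,3) m fwd(1)] unfolding slopes by blast
  obtain eb db g g1 g2 Mg where gb: "0 < eb" "0 < db"
    "\<And>z. z \<in> ball p eb \<Longrightarrow> z \<in> path_image b \<longleftrightarrow> 0 \<le> hor m (z - p) \<and> ver m (z - p) = g (hor m (z - p))"
    "\<And>z. z \<in> ball p eb \<Longrightarrow> z \<in> path_image b \<Longrightarrow> \<exists>s\<in>{0..<1}. z = b s"
    "continuous_on {0..db} g" "continuous_on {0..db} g1" "g 0 = 0" "g1 0 = \<tau>"
    "\<And>X. 0 < X \<Longrightarrow> X < db \<Longrightarrow> (g has_real_derivative g1 X) (at X)"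
    "\<And>X. 0 < X \<Longrightarrow> X < db \<Longrightarrow> (g1 has_real_derivative g2 X) (at X)"
    "\<And>X. 0 \<le> X \<Longrightarrow> X \<le> db \<Longrightarrow> \<bar>g2 X\<bar> \<le> Mg"
    using smooth_arc_graph[OF arcs(2,4) m fwd(2)] unfolding slopes by blast
  define e where "e = min \<epsilon> (min ea eb)"
  have e: "0 < e" "ball p e \<subseteq> ball p \<epsilon>" "ball p e \<subseteq> ball p ea" "ball p e \<subseteq> ball p eb"
    using \<epsilon>(1) fa(1) gb(1) by (auto simp: e_def)
  have fr: "frontier B \<inter> ball p e = (path_image a \<union> path_image b) \<inter> ball p e"
    "frontier B \<inter> ball p e = (path_image b \<union> path_image a) \<inter> ball p e"
    using \<epsilon>(2) e(2) by blast+
  have ae: "\<And>z. z \<in> ball p e \<Longrightarrow> z \<in> path_image a \<longleftrightarrow> 0 \<le> hor m (z - p) \<and> ver m (z - p) = f (hor m (z - p))"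
    "\<And>z. z \<in> ball p e \<Longrightarrow> z \<in> path_image a \<Longrightarrow> \<exists>s\<in>{0..<1}. z = a s"
    using fa(3,4) e(3) by blast+
  have be: "\<And>z. z \<in> ball p e \<Longrightarrow> z \<in> path_image b \<longleftrightarrow> 0 \<le> hor m (z - p) \<and> ver m (z - p) = g (hor m (z - p))"
    "\<And>z. z \<in> ball p e \<Longrightarrow> z \<in> path_image b \<Longrightarrow> \<exists>s\<in>{0..<1}. z = b s"
    using gb(3,4) e(4) by blast+
  \<comment> \<open>The ray opposite to the bisector is the one at angle
    \<open>\<phi> / 2 + pi\<close> from the first side.\<close>
  have outside: "\<forall>\<^sub>F t in at_right 0. p + of_real t * (- m) \<notin> B"
  proof -
    have "cis (\<phi> / 2 + pi) * sgn (velocity a 0) = - m"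
      by (simp add: m_def flip: cis_mult)
    then show ?thesis using out[of "\<phi> / 2 + pi"] \<phi> \<phi>0 by (simp add: mult.assoc)
  qed
  \<comment> \<open>The arcs meet only at \<open>p\<close>, so the graphs do not meet over small
    positive \<open>X\<close>. By connectedness one of them then stays above the other.\<close>
  obtain d where d: "0 < d" "d \<le> da" "d \<le> db" "\<And>X. 0 < X \<Longrightarrow> X < d \<Longrightarrow> f X \<noteq> g X"
  proof -
    obtain d1 where d1: "0 < d1" "d1 \<le> da" "\<And>X. 0 \<le> X \<Longrightarrow> X < d1 \<Longrightarrow> \<bar>f X\<bar> < e / 2"
      using continuous_on_Icc_near_left[OF fa(5,2), of "e / 2"] fa(7) e(1) by auto
    show thesis
    proof (rule that[of "min (min d1 db) (e / 2)"])
      fix X assume X: "0 < X" "X < min (min d1 db) (e / 2)"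
      let ?z = "frame_point p m X (f X)"
      have c: "hor m (?z - p) = X" "ver m (?z - p) = f X" by (simp_all add: frame_point_coordinates[OF m])
      have z: "?z \<in> ball p e"
        using norm_le_hor_ver[OF m, of "?z - p"] d1(3)[of X] X
        by (simp add: c dist_norm norm_minus_commute)
      show "f X \<noteq> g X"
      proof
        assume "f X = g X"
        then have "?z \<in> path_image a" "?z \<in> path_image b"
          using ae(1)[OF z] be(1)[OF z] X unfolding c by simp_all
        then have "?z = p" using arcs(5) by blast
        then show False using c(1) X linear_0[OF hor_linear, of m] by simp
      qed
    qed (use d1 gb(2) e(1) in auto)
  qed
  have sub: "{0..d} \<subseteq> {0..da}" "{0..d} \<subseteq> {0..db}" using d by auto
  have fc: "continuous_on {0..d} f" "continuous_on {0..d} f1"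
    and gc: "continuous_on {0..d} g" "continuous_on {0..d} g1"
    using fa(5,6) gb(5,6) sub by (auto intro: continuous_on_subset)
  have fd: "\<And>X. 0 < X \<Longrightarrow> X < d \<Longrightarrow> (f has_real_derivative f1 X) (at X)"
    "\<And>X. 0 < X \<Longrightarrow> X < d \<Longrightarrow> (f1 has_real_derivative f2 X) (at X)"
    and gd: "\<And>X. 0 < X \<Longrightarrow> X < d \<Longrightarrow> (g has_real_derivative g1 X) (at X)"
    "\<And>X. 0 < X \<Longrightarrow> X < d \<Longrightarrow> (g1 has_real_derivative g2 X) (at X)"
    using fa(9,10) gb(9,10) d by auto
  have curv: "\<bar>f2 X\<bar> \<le> max Mf Mg \<and> \<bar>g2 X\<bar> \<le> max Mf Mg" if "0 < X" "X < d" for X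
    using fa(11)[of X] gb(11)[of X] d that by (auto simp: le_max_iff_disj)
  have "(\<forall>X. 0 < X \<and> X < d \<longrightarrow> f X < g X) \<or> (\<forall>X. 0 < X \<and> X < d \<longrightarrow> g X < f X)"
  proof (rule ccontr)
    assume "\<not> ?thesis"
    then obtain X X' where X: "0 < X" "X < d" "g X \<le> f X" and X': "0 < X'" "X' < d" "f X' \<le> g X'"
      by (auto simp: not_less)
    have "connected ((\<lambda>X. g X - f X) ` {0<..<d})"
      by (intro connected_continuous_image continuous_on_diff)
        (use fc gc in \<open>auto elim!: continuous_on_subset\<close>)
    then have "{g X - f X..g X' - f X'} \<subseteq> (\<lambda>X. g X - f X) ` {0<..<d}"
      using X X' by (intro connected_contains_Icc) auto
    then have "0 \<in> (\<lambda>X. g X - f X) ` {0<..<d}" using X X' by auto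
    then show False using d(4) by force
  qed
  then show thesis
  proof
    assume less: "\<forall>X. 0 < X \<and> X < d \<longrightarrow> f X < g X"
    obtain \<delta> h \<Lambda> where s: "0 < \<delta>" "\<delta> \<le> d" "strip B p m 0 \<delta> h \<Lambda> f f1 f2 g g1 g2"
      by (rule two_arcs_strip[OF B m arcs(1,2,5,3,4) e(1) fr(1) outside ae be d(1) fc fa(7) fd gc gb(7) gd])
        (use less in blast)+
    show thesis
      by (rule that[OF s(3,1) fa(7) gb(7) fa(8)[unfolded \<tau>_def] gb(8)[unfolded \<tau>_def], of "max Mf Mg"])
        (use s(2) curv fc gc in \<open>auto elim!: continuous_on_subset\<close>)
  next
    assume less: "\<forall>X. 0 < X \<and> X < d \<longrightarrow> g X < f X"
    \<comment> \<open>Only possible at a cusp, where the order of the two sides is not determined.\<close>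
    have ba: "path_image b \<inter> path_image a = {p}" using arcs(5) by blast
    obtain \<delta> h \<Lambda> where s: "0 < \<delta>" "\<delta> \<le> d" "strip B p m 0 \<delta> h \<Lambda> g g1 g2 f f1 f2"
      by (rule two_arcs_strip[OF B m arcs(2,1) ba arcs(4,3) e(1) fr(2) outside be ae d(1) gc gb(7) gd fc fa(7) fd])
        (use less in blast)+
    have "g1 0 \<le> f1 0"
      by (rule initial_slope_mono[OF d(1) gc(1) fc(1) gc(2) fc(2) gd(1) fd(1)]) (use fa(7) gb(7) less in auto)
    then have "\<tau> = 0" using fa(8) gb(8) \<tau> by simp
    then have "g1 0 = - tan (\<phi> / 2)" "f1 0 = tan (\<phi> / 2)" using fa(8) gb(8) by (simp_all add: \<tau>_def)
    then show thesis
      by (intro that[OF s(3,1) gb(7) fa(7), of "max Mf Mg"])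
        (use s(2) curv fc gc in \<open>auto elim!: continuous_on_subset\<close>)
  qed
qed

section \<open>Short chords across a corner\<close>

lemma abs_sin_cos_diff_le:
  fixes x y :: real
  shows "\<bar>sin x - sin y\<bar> \<le> \<bar>x - y\<bar>" "\<bar>cos x - cos y\<bar> \<le> \<bar>x - y\<bar>"
proof -
  have "norm (sin x - sin y) \<le> 1 * norm (x - y)"
    by (rule field_differentiable_bound[of UNIV sin cos]) (auto intro: DERIV_sin)
  then show "\<bar>sin x - sin y\<bar> \<le> \<bar>x - y\<bar>" by simp
  have "norm (cos x - cos y) \<le> 1 * norm (x - y)"
    by (rule field_differentiable_bound[of UNIV cos "\<lambda>x. - sin x"]) (auto intro: DERIV_cos)
  then show "\<bar>cos x - cos y\<bar> \<le> \<bar>x - y\<bar>" by simp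
qed

lemma product_near_square:
  fixes N :: real
  assumes N: "N \<noteq> 0" "\<bar>N\<bar> < 1"
  obtains \<rho> where "0 < \<rho>" "\<And>x y. \<bar>x - N\<bar> \<le> \<rho> \<Longrightarrow> \<bar>y - N\<bar> \<le> \<rho> \<Longrightarrow> 0 < x * y \<and> x * y < 1"
proof -
  define \<rho> where "\<rho> = min \<bar>N\<bar> (1 - \<bar>N\<bar>) / 2"
  have \<rho>: "0 < \<rho>" "\<rho> < \<bar>N\<bar>" "\<rho> < 1 - \<bar>N\<bar>" using N by (auto simp: \<rho>_def min_def)
  show thesis
  proof (rule that[OF \<rho>(1)])
    fix x y assume xy: "\<bar>x - N\<bar> \<le> \<rho>" "\<bar>y - N\<bar> \<le> \<rho>"
    have "0 < x \<and> 0 < y \<or> x < 0 \<and> y < 0" using xy \<rho> N(1) by linarith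
    then have "0 < x * y" by (auto intro: mult_pos_pos mult_neg_neg)
    moreover have "\<bar>x\<bar> < 1" "\<bar>y\<bar> < 1" using xy \<rho> by linarith+
    then have "\<bar>x\<bar> * \<bar>y\<bar> < 1 * 1" by (intro mult_strict_mono) auto
    then have "x * y < 1" by (simp flip: abs_mult)
    ultimately show "0 < x * y \<and> x * y < 1" by blast
  qed
qed

text \<open>With \<open>c\<close> the squared cosine, \<open>c * (1 + \<gamma>^2) = 1\<close> and
  \<open>N = c * (cos \<phi> - \<gamma>^2)\<close>, which vanishes only at the excluded angle. The
  lower bound is strict because \<open>\<phi> < pi\<close>, the upper one because
  \<open>\<gamma> > 0\<close>, even at a cusp.\<close>

lemma rotation_cosine_bounds:
  fixes \<gamma> \<phi> :: real
  assumes "0 < \<gamma>" "0 \<le> \<phi>" "\<phi> < pi" "cos \<phi> \<noteq> \<gamma>\<^sup>2"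
  defines "N \<equiv> (cos (arctan \<gamma>))\<^sup>2 * cos \<phi> - (sin (arctan \<gamma>))\<^sup>2"
  shows "N \<noteq> 0" "\<bar>N\<bar> < 1"
proof -
  define c where "c = (cos (arctan \<gamma>))\<^sup>2"
  have c: "0 < c" using cos_arctan_pos[of \<gamma>] by (simp add: c_def)
  have N: "N = c * (cos \<phi> - \<gamma>\<^sup>2)"
    by (simp add: N_def c_def sin_arctan_cos_arctan power_mult_distrib algebra_simps)
  then show "N \<noteq> 0" using c assms by simp
  have "c + (sin (arctan \<gamma>))\<^sup>2 = 1" by (simp add: c_def)
  then have one: "c + c * \<gamma>\<^sup>2 = 1" by (simp add: c_def sin_arctan_cos_arctan power_mult_distrib mult.commute)
  have "cos pi < cos \<phi>" using assms by (intro cos_monotone_0_pi) auto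
  then have "c * (-1) < c * cos \<phi>" using c by (intro mult_strict_left_mono) auto
  moreover have "c * cos \<phi> \<le> c * 1" using c by (intro mult_left_mono) auto
  moreover have "0 < c * \<gamma>\<^sup>2" using c assms by simp
  ultimately show "\<bar>N\<bar> < 1" using one by (simp add: N algebra_simps abs_less_iff)
qed

text \<open>The equation says that the chord makes equal angles with the two sides. Along the segment
  \<open>X + Y = r\<close> its left-hand side changes sign.\<close>

lemma chord_balance:
  fixes f f1 g g1 :: "real \<Rightarrow> real"
  assumes r: "0 < r" and \<Lambda>: "0 \<le> \<Lambda>" and \<eta>: "0 \<le> \<eta>" "2 * \<Lambda> * \<eta> \<le> 1"
    and cont: "continuous_on {0..r} f" "continuous_on {0..r} f1" "continuous_on {0..r} g" "continuous_on {0..r} g1"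
    and fg: "f 0 = 0" "g 0 = 0" "\<bar>f r\<bar> \<le> \<Lambda> * r" "\<bar>g r\<bar> \<le> \<Lambda> * r"
    and angles: "\<And>X Y. X \<in> {0..r} \<Longrightarrow> Y \<in> {0..r} \<Longrightarrow>
      0 < cos (arctan (f1 X)) + cos (arctan (g1 Y)) \<and>
      \<bar>sin (arctan (f1 X)) + sin (arctan (g1 Y))\<bar> \<le> \<eta> * (cos (arctan (f1 X)) + cos (arctan (g1 Y)))"
  obtains X Y where "0 < X" "X < r" "0 < Y" "Y < r"
    "(Y - X) * (cos (arctan (f1 X)) + cos (arctan (g1 Y)))
      + (g Y - f X) * (sin (arctan (f1 X)) + sin (arctan (g1 Y))) = 0"
proof -
  define S T where "S X Y = cos (arctan (f1 X)) + cos (arctan (g1 Y))"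
    and "T X Y = sin (arctan (f1 X)) + sin (arctan (g1 Y))" for X Y
  define H where "H u = (r * u - r * (1 - u)) * S (r * (1 - u)) (r * u)
      + (g (r * u) - f (r * (1 - u))) * T (r * (1 - u)) (r * u)" for u
  have unit: "r * u \<in> {0..r}" "r * (1 - u) \<in> {0..r}" if "u \<in> {0..1}" for u
    using that r by (auto simp: mult_le_cancel_left2)
  have c: "continuous_on {0..1} (\<lambda>u. \<phi> (r * u))" "continuous_on {0..1} (\<lambda>u. \<phi> (r * (1 - u)))"
    if "continuous_on {0..r} \<phi>" for \<phi> :: "real \<Rightarrow> real"
    using unit by (intro continuous_on_compose2[OF that] continuous_intros; blast)+
  have contH: "continuous_on {0..1} H"
    unfolding H_def S_def T_def by (intro continuous_intros c cont)
  \<comment> \<open>At the two ends of the segment one end of the chord is the corner, so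
    \<open>\<bar>Y - X\<bar> = r\<close> and the vertical extent is at most
    \<open>\<Lambda> * r\<close>. As \<open>\<Lambda> * \<eta> \<le> 1/2\<close>, the first term of
    \<open>H\<close> determines its sign there.\<close>
  have dom: "\<bar>z * T X Y\<bar> < r * S X Y" if "\<bar>z\<bar> \<le> \<Lambda> * r" "X \<in> {0..r}" "Y \<in> {0..r}" for z X Y
  proof -
    have S: "0 < S X Y" "\<bar>T X Y\<bar> \<le> \<eta> * S X Y" using angles[OF that(2,3)] by (auto simp: S_def T_def)
    have "\<bar>z * T X Y\<bar> \<le> (\<Lambda> * r) * (\<eta> * S X Y)"
      unfolding abs_mult using that(1) S(2) \<Lambda> r by (intro mult_mono) auto
    also have "\<dots> = (\<Lambda> * \<eta>) * (r * S X Y)" by simp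
    also have "\<dots> < 1 * (r * S X Y)"
      using \<eta>(2) r S(1) by (intro mult_strict_right_mono) auto
    finally show ?thesis by simp
  qed
  have in0: "0 \<in> {0..r}" "r \<in> {0..r}" using r by auto
  have H0: "H 0 < 0" using dom[of "- f r" r 0] fg in0 by (simp add: H_def)
  have H1: "0 < H 1" using dom[of "g r" 0 r] fg in0 by (simp add: H_def)
  obtain u where u: "0 \<le> u" "u \<le> 1" "H u = 0"
    using IVT'[OF _ _ _ contH, of 0] H0 H1 by force
  then have "u \<noteq> 0" "u \<noteq> 1" using H0 H1 by auto
  then have "0 < u" "u < 1" using u by auto
  then show thesis
    using u(3) r by (intro that[of "r * (1 - u)" "r * u"]) (auto simp: H_def S_def T_def)
qed


theorem theorem9p1:
  fixes B :: "complex set" and p :: complex and \<gamma> R \<phi> :: real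
  assumes "R > 0"
    and "0 < \<gamma>" and "\<gamma> \<le> 1"
    and "closed_region B"
    and "piecewise_smooth_boundary B"
    and "corner_with_inner_angle B p \<phi>"
    and "\<phi> < pi"
    and "cos \<phi> \<noteq> \<gamma>^2"
  shows "\<forall>W. open W \<and> p \<in> W \<longrightarrow>
           (\<exists>\<xi>. period_two B \<gamma> R \<xi> \<and>
                (\<forall>n. snd (fst ((billiard_map B \<gamma> ^^ n) \<xi>)) \<in> W) \<and>
                elliptic B \<gamma> \<xi>)"
proof (intro allI impI)
  fix W assume "open W \<and> p \<in> W"
  then obtain w where w: "0 < w" "ball p w \<subseteq> W" using open_contains_ball by blast
  have \<phi>: "0 \<le> \<phi>" "\<phi> < pi" using assms(6,7) by (auto simp: corner_with_inner_angle_def)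
  obtain m \<delta> h \<Lambda> K f f1 f2 g g1 g2 where strip: "strip B p m 0 \<delta> h \<Lambda> f f1 f2 g g1 g2"
    and \<delta>: "0 < \<delta>" and fg0: "f 0 = 0" "g 0 = 0" "f1 0 = - tan (\<phi> / 2)" "g1 0 = tan (\<phi> / 2)"
    and cont: "continuous_on {0..\<delta>} f" "continuous_on {0..\<delta>} f1"
      "continuous_on {0..\<delta>} g" "continuous_on {0..\<delta>} g1"
    and curv: "\<And>X. 0 < X \<Longrightarrow> X < \<delta> \<Longrightarrow> \<bar>f2 X\<bar> \<le> K \<and> \<bar>g2 X\<bar> \<le> K"
    by (rule corner_strip[OF assms(4,6,7)]) blast
  interpret strip B p m 0 \<delta> h \<Lambda> f f1 f2 g g1 g2 by (rule strip)
  have \<Lambda>: "0 \<le> \<Lambda>" using slope_f[of "\<delta> / 2"] \<delta> by simp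
  have K: "0 \<le> K" using curv[of "\<delta> / 2"] \<delta> by (auto dest: order_trans[OF abs_ge_zero])
  define N where "N \<psi> = (cos (arctan \<gamma>))\<^sup>2 * cos \<psi> - (sin (arctan \<gamma>))\<^sup>2" for \<psi>
  obtain \<rho> where \<rho>: "0 < \<rho>" "\<And>x y. \<bar>x - N \<phi>\<bar> \<le> \<rho> \<Longrightarrow> \<bar>y - N \<phi>\<bar> \<le> \<rho> \<Longrightarrow> 0 < x * y \<and> x * y < 1"
    unfolding N_def using product_near_square[OF rotation_cosine_bounds[OF assms(2) \<phi> assms(8)]] by blast
  define C where "C = cos (\<phi> / 2)"
  have C: "0 < C" unfolding C_def using \<phi> by (intro cos_gt_zero_pi) auto
  define \<eta> where "\<eta> = 1 / (2 * \<Lambda> + 1)"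
  have \<eta>: "0 < \<eta>" "\<eta> \<le> 1" "2 * \<Lambda> * \<eta> \<le> 1" using \<Lambda> by (auto simp: \<eta>_def divide_simps)
  \<comment> \<open>Tolerance for the tangent angles. At the corner the two sines cancel and the
    cosines add up to \<open>2 * C\<close>; so nearby the sines add up to at most
    \<open>2 * \<kappa> \<le> \<eta> * C\<close> in absolute value and the cosines to at least
    \<open>C\<close>. The bound \<open>\<rho> / 4\<close> costs half of \<open>\<rho>\<close>, as
    two angles enter \<open>\<psi>\<close>.\<close>
  define \<kappa> where "\<kappa> = min (\<rho> / 4) (\<eta> * C / 2)"
  have \<kappa>: "0 < \<kappa>" "\<kappa> \<le> \<rho> / 4" "2 * \<kappa> \<le> \<eta> * C" "2 * \<kappa> \<le> C"
  proof -
    show "0 < \<kappa>" "\<kappa> \<le> \<rho> / 4" "2 * \<kappa> \<le> \<eta> * C"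
      using \<rho>(1) \<eta>(1) C min.cobounded1[of "\<rho> / 4" "\<eta> * C / 2"] min.cobounded2[of "\<rho> / 4" "\<eta> * C / 2"]
      by (simp_all add: \<kappa>_def)
    moreover have "\<eta> * C \<le> 1 * C" using \<eta> C by (intro mult_right_mono) auto
    ultimately show "2 * \<kappa> \<le> C" by linarith
  qed
  \<comment> \<open>The coefficient of \<open>b\<close> in the error bound of
    \<open>elliptic_orbit\<close>. Heights below \<open>\<zeta>\<close> give
    \<open>b \<le> 2 * \<zeta>\<close>, so that the error stays below the other half of
    \<open>\<rho>\<close>.\<close>
  define D where "D = 2 * (1 + 1 / \<gamma>) * (K * (1 + 4 * (1 + \<Lambda>) * (1 + 1 / \<gamma>)))"
  have D: "0 \<le> D" using assms(2) K \<Lambda> by (auto simp: D_def intro!: mult_nonneg_nonneg add_nonneg_nonneg)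
  define \<zeta> where "\<zeta> = min (w / 2) (\<rho> / (4 * (D + 1)))"
  have \<zeta>: "0 < \<zeta>" "\<zeta> \<le> w / 2" "2 * \<zeta> * D \<le> \<rho> / 2"
  proof -
    show "0 < \<zeta>" using w(1) \<rho>(1) D by (simp add: \<zeta>_def)
    show "\<zeta> \<le> w / 2" unfolding \<zeta>_def by (rule min.cobounded1)
    have "\<zeta> \<le> \<rho> / (4 * (D + 1))" unfolding \<zeta>_def by (rule min.cobounded2)
    then have "\<zeta> * (4 * (D + 1)) \<le> \<rho>" using D by (simp add: pos_le_divide_eq)
    then show "2 * \<zeta> * D \<le> \<rho> / 2" using \<open>0 < \<zeta>\<close> by (simp add: algebra_simps)
  qed
  have at0: "arctan (f1 0) = - (\<phi> / 2)" "arctan (g1 0) = \<phi> / 2"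
    using \<phi> by (simp_all add: fg0 arctan_minus arctan_tan)
  obtain d1 where d1: "0 < d1" "d1 \<le> \<delta>" "\<And>X. 0 \<le> X \<Longrightarrow> X < d1 \<Longrightarrow> \<bar>f X\<bar> < \<zeta>"
    using continuous_on_Icc_near_left[OF cont(1) \<delta> \<zeta>(1)] fg0 by auto
  obtain d2 where d2: "0 < d2" "d2 \<le> \<delta>" "\<And>X. 0 \<le> X \<Longrightarrow> X < d2 \<Longrightarrow> \<bar>g X\<bar> < \<zeta>"
    using continuous_on_Icc_near_left[OF cont(3) \<delta> \<zeta>(1)] fg0 by auto
  obtain d3 where d3: "0 < d3" "d3 \<le> \<delta>" "\<And>X. 0 \<le> X \<Longrightarrow> X < d3 \<Longrightarrow> \<bar>arctan (f1 X) + \<phi> / 2\<bar> < \<kappa>"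
    using continuous_on_Icc_near_left[OF continuous_on_arctan[OF cont(2)] \<delta> \<kappa>(1)] unfolding at0 by auto
  obtain d4 where d4: "0 < d4" "d4 \<le> \<delta>" "\<And>X. 0 \<le> X \<Longrightarrow> X < d4 \<Longrightarrow> \<bar>arctan (g1 X) - \<phi> / 2\<bar> < \<kappa>"
    using continuous_on_Icc_near_left[OF continuous_on_arctan[OF cont(4)] \<delta> \<kappa>(1)] unfolding at0 by auto
  define r where "r = min (min d1 d2) (min (min d3 d4) w) / 2"
  have r: "0 < r" "r < d1" "r < d2" "r < d3" "r < d4" "r \<le> w / 2" "r < \<delta>"
    using d1 d2 d3 d4 w(1) by (auto simp: r_def)
  have near: "\<bar>f X\<bar> < \<zeta>" "\<bar>g X\<bar> < \<zeta>" "\<bar>arctan (f1 X) + \<phi> / 2\<bar> < \<kappa>" "\<bar>arctan (g1 X) - \<phi> / 2\<bar> < \<kappa>"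
    if "X \<in> {0..r}" for X
    using d1(3)[of X] d2(3)[of X] d3(3)[of X] d4(3)[of X] that r by auto
  have contr: "continuous_on {0..r} f" "continuous_on {0..r} f1" "continuous_on {0..r} g" "continuous_on {0..r} g1"
    using cont r(7) by (auto elim!: continuous_on_subset)
  \<comment> \<open>The Lipschitz bounds of the strip leave out the corner; the mean value theorem
    reaches it with continuity alone at that end.\<close>
  have lin: "\<bar>u r\<bar> \<le> \<Lambda> * r"
    if u: "continuous_on {0..r} u" "u 0 = 0" "\<And>X. 0 < X \<Longrightarrow> X < \<delta> \<Longrightarrow> (u has_real_derivative u1 X) (at X)"
      "\<And>X. 0 < X \<Longrightarrow> X < \<delta> \<Longrightarrow> \<bar>u1 X\<bar> \<le> \<Lambda>" for u u1 :: "real \<Rightarrow> real"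
  proof -
    have "u differentiable (at X)" if "0 < X" "X < r" for X
      using u(3)[of X] that r(7) by (auto simp: real_differentiable_def)
    then obtain l z where z: "0 < z" "z < r" "(u has_real_derivative l) (at z)" "u r - u 0 = (r - 0) * l"
      using MVT[OF r(1) u(1)] by blast
    then have "l = u1 z" using u(3)[of z] r(7) by (intro DERIV_unique[OF z(3)]) auto
    then have "\<bar>l\<bar> \<le> \<Lambda>" using u(4)[of z] z r(7) by simp
    then show ?thesis using z(4) u(2) r(1) by (simp add: abs_mult mult.commute)
  qed
  obtain X1 X2 where X: "0 < X1" "X1 < r" "0 < X2" "X2 < r"
    "(X2 - X1) * (cos (arctan (f1 X1)) + cos (arctan (g1 X2)))
      + (g X2 - f X1) * (sin (arctan (f1 X1)) + sin (arctan (g1 X2))) = 0"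
    and angles: "0 < cos (arctan (f1 X1)) + cos (arctan (g1 X2)) \<and>
      \<bar>sin (arctan (f1 X1)) + sin (arctan (g1 X2))\<bar> \<le> \<eta> * (cos (arctan (f1 X1)) + cos (arctan (g1 X2)))"
  proof -
    have angles: "0 < cos (arctan (f1 X)) + cos (arctan (g1 Y)) \<and>
      \<bar>sin (arctan (f1 X)) + sin (arctan (g1 Y))\<bar> \<le> \<eta> * (cos (arctan (f1 X)) + cos (arctan (g1 Y)))"
      if "X \<in> {0..r}" "Y \<in> {0..r}" for X Y
    proof -
      define x y where "x = arctan (f1 X)" and "y = arctan (g1 Y)"
      have xy: "\<bar>x - (- (\<phi> / 2))\<bar> < \<kappa>" "\<bar>y - \<phi> / 2\<bar> < \<kappa>"
        using near(3)[OF that(1)] near(4)[OF that(2)] by (simp_all add: x_def y_def)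
      have "\<bar>cos x - C\<bar> < \<kappa>" "\<bar>cos y - C\<bar> < \<kappa>"
        using abs_sin_cos_diff_le(2)[of x "- (\<phi> / 2)"] abs_sin_cos_diff_le(2)[of y "\<phi> / 2"] xy
        by (simp_all add: C_def)
      then have cos: "C \<le> cos x + cos y" using \<kappa>(4) by linarith
      have "\<bar>sin x + sin (\<phi> / 2)\<bar> < \<kappa>" "\<bar>sin y - sin (\<phi> / 2)\<bar> < \<kappa>"
        using abs_sin_cos_diff_le(1)[of x "- (\<phi> / 2)"] abs_sin_cos_diff_le(1)[of y "\<phi> / 2"] xy by simp_all
      then have "\<bar>sin x + sin y\<bar> \<le> \<eta> * C" using \<kappa>(3) by linarith
      also have "\<dots> \<le> \<eta> * (cos x + cos y)" using cos \<eta>(1) by (intro mult_left_mono) auto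
      finally show ?thesis using cos C by (simp add: x_def y_def)
    qed
    obtain X1 X2 where X: "0 < X1" "X1 < r" "0 < X2" "X2 < r"
      "(X2 - X1) * (cos (arctan (f1 X1)) + cos (arctan (g1 X2)))
        + (g X2 - f X1) * (sin (arctan (f1 X1)) + sin (arctan (g1 X2))) = 0"
      by (rule chord_balance[OF r(1) \<Lambda> less_imp_le[OF \<eta>(1)] \<eta>(3) contr fg0(1,2)
            lin[OF contr(1) fg0(1) DERIV_f slope_f] lin[OF contr(3) fg0(2) DERIV_g slope_g] angles]) blast+
    then show thesis using that angles[of X1 X2] by simp
  qed
  have X1: "0 < X1" "X1 < \<delta>" "X1 \<in> {0..r}" and X2: "0 < X2" "X2 < \<delta>" "X2 \<in> {0..r}"
    using X r(7) by auto
  define a b where "a = X2 - X1" and "b = g X2 - f X1"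
  \<comment> \<open>This is the balance equation combined with the bound on the sum of sines. The
    absolute value of \<open>b\<close> is needed because its sign is not yet known.\<close>
  have a\<eta>: "\<bar>a\<bar> \<le> \<eta> * \<bar>b\<bar>"
  proof -
    let ?S = "cos (arctan (f1 X1)) + cos (arctan (g1 X2))" and ?T = "sin (arctan (f1 X1)) + sin (arctan (g1 X2))"
    have "a * ?S = - (b * ?T)" using X(5) by (simp add: a_def b_def)
    then have "\<bar>a\<bar> * ?S = \<bar>b\<bar> * \<bar>?T\<bar>" using angles by (metis abs_minus_cancel abs_mult abs_of_pos)
    also have "\<dots> \<le> \<bar>b\<bar> * (\<eta> * ?S)" using angles by (intro mult_left_mono) auto
    finally have "\<bar>a\<bar> * ?S \<le> (\<eta> * \<bar>b\<bar>) * ?S" by (simp only: mult_ac)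
    then show ?thesis using angles mult_le_cancel_right_pos[of ?S] by blast
  qed
  have \<Lambda>a: "2 * \<Lambda> * \<bar>a\<bar> \<le> \<bar>b\<bar>"
  proof -
    have "2 * \<Lambda> * \<bar>a\<bar> \<le> 2 * \<Lambda> * (\<eta> * \<bar>b\<bar>)" using a\<eta> \<Lambda> by (intro mult_left_mono) auto
    also have "\<dots> = (2 * \<Lambda> * \<eta>) * \<bar>b\<bar>" by simp
    also have "\<dots> \<le> 1 * \<bar>b\<bar>" using \<eta>(3) by (intro mult_right_mono) auto
    finally show ?thesis by simp
  qed
  \<comment> \<open>The end points lie over different abscissas, so \<open>f < g\<close> alone does
    not suffice. Moving along the upper graph costs at most
    \<open>\<Lambda> * \<bar>a\<bar> \<le> \<bar>b\<bar> / 2\<close>; hence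
    \<open>b > - \<bar>b\<bar> / 2\<close>, which forces \<open>b > 0\<close>.\<close>
  have b: "0 < b"
  proof -
    have "f X1 < g X1" using f_less_g[OF X1(1,2)] .
    moreover have "g X1 \<le> g X2 + \<Lambda> * \<bar>a\<bar>"
      using lipschitz(2)[OF X1(1,2) X2(1,2)] by (simp add: a_def abs_minus_commute)
    ultimately show ?thesis using \<Lambda>a by (simp add: b_def)
  qed
  have ab: "\<bar>a\<bar> \<le> b" "2 * \<Lambda> * \<bar>a\<bar> \<le> b"
  proof -
    have "\<eta> * \<bar>b\<bar> \<le> 1 * \<bar>b\<bar>" using \<eta>(2) by (intro mult_right_mono) auto
    then show "\<bar>a\<bar> \<le> b" using a\<eta> b by linarith
    show "2 * \<Lambda> * \<bar>a\<bar> \<le> b" using \<Lambda>a b by simp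
  qed
  have b\<zeta>: "b \<le> 2 * \<zeta>" using near(1)[OF X1(3)] near(2)[OF X2(3)] by (simp add: b_def)
  have eps: "2 * b * (1 + 1 / \<gamma>) * (K * (1 + 4 * (1 + \<Lambda>) * (1 + 1 / \<gamma>))) \<le> \<rho> / 2"
  proof -
    have "b * D \<le> 2 * \<zeta> * D" using b\<zeta> D by (intro mult_right_mono)
    moreover have "2 * b * (1 + 1 / \<gamma>) * (K * (1 + 4 * (1 + \<Lambda>) * (1 + 1 / \<gamma>))) = b * D"
      by (simp only: D_def mult_ac)
    ultimately show ?thesis using \<zeta>(3) by linarith
  qed
  define \<psi> where "\<psi> = arctan (g1 X2) - arctan (f1 X1)"
  have "\<bar>\<psi> - \<phi>\<bar> \<le> 2 * \<kappa>" using near(3)[OF X1(3)] near(4)[OF X2(3)] by (simp add: \<psi>_def)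
  then have "\<bar>cos \<psi> - cos \<phi>\<bar> \<le> \<rho> / 2" using abs_sin_cos_diff_le(2)[of \<psi> \<phi>] \<kappa>(2) by linarith
  moreover have "(cos (arctan \<gamma>))\<^sup>2 * \<bar>cos \<psi> - cos \<phi>\<bar> \<le> 1 * \<bar>cos \<psi> - cos \<phi>\<bar>"
    by (intro mult_right_mono) (auto simp: abs_square_le_1)
  moreover have "\<bar>N \<psi> - N \<phi>\<bar> = (cos (arctan \<gamma>))\<^sup>2 * \<bar>cos \<psi> - cos \<phi>\<bar>"
    by (simp add: N_def abs_mult flip: right_diff_distrib)
  ultimately have N: "\<bar>N \<psi> - N \<phi>\<bar> \<le> \<rho> / 2"
    by (metis mult_1 order_trans)
  have good: "0 < x * y \<and> x * y < 1"
    if "\<bar>x - N \<psi>\<bar> \<le> \<rho> / 2" "\<bar>y - N \<psi>\<bar> \<le> \<rho> / 2" for x y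
    using that N by (intro \<rho>(2)) linarith+
  have inW: "frame_point p m X Y \<in> W" if "X \<in> {0..r}" "\<bar>Y\<bar> < \<zeta>" for X Y
  proof -
    have "norm (frame_point p m X Y - p) < w"
      using norm_le_hor_ver[OF m, of "frame_point p m X Y - p"] that r(6) \<zeta>(2)
      by (simp add: frame_point_coordinates[OF m])
    then show ?thesis using w(2) by (auto simp: dist_norm norm_minus_commute)
  qed
  have "{frame_point p m X1 (f X1), frame_point p m X2 (g X2)} \<subseteq> W"
    using inW X1 X2 near by auto
  moreover have "\<exists>\<xi>. period_two B \<gamma> R \<xi> \<and>
     (\<forall>n. snd (fst ((billiard_map B \<gamma> ^^ n) \<xi>)) \<in> {frame_point p m X1 (f X1), frame_point p m X2 (g X2)}) \<and>
     elliptic B \<gamma> \<xi>"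
    by (rule elliptic_orbit[of \<gamma> X1 X2 K "\<rho> / 2" R, folded a_def b_def \<psi>_def N_def])
      (use assms(2) X1 X2 b ab X(5) curv eps good in \<open>auto simp: a_def b_def\<close>)
  ultimately show "\<exists>\<xi>. period_two B \<gamma> R \<xi> \<and>
      (\<forall>n. snd (fst ((billiard_map B \<gamma> ^^ n) \<xi>)) \<in> W) \<and> elliptic B \<gamma> \<xi>"
    by blast
qed

end
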